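(* Let $K$ be an algebraically closed field of characteristic $p > 0$, let $V$ be a $K$-vector space with $\dim V = n$ for some $n \geq 2$, and let $G = \operatorname{SL}(V)$. Let $u \in G$ be a unipotent element and suppose that the Jordan blocks of $u$ on $V$ have sizes $d_1, \ldots, d_t$ (listed with multiplicity), i.e. $V \downarrow K[u] = V_{d_1} \oplus \cdots \oplus V_{d_t}$, where $t \geq 1$ and $d_r \geq 1$ for all $1 \leq r \leq t$. Set $\alpha = \nu_p(\gcd(d_1, \ldots, d_t))$. Let $u_0$ be the action of $u$ on $V \otimes V^*$, and let $u_0''$ be the action of $u$ on the irreducible $G$-module $L_G(\varpi_1 + \varpi_{n-1})$. Then the Jordan block sizes of $u_0''$ are determined from those of $u_0$ as follows: (i) If $p \nmid n$, then $r_1(u_0'') = r_1(u_0) - 1$ and $r_m(u_0'') = r_m(u_0)$ for all $m \neq 1$. (ii) If $p \mid n$ and $\alpha = 0$, then $r_1(u_0'') = r_1(u_0) - 2$ and $r_m(u_0'') = r_m(u_0)$ for all $m \neq 1$. (iii) If $p \mid n$ and $\alpha > 0$: (a) If $p \mid \frac{n}{p^{\alpha}}$, then $r_{p^{\alpha}}(u_0'') = r_{p^{\alpha}}(u_0) - 2$, $r_{p^{\alpha}-1}(u_0'') = 2$ and $r_m(u_0'') = r_m(u_0)$ for all $m \neq p^{\alpha}, p^{\alpha} - 1$. (b) If $p \nmid \frac{n}{p^{\alpha}}$ and $p^{\alpha} > 2$, then $r_{p^{\alpha}}(u_0'') = r_{p^{\alpha}}(u_0) - 1$, $r_{p^{\alpha}-2}(u_0'')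 = 1$ and $r_m(u_0'') = r_m(u_0)$ for all $m \neq p^{\alpha}, p^{\alpha} - 2$. (c) If $p \nmid \frac{n}{p^{\alpha}}$ and $p^{\alpha} = 2$, then $r_{2}(u_0'') = r_{2}(u_0) - 1$ and $r_m(u_0'') = r_m(u_0)$ for all $m \neq 2$.
   Context: For a unipotent linear map $x$ and an integer $m \geq 1$, $r_m(x)$ denotes the number of Jordan blocks of size $m$ in the Jordan decomposition of $x$; here $m$ ranges over integers $\geq 1$. $\nu_p$ is the $p$-adic valuation on the integers: $\nu_p(a)$ is the largest $k \geq 0$ such that $p^k \mid a$. $K[u]$ is the group algebra of the cyclic $p$-group generated by $u$, and $V_d$ denotes the indecomposable $K[u]$-module of dimension $d$, on which $u$ acts as a single $d \times d$ unipotent Jordan block; $V \downarrow K[u]$ is the restriction of $V$ to $K[u]$. $L_G(\lambda)$ denotes the rational irreducible $G$-module with highest weight $\lambda$ (with respect to a fixed maximal torus and base of simple roots), and $\varpi_i$ is the fundamental dominant weight corresponding to the $i$-th simple root $\alpha_i$ in the standard Bourbaki labeling (for $n = 2$, $\varpi_1 + \varpi_{n-1} = 2\varpi_1$). *)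

theory Defs
  imports
    "Jordan_Normal_Form.VS_Connect"
    "Jordan_Normal_Form.Jordan_Normal_Form_Existence"
    "Jordan_Normal_Form.Jordan_Normal_Form_Uniqueness"
    "HOL-Computational_Algebra.Computational_Algebra"
begin

text \<open>
  The space \<open>V\<close> of dimension \<open>n\<close> is \<open>K\<^sup>n\<close>, so that \<open>SL(V)\<close> is the group \<open>SL\<^sub>n(K)\<close> of matrices, and a
  module of dimension \<open>N\<close> is given by a matrix representation on \<open>K\<^sup>N\<close>. Matrix indices start at 0.
\<close>

definition GL_grp :: "nat \<Rightarrow> 'a :: field mat monoid" where
  "GL_grp n = units_of (ring_mat TYPE('a) n ())"

definition SL_grp :: "nat \<Rightarrow> 'a :: field mat monoid" where
  "SL_grp n = (GL_grp n)\<lparr>carrier := {A \<in> carrier_mat n n. det A = 1}\<rparr>"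

definition unipotent_mat :: "'a :: field mat \<Rightarrow> bool" where
  "unipotent_mat A \<longleftrightarrow> (\<exists>n k. A \<in> carrier_mat n n \<and> (A - 1\<^sub>m n) ^\<^sub>m k = 0\<^sub>m n n)"


subsection \<open>Number of Jordan blocks of a given size\<close>

text \<open>
  The Jordan normal form is unique up to the order of the blocks, so the choice below does not
  matter; see \<open>jordan_block_count_eq\<close>. It exists for all square matrices over an algebraically
  closed field.
\<close>

definition jordan_block_count :: "nat \<Rightarrow> 'a :: field mat \<Rightarrow> nat" where
  "jordan_block_count m A = count_list (map fst (SOME n_as. jordan_nf A n_as)) m"

lemma jordan_nf_mset_unique:
  assumes "jordan_nf (A :: 'a :: field mat) n_as" "jordan_nf A m_bs"
  shows "mset n_as = mset m_bs"
proof (rule multiset_eqI)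
  fix x :: "nat \<times> 'a"
  obtain k ev where x: "x = (k, ev)" by (cases x)
  show "count (mset n_as) x = count (mset m_bs) x"
  proof (cases "k = 0")
    case True
    hence "x \<notin> set n_as" "x \<notin> set m_bs"
      using assms x unfolding jordan_nf_def by force+
    thus ?thesis by (metis count_mset_0_iff)
  next
    case False
    have "length (filter ((=) x) n_as) = length (filter ((=) x) m_bs)"
      using compute_nr_of_jordan_blocks[OF assms(1) False, of ev]
        compute_nr_of_jordan_blocks[OF assms(2) False, of ev] x by simp
    thus ?thesis by (simp only: count_mset count_list_eq_length_filter)
  qed
qed

lemma jordan_block_count_eq:
  assumes "jordan_nf A n_as"
  shows "jordan_block_count m A = count_list (map fst n_as) m"
proof -
  have "jordan_nf A (SOME n_as. jordan_nf A n_as)" using assms by (rule someI)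
  from jordan_nf_mset_unique[OF this assms]
  have "mset (map fst (SOME n_as. jordan_nf A n_as)) = mset (map fst n_as)" by simp
  thus ?thesis unfolding jordan_block_count_def by (metis count_mset)
qed


subsection \<open>Dual and tensor product\<close>

text \<open>The action of \<open>g\<close> on \<open>V\<^sup>*\<close>, with respect to the dual basis.\<close>

definition dual_mat :: "nat \<Rightarrow> 'a :: field mat \<Rightarrow> 'a mat" where
  "dual_mat n g = transpose_mat (inv\<^bsub>GL_grp n\<^esub> g)"

text \<open>
  The Kronecker product: the matrix of the tensor product of the endomorphisms \<open>A\<close> of \<open>K\<^sup>a\<close> and \<open>B\<close> of
  \<open>K\<^sup>b\<close> with respect to the basis of the \<open>e\<^sub>i \<otimes> f\<^sub>j\<close>, which has index \<open>i * b + j\<close>.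
\<close>

definition tensor_mat :: "'a :: field mat \<Rightarrow> 'a mat \<Rightarrow> 'a mat" where
  "tensor_mat A B = mat (dim_row A * dim_row B) (dim_col A * dim_col B)
     (\<lambda>(i, j). A $$ (i div dim_row B, j div dim_col B) * B $$ (i mod dim_row B, j mod dim_col B))"


subsection \<open>Rational irreducible modules of \<open>SL\<^sub>n(K)\<close>\<close>

text \<open>
  The polynomial functions of the matrix entries. As \<open>SL\<^sub>n(K)\<close> is closed in the space of all
  matrices, the regular functions on \<open>SL\<^sub>n(K)\<close> are their restrictions.
\<close>

inductive_set entry_polynomials :: "nat \<Rightarrow> ('a :: field mat \<Rightarrow> 'a) set" for n :: nat where
  const: "(\<lambda>_. c) \<in> entry_polynomials n"
| entry: "i < n \<Longrightarrow> j < n \<Longrightarrow> (\<lambda>A. A $$ (i, j)) \<in> entry_polynomials n"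
| add: "f \<in> entry_polynomials n \<Longrightarrow> g \<in> entry_polynomials n \<Longrightarrow>
    (\<lambda>A. f A + g A) \<in> entry_polynomials n"
| mult: "f \<in> entry_polynomials n \<Longrightarrow> g \<in> entry_polynomials n \<Longrightarrow>
    (\<lambda>A. f A * g A) \<in> entry_polynomials n"

definition rational_SL_rep :: "nat \<Rightarrow> nat \<Rightarrow> ('a :: field mat \<Rightarrow> 'a mat) \<Rightarrow> bool" where
  "rational_SL_rep n N \<rho> \<longleftrightarrow>
     \<rho> \<in> hom (SL_grp n) (GL_grp N) \<and>
     (\<forall>i<N. \<forall>j<N. \<exists>f \<in> entry_polynomials n. \<forall>g \<in> carrier (SL_grp n). \<rho> g $$ (i, j) = f g)"

definition irreducible_SL_rep :: "nat \<Rightarrow> nat \<Rightarrow> ('a :: field mat \<Rightarrow> 'a mat) \<Rightarrow> bool" where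
  "irreducible_SL_rep n N \<rho> \<longleftrightarrow> N > 0 \<and>
     (\<forall>W. subspace class_ring W (module_vec TYPE('a) N) \<and>
          (\<forall>g \<in> carrier (SL_grp n). \<forall>w \<in> W. \<rho> g *\<^sub>v w \<in> W)
        \<longrightarrow> W = {0\<^sub>v N} \<or> W = carrier_vec N)"

text \<open>
  Weights are taken with respect to the maximal torus of diagonal matrices, and the base of simple
  roots is \<open>\<alpha>\<^sub>i = \<epsilon>\<^sub>i - \<epsilon>\<^sub>i\<^sub>+\<^sub>1\<close>, so that the positive Borel subgroup consists of the upper triangular
  matrices. A weight is given as a character of the torus, and the sum of two weights is the
  pointwise product of characters.
\<close>

definition SL_torus :: "nat \<Rightarrow> 'a :: field mat set" where
  "SL_torus n = {t \<in> carrier (SL_grp n). diagonal_mat t}"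

definition SL_max_unipotent :: "nat \<Rightarrow> 'a :: field mat set" where
  "SL_max_unipotent n =
     {x \<in> carrier (SL_grp n). upper_triangular x \<and> (\<forall>i<n. x $$ (i, i) = 1)}"

text \<open>\<open>\<varpi>\<^sub>i = \<epsilon>\<^sub>1 + \<dots> + \<epsilon>\<^sub>i\<close> for \<open>1 \<le> i \<le> n - 1\<close>.\<close>

definition fundamental_weight :: "nat \<Rightarrow> 'a :: field mat \<Rightarrow> 'a" where
  "fundamental_weight i t = (\<Prod>j<i. t $$ (j, j))"

definition weight_add :: "('a mat \<Rightarrow> 'a) \<Rightarrow> ('a mat \<Rightarrow> 'a) \<Rightarrow> 'a :: field mat \<Rightarrow> 'a" where
  "weight_add \<chi> \<psi> t = \<chi> t * \<psi> t"

definition has_highest_weight ::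
    "nat \<Rightarrow> nat \<Rightarrow> ('a :: field mat \<Rightarrow> 'a mat) \<Rightarrow> ('a mat \<Rightarrow> 'a) \<Rightarrow> bool" where
  "has_highest_weight n N \<rho> \<chi> \<longleftrightarrow>
     (\<exists>v \<in> carrier_vec N. v \<noteq> 0\<^sub>v N \<and>
        (\<forall>x \<in> SL_max_unipotent n. \<rho> x *\<^sub>v v = v) \<and>
        (\<forall>t \<in> SL_torus n. \<rho> t *\<^sub>v v = \<chi> t \<cdot>\<^sub>v v))"

text \<open>
  \<open>\<rho>\<close> is a matrix representation affording \<open>L\<^sub>G(\<chi>)\<close>, which is determined by \<open>\<chi>\<close> up to isomorphism.
\<close>

definition is_L_SL :: "nat \<Rightarrow> ('a :: field mat \<Rightarrow> 'a) \<Rightarrow> nat \<Rightarrow> ('a mat \<Rightarrow> 'a mat) \<Rightarrow> bool" where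
  "is_L_SL n \<chi> N \<rho> \<longleftrightarrow>
     rational_SL_rep n N \<rho> \<and> irreducible_SL_rep n N \<rho> \<and> has_highest_weight n N \<rho> \<chi>"

end

theory Submission
  imports Defs "Jordan_Normal_Form.DL_Rank"
begin

unbundle no fps_syntax

text \<open>
  Identify \<open>V \<otimes> V\<^sup>*\<close> with the space of \<open>n \<times> n\<close> matrices, on which \<open>u\<close> acts by conjugation, and put
  \<open>\<delta> X = u X u\<^sup>-\<^sup>1 - X\<close>. Numbers of Jordan blocks of a unipotent map are second differences of the
  dimensions of the kernels of the powers of the map minus the identity
  (\<open>jordan_block_count_unipotent\<close>), so the dimensions for \<open>\<delta>\<close> have to be compared with those for the
  irreducible module.

  The module. \<open>L(\<varpi>\<^sub>1 + \<varpi>\<^sub>n\<^sub>-\<^sub>1)\<close> is the space of matrices of trace zero modulo the scalar matrices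
  in it (\<open>adjoint_module_model\<close>). Only the defining properties of the irreducible module are used:
  let \<open>v\<close> be a highest weight vector, and \<open>E\<close> the matrix unit of the highest root. The linear span of
  the pairs \<open>(g E g\<^sup>-\<^sup>1, g v)\<close> is a linear relation between matrices of trace zero and vectors of the
  module, and it has to be shown that a matrix is scalar if and only if its partner is zero. This
  holds because on both sides the highest weight vector has the same matrix coefficient
  \<open>g\<^sub>1\<^sub>1 \<sqdot> det(g\<^sub>i\<^sub>j)\<^sub>i\<^sub>,\<^sub>j\<^sub><\<^sub>n\<close>. On the module side, a one-parameter subgroup of the torus gives a linear
  map which sends every vector \<open>x v\<close> with \<open>x\<close> lower unitriangular to \<open>v\<close> (\<open>highest_coefficient_exists\<close>).
  Hence the coefficient is known on the big cell, and everywhere by density (\<open>SL_density\<close>).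

  Linear algebra. The kernel of \<open>(u - 1)\<^sup>k\<close> on the quotient comes from the traceless part of the
  preimage of the scalars under \<open>\<delta>\<^sup>k\<close>. So its dimension differs from that of the kernel of \<open>\<delta>\<^sup>k\<close> by
  three corrections, each 0 or 1 (\<open>kernel_dim_quotient\<close>): whether the identity is in the image of
  \<open>\<delta>\<^sup>k\<close>, whether some matrix that \<open>\<delta>\<^sup>k\<close> maps to a scalar has nonzero trace, and whether \<open>p\<close> divides
  \<open>n\<close>.

  The corrections. If \<open>p\<close> does not divide \<open>n\<close> they are immediate from \<open>tr 1 = n\<close>. Otherwise let
  \<open>q = p\<^sup>\<alpha>\<close>, the largest power of \<open>p\<close> that divides all block sizes. Then \<open>K[u]\<close> acts
  on each Jordan block through a quotient that is free over the image of \<open>K[u\<^sup>q]\<close>, with basis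
  \<open>1, u, \<dots>, u\<^sup>q\<^sup>-\<^sup>1\<close>. The projection \<open>w\<close> onto the component of \<open>1\<close> commutes with \<open>u\<^sup>q\<close>, has trace
  \<open>n/q\<close>, and its conjugates \<open>u\<^sup>i w u\<^sup>-\<^sup>i\<close> for \<open>i < q\<close> are the projections onto all components.
  In characteristic \<open>p\<close> their sum is \<open>\<delta>\<^sup>q\<^sup>-\<^sup>1 w\<close>, so \<open>\<delta>\<^sup>q\<^sup>-\<^sup>1 w = 1\<close> (\<open>unipotent_average\<close>,
  \<open>delta_pow_average\<close>). In a block whose size is not
  divisible by \<open>p q\<close> the same construction gives a matrix \<open>w'\<close> with \<open>\<delta>\<^sup>q w' = 0\<close> and nonzero trace
  (\<open>unipotent_centralizer_trace\<close>). As \<open>ker \<delta>\<^sup>k\<close> and \<open>im \<delta>\<^sup>k\<close> are orthogonal for the trace form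
  (\<open>trace_orthogonal\<close>), \<open>w'\<close> shows that \<open>1\<close> is in the image of \<open>\<delta>\<^sup>k\<close> exactly for \<open>k < q\<close>, and \<open>w\<close>
  shows that \<open>tr\<close> vanishes on \<open>ker \<delta>\<^sup>q\<^sup>-\<^sup>1\<close>; so the trace correction occurs exactly for \<open>k \<ge> q\<close>, and
  for \<open>k = q - 1\<close> if \<open>p\<close> does not divide \<open>n/q\<close>. Finally \<open>w\<close> makes all kernels grow by the same amount
  up to \<open>\<delta>\<^sup>q\<close> (\<open>kernel_dim_linear\<close>), so that \<open>V \<otimes> V\<^sup>*\<close> has no block of size less than \<open>q\<close>.
\<close>

section \<open>Dimensions of subspaces\<close>

definition lin_subspace :: "nat \<Rightarrow> 'a :: field vec set \<Rightarrow> bool" where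
  "lin_subspace n S \<longleftrightarrow> S \<subseteq> carrier_vec n \<and> 0\<^sub>v n \<in> S \<and>
     (\<forall>x \<in> S. \<forall>y \<in> S. x + y \<in> S) \<and> (\<forall>c. \<forall>x \<in> S. c \<cdot>\<^sub>v x \<in> S)"

definition sdim :: "nat \<Rightarrow> 'a :: field vec set \<Rightarrow> nat" where
  "sdim n S = vectorspace.dim class_ring ((module_vec TYPE('a) n)\<lparr>carrier := S\<rparr>)"

lemma lin_subspace_imp_subspace:
  "lin_subspace n S \<Longrightarrow> VectorSpace.subspace class_ring S (module_vec TYPE('a :: field) n)"
  unfolding lin_subspace_def subspace_def submodule_def
  by (auto simp: vec_vs vec_module class_ring_simps module_vec_simps)

lemma lin_subspace_vectorspace:
  fixes S :: "'a :: field vec set"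
  assumes "lin_subspace n S"
  shows "vectorspace class_ring ((module_vec TYPE('a) n)\<lparr>carrier := S\<rparr>)"
  by (rule vectorspace.subspace_is_vs[OF vec_vs lin_subspace_imp_subspace[OF assms]])

text \<open>
  A linearly independent subset of the subspace is linearly independent in the whole space, which
  bounds its size; so a maximal one exists, and it is a basis.
\<close>

lemma lin_subspace_fin_dim:
  fixes S :: "'a :: field vec set"
  assumes S: "lin_subspace n S"
  shows "vectorspace.fin_dim class_ring ((module_vec TYPE('a) n)\<lparr>carrier := S\<rparr>)"
proof -
  interpret V: vec_space "TYPE('a)" n .
  interpret S: vectorspace class_ring "(module_vec TYPE('a) n)\<lparr>carrier := S\<rparr>"
    by (rule lin_subspace_vectorspace[OF S])
  have sub: "submodule class_ring S (module_vec TYPE('a) n)"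
    using lin_subspace_imp_subspace[OF S] by (auto simp: subspace_def)
  have SC: "S \<subseteq> carrier_vec n" using S by (auto simp: lin_subspace_def)
  have li: "finite A \<and> card A \<le> V.dim" if "A \<subseteq> S" "S.lin_indpt A" for A
  proof -
    have "V.lin_indpt A" using that V.span_li_not_depend(2)[OF that(1) sub] by simp
    with V.li_le_dim[of A] V.fin_dim that(1) SC show ?thesis by auto
  qed
  have "\<exists>A. finite A \<and> maximal A (\<lambda>A. A \<subseteq> S \<and> S.lin_indpt A)"
    by (rule maximal_exists[where ?N = V.dim and ?B = "{}"])
       (use li in \<open>auto simp: S.lin_dep_def\<close>)
  then obtain A where "finite A" "maximal A (\<lambda>A. A \<subseteq> S \<and> S.lin_indpt A)" by blast
  moreover have "S.basis A" by (rule S.max_li_is_basis) (use calculation in auto)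
  ultimately show ?thesis unfolding S.fin_dim_def S.basis_def by auto
qed

lemma rank_nullity_subspace:
  fixes S :: "'a :: field vec set" and R :: "'a vec set"
  assumes S: "lin_subspace n S" and R: "lin_subspace m R"
    and add: "\<And>x y. x \<in> S \<Longrightarrow> y \<in> S \<Longrightarrow> T (x + y) = T x + T y"
    and smult: "\<And>c x. x \<in> S \<Longrightarrow> T (c \<cdot>\<^sub>v x) = c \<cdot>\<^sub>v T x"
    and surj: "T ` S = R"
  shows "sdim n S = sdim m R + sdim n {x \<in> S. T x = 0\<^sub>v m}"
proof -
  let ?S = "(module_vec TYPE('a) n)\<lparr>carrier := S\<rparr>"
  let ?R = "(module_vec TYPE('a) m)\<lparr>carrier := R\<rparr>"
  interpret S: vectorspace class_ring ?S by (rule lin_subspace_vectorspace[OF S])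
  interpret R: vectorspace class_ring ?R by (rule lin_subspace_vectorspace[OF R])
  have hom: "T \<in> LinearCombinations.module_hom class_ring ?S ?R"
    unfolding module_hom_def using add smult surj
    by (auto simp: module_vec_simps class_ring_simps)
  interpret L: linear_map class_ring ?S ?R T
    by unfold_locales (rule hom)
  have "vectorspace.dim class_ring (?R\<lparr>carrier := L.imT\<rparr>) +
      vectorspace.dim class_ring (?S\<lparr>carrier := L.kerT\<rparr>) = vectorspace.dim class_ring ?S"
    by (rule L.rank_nullity[OF lin_subspace_fin_dim[OF S]])
  moreover have "L.imT = R" using surj by (auto simp: L.im_def)
  moreover have "L.kerT = {x \<in> S. T x = 0\<^sub>v m}" by (auto simp: L.ker_def module_vec_simps)
  ultimately show ?thesis unfolding sdim_def by simp
qed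

lemma lin_subspace_mat_kernel:
  assumes "A \<in> carrier_mat m n"
  shows "lin_subspace n (mat_kernel A)"
  using assms unfolding lin_subspace_def
  by (auto simp: mat_kernel mult_add_distrib_mat_vec mult_mat_vec)

lemma kernel_dim_eq_sdim:
  "A \<in> carrier_mat m n \<Longrightarrow> kernel_dim A = sdim n (mat_kernel A)"
  unfolding kernel_dim_def sdim_def by (simp add: carrier_matD)

lemma lin_subspace_carrier: "lin_subspace n (carrier_vec n)"
  unfolding lin_subspace_def by auto

lemma sdim_carrier: "sdim n (carrier_vec n :: 'a :: field vec set) = n"
proof -
  interpret V: vec_space "TYPE('a)" n .
  have "(module_vec TYPE('a) n)\<lparr>carrier := carrier_vec n\<rparr> = module_vec TYPE('a) n"
    by (simp add: module_vec_def)
  thus ?thesis unfolding sdim_def using V.dim_is_n by metis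
qed

text \<open>
  Rank-nullity for a functional: its kernel has codimension 0 or 1. This is the source of the 0-1
  corrections in \<open>kernel_dim_quotient\<close>.
\<close>

lemma sdim_functional:
  fixes S :: "'a :: field vec set" and f :: "'a vec \<Rightarrow> 'a"
  assumes S: "lin_subspace n S"
    and add: "\<And>x y. x \<in> S \<Longrightarrow> y \<in> S \<Longrightarrow> f (x + y) = f x + f y"
    and smult: "\<And>c x. x \<in> S \<Longrightarrow> f (c \<cdot>\<^sub>v x) = c * f x"
  shows "sdim n S = sdim n {x \<in> S. f x = 0} + (if \<exists>x \<in> S. f x \<noteq> 0 then 1 else 0)"
proof (cases "\<exists>x \<in> S. f x \<noteq> 0")
  case True
  then obtain a where a: "a \<in> S" "f a \<noteq> 0" by auto
  have "sdim n S = sdim 1 (carrier_vec 1 :: 'a vec set) + sdim n {x \<in> S. vec 1 (\<lambda>_. f x) = 0\<^sub>v 1}"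
  proof (rule rank_nullity_subspace[OF S lin_subspace_carrier])
    show "(\<lambda>x. vec 1 (\<lambda>_. f x)) ` S = carrier_vec 1"
    proof (intro equalityI subsetI)
      fix y :: "'a vec" assume y: "y \<in> carrier_vec 1"
      have "(y $ 0 / f a) \<cdot>\<^sub>v a \<in> S" using S a by (auto simp: lin_subspace_def)
      moreover have "vec 1 (\<lambda>_. f ((y $ 0 / f a) \<cdot>\<^sub>v a)) = y"
        using y a smult[OF a(1)] by (intro eq_vecI) auto
      ultimately show "y \<in> (\<lambda>x. vec 1 (\<lambda>_. f x)) ` S" by (metis imageI)
    qed auto
  qed (auto simp: add smult intro!: eq_vecI)
  also have "{x \<in> S. vec 1 (\<lambda>_. f x) = 0\<^sub>v 1} = {x \<in> S. f x = 0}"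
    by (auto simp: vec_eq_iff)
  finally show ?thesis using True by (simp add: sdim_carrier)
next
  case False
  hence "{x \<in> S. f x = 0} = S" by auto
  with False show ?thesis by simp
qed

lemma sdim_zero: "sdim n {0\<^sub>v n :: 'a :: field vec} = 0"
proof -
  have "lin_subspace n {0\<^sub>v n :: 'a vec}" by (auto simp: lin_subspace_def)
  from rank_nullity_subspace[OF this this, of "\<lambda>x. x"] have
    "sdim n {0\<^sub>v n :: 'a vec} = sdim n {0\<^sub>v n :: 'a vec} + sdim n {x \<in> {0\<^sub>v n :: 'a vec}. x = 0\<^sub>v n}" by simp
  moreover have "{x \<in> {0\<^sub>v n :: 'a vec}. x = 0\<^sub>v n} = {0\<^sub>v n}" by auto
  ultimately show ?thesis by simp
qed

section \<open>Jordan blocks and kernels of powers\<close>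

lemma mat_of_cols_first_invertible:
  fixes v :: "'a :: field vec"
  assumes v: "v \<in> carrier_vec n" "v \<noteq> 0\<^sub>v n"
  obtains W W' where "W \<in> carrier_mat n n" "W' \<in> carrier_mat n n" "W * W' = 1\<^sub>m n" "W' * W = 1\<^sub>m n"
    "col W 0 = v"
proof -
  interpret V: vec_space "TYPE('a)" n .
  note b = V.basis_completion[OF v]
  let ?b = "basis_completion v"
  define W where "W = mat_of_cols n ?b"
  have n: "n > 0" using v by (cases n) auto
  have W: "W \<in> carrier_mat n n" unfolding W_def using b(6) mat_of_cols_carrier(1)[of n ?b] by simp
  have c: "cols W = ?b" unfolding W_def by (rule cols_mat_of_cols[OF b(2)])
  have "det W \<noteq> 0"
  proof
    assume "det W = 0"
    from det_0_iff_vec_prod_zero_field[OF W] this obtain x where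
      x: "x \<in> carrier_vec n" "x \<noteq> 0\<^sub>v n" "W *\<^sub>v x = 0\<^sub>v n" by auto
    have "V.lin_dep (set (cols W))"
      by (rule V.lin_depI[OF W x]) (use b(4) c in simp)
    with b(5) c show False by simp
  qed
  then obtain W' where W': "W' \<in> carrier_mat n n" "W * W' = 1\<^sub>m n" "W' * W = 1\<^sub>m n"
    using det_non_zero_imp_unit[OF W, of "()"] by (auto simp: Units_def ring_mat_simps)
  have "col W 0 = hd ?b"
    using n b(6) c W by (metis carrier_matD(2) cols_nth hd_conv_nth length_greater_0_conv)
  hence "col W 0 = v" using b(7) by simp
  with that W W' show ?thesis by blast
qed

lemma similar_upper_triangular:
  fixes A :: "'a :: alg_closed_field mat"
  assumes "A \<in> carrier_mat n n"
  shows "\<exists>B. similar_mat A B \<and> upper_triangular B"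
  using assms
proof (induction n arbitrary: A)
  case 0
  thus ?case by (intro exI[of _ A]) (auto intro: similar_mat_refl)
next
  case (Suc n A)
  have "degree (char_poly A) > 0" using degree_monic_char_poly[OF Suc.prems] by simp
  then obtain e where "poly (char_poly A) e = 0" using alg_closed_imp_poly_has_root by blast
  hence "eigenvalue A e" using eigenvalue_root_char_poly[OF Suc.prems] by simp
  then obtain v where v: "v \<in> carrier_vec (Suc n)" "v \<noteq> 0\<^sub>v (Suc n)" "A *\<^sub>v v = e \<cdot>\<^sub>v v"
    using Suc.prems unfolding eigenvalue_def eigenvector_def by auto
  from mat_of_cols_first_invertible[OF v(1,2)] obtain W W' where
    W: "W \<in> carrier_mat (Suc n) (Suc n)" "W' \<in> carrier_mat (Suc n) (Suc n)"
       "W * W' = 1\<^sub>m (Suc n)" "W' * W = 1\<^sub>m (Suc n)" "col W 0 = v" .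
  define A' where "A' = W' * A * W"
  have A': "A' \<in> carrier_mat (Suc n) (Suc n)" using W Suc.prems by (auto simp: A'_def)
  have "similar_mat_wit A' A W' W"
    by (rule similar_mat_witI[of _ _ "Suc n"]) (use W A' Suc.prems in \<open>auto simp: A'_def\<close>)
  hence sim: "similar_mat A A'" by (meson similar_mat_def similar_mat_sym)
  have "col A' 0 = W' *\<^sub>v (A *\<^sub>v v)"
    unfolding A'_def col_mult2[OF mult_carrier_mat[OF W(2) Suc.prems] W(1) zero_less_Suc] W(5)
    by (rule assoc_mult_mat_vec[OF W(2) Suc.prems v(1)])
  also have "\<dots> = e \<cdot>\<^sub>v (W' *\<^sub>v v)" unfolding v(3) by (rule mult_mat_vec[OF W(2) v(1)])
  also have "W' *\<^sub>v v = col (W' * W) 0"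
    using W(5) by (subst col_mult2[OF W(2) W(1)]) auto
  also have "\<dots> = unit_vec (Suc n) 0" using W by simp
  finally have col0: "col A' 0 = e \<cdot>\<^sub>v unit_vec (Suc n) 0" .
  obtain A1 A2 A0 A3 where split: "split_block A' 1 1 = (A1, A2, A0, A3)"
    by (metis prod_cases4)
  have d: "dim_row A' = 1 + n" "dim_col A' = 1 + n" using A' by auto
  note sb = split_block[OF split d]
  have A0: "A0 = 0\<^sub>m n 1"
  proof (rule eq_matI)
    fix i j assume ij: "i < dim_row (0\<^sub>m n 1 :: 'a mat)" "j < dim_col (0\<^sub>m n 1 :: 'a mat)"
    have "A0 $$ (i, j) = A' $$ (Suc i, 0)"
      using ij split d by (auto simp: split_block_def Let_def)
    also have "\<dots> = col A' 0 $ Suc i" using ij d by simp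
    finally show "A0 $$ (i, j) = 0\<^sub>m n 1 $$ (i, j)" using ij col0 by simp
  qed (use sb in auto)
  from Suc.IH[OF sb(4)] obtain B P Q where
    B: "similar_mat_wit A3 B P Q" "upper_triangular B" by (auto simp: similar_mat_def)
  note BD = similar_mat_witD2[OF sb(4) B(1)]
  have "similar_mat_wit (four_block_mat A1 A2 A0 A3) (four_block_mat A1 (A2 * P) A0 B)
      (four_block_mat (1\<^sub>m 1) (0\<^sub>m 1 n) (0\<^sub>m n 1) P) (four_block_mat (1\<^sub>m 1) (0\<^sub>m 1 n) (0\<^sub>m n 1) Q)"
  proof (rule similar_mat_wit_four_block[OF similar_mat_wit_refl[OF sb(1)] B(1)])
    show "A2 = 1\<^sub>m 1 * (A2 * P) * Q"
      using BD sb(2) by (simp add: assoc_mult_mat[of _ 1 n _ n _ n])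
    show "A0 = P * A0 * 1\<^sub>m 1" using A0 BD by simp
  qed (use sb BD in auto)
  hence "similar_mat A' (four_block_mat A1 (A2 * P) A0 B)"
    unfolding similar_mat_def sb(5)[symmetric] by blast
  moreover have "upper_triangular (four_block_mat A1 (A2 * P) A0 B)"
    unfolding A0 by (rule upper_triangular_four_block[OF sb(1) BD(5) _ B(2)]) (use sb in auto)
  ultimately show ?case using similar_mat_trans[OF sim] by blast
qed

lemma jordan_nf_exists_alg_closed:
  fixes A :: "'a :: alg_closed_field mat"
  assumes "A \<in> carrier_mat n n"
  shows "\<exists>n_as. jordan_nf A n_as"
proof -
  obtain B where B: "similar_mat A B" "upper_triangular B"
    using similar_upper_triangular[OF assms] by blast
  obtain m where "B \<in> carrier_mat m m" using B(1) similar_matD[OF B(1)] by auto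
  from triangular_to_jnf_vector[OF this B(2)] B(1) show ?thesis
    unfolding jordan_nf_def using similar_mat_trans by blast
qed

text \<open>
  The function \<open>m \<mapsto> min m k\<close> is concave, and its second difference is supported at \<open>m = k\<close>.
\<close>

lemma count_from_sizes:
  "int (count_list ns m) = 2 * int (sum_list (map (min m) ns))
     - int (sum_list (map (min (m - 1)) ns)) - int (sum_list (map (min (Suc m)) ns))" if "m \<ge> 1"
proof (induction ns)
  case (Cons k ns)
  have "int (if k = m then 1 else 0) = 2 * int (min m k) - int (min (m - 1) k) - int (min (Suc m) k)"
    using that by (auto simp: min_def)
  with Cons show ?case by auto
qed auto

lemma jordan_block_count_unipotent:
  fixes A :: "'a :: alg_closed_field mat"
  assumes A: "A \<in> carrier_mat n n" and ev: "\<And>e. eigenvalue A e \<Longrightarrow> e = 1" and m: "m \<ge> 1"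
  shows "int (jordan_block_count m A) = 2 * int (kernel_dim ((A - 1\<^sub>m n) ^\<^sub>m m))
     - int (kernel_dim ((A - 1\<^sub>m n) ^\<^sub>m (m - 1))) - int (kernel_dim ((A - 1\<^sub>m n) ^\<^sub>m (Suc m)))"
proof -
  obtain n_as where jnf: "jordan_nf A n_as" using jordan_nf_exists_alg_closed[OF A] by blast
  have e1: "e = 1" if "(k, e) \<in> set n_as" for k e
  proof (rule ev)
    have "k \<noteq> 0" using that jnf unfolding jordan_nf_def by force
    have "poly (char_poly A) e = (\<Prod>x\<leftarrow>n_as. poly (case x of (n, a) \<Rightarrow> [:- a, 1:] ^ n) e)"
      unfolding jordan_nf_char_poly[OF jnf] by (induction n_as) auto
    also have "\<dots> = 0"
      unfolding prod_list_zero_iff using that \<open>k \<noteq> 0\<close> by (force simp: poly_power intro!: image_eqI[of _ _ "(k, e)"])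
    finally show "eigenvalue A e" using eigenvalue_root_char_poly[OF A] by simp
  qed
  have "[(n, e)\<leftarrow>n_as. e = 1] = n_as" using e1 by (intro filter_True) auto
  hence dg: "dim_gen_eigenspace A 1 k = sum_list (map (min k) (map fst n_as))" for k
    using dim_gen_eigenspace[OF jnf, of 1 k] by simp
  have "char_matrix A 1 = A - 1\<^sub>m n" using A unfolding char_matrix_def by (intro eq_matI) auto
  hence "kernel_dim ((A - 1\<^sub>m n) ^\<^sub>m k) = sum_list (map (min k) (map fst n_as))" for k
    using dg[of k] unfolding dim_gen_eigenspace_def by simp
  with count_from_sizes[OF m, of "map fst n_as"] jordan_block_count_eq[OF jnf, of m] show ?thesis by presburger
qed

section \<open>Powers of a matrix in characteristic p\<close>

lemma mat_pow_add:
  assumes "A \<in> carrier_mat n n"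
  shows "A ^\<^sub>m (i + j) = A ^\<^sub>m i * A ^\<^sub>m j"
proof (induction j)
  case (Suc j)
  thus ?case using assms by (simp add: assoc_mult_mat[of _ n n _ n _ n])
qed (use assms in simp)

lemma mat_pow_Suc_left:
  assumes "A \<in> carrier_mat n n"
  shows "A ^\<^sub>m Suc j = A * A ^\<^sub>m j"
  using mat_pow_add[OF assms, of 1 j] assms by simp

text \<open>
  Evaluation at a fixed matrix is a ring homomorphism. It transports identities between
  polynomials over a field of characteristic \<open>p\<close>, where the Frobenius map is available, to
  matrices.
\<close>

definition poly_mat :: "'a :: field mat \<Rightarrow> 'a poly \<Rightarrow> 'a mat" where
  "poly_mat A f = fold_coeffs (\<lambda>a M. a \<cdot>\<^sub>m 1\<^sub>m (dim_row A) + A * M) f (0\<^sub>m (dim_row A) (dim_row A))"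

lemma poly_mat_0: "poly_mat A 0 = 0\<^sub>m (dim_row A) (dim_row A)"
  by (simp add: poly_mat_def)

lemma poly_mat_pCons:
  assumes "A \<in> carrier_mat n n"
  shows "poly_mat A (pCons a f) = a \<cdot>\<^sub>m 1\<^sub>m n + A * poly_mat A f"
proof (cases "a = 0 \<and> f = 0")
  case True
  have "0 \<cdot>\<^sub>m 1\<^sub>m n + A * 0\<^sub>m n n = (0\<^sub>m n n :: 'a mat)" using assms by (intro eq_matI) auto
  with True show ?thesis using assms by (simp add: poly_mat_0)
next
  case False
  thus ?thesis using assms by (auto simp: poly_mat_def)
qed

context
  fixes A :: "'a :: field mat" and n :: nat
  assumes A: "A \<in> carrier_mat n n"
begin

lemma poly_mat_closed [simp]: "poly_mat A f \<in> carrier_mat n n"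
  using A by (induction f) (auto simp: poly_mat_0 poly_mat_pCons[OF A])

lemma poly_mat_add: "poly_mat A (f + g) = poly_mat A f + poly_mat A g"
proof (induction f g rule: poly_induct2)
  case 0
  show ?case using A by (simp add: poly_mat_0)
next
  case (pCons a f b g)
  have "poly_mat A (pCons a f + pCons b g) = (a + b) \<cdot>\<^sub>m 1\<^sub>m n + A * (poly_mat A f + poly_mat A g)"
    using pCons A by (simp add: poly_mat_pCons)
  also have "\<dots> = (a \<cdot>\<^sub>m 1\<^sub>m n + A * poly_mat A f) + (b \<cdot>\<^sub>m 1\<^sub>m n + A * poly_mat A g)"
  proof -
    have "(a + b) \<cdot>\<^sub>m 1\<^sub>m n + (M + N) = (a \<cdot>\<^sub>m 1\<^sub>m n + M) + (b \<cdot>\<^sub>m 1\<^sub>m n + N)"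
      if "M \<in> carrier_mat n n" "N \<in> carrier_mat n n" for M N :: "'a mat"
      using that by (intro eq_matI) (auto simp: algebra_simps)
    from this[of "A * poly_mat A f" "A * poly_mat A g"] show ?thesis
      using A by (simp add: mult_add_distrib_mat[OF A poly_mat_closed poly_mat_closed])
  qed
  finally show ?case using A by (simp add: poly_mat_pCons)
qed

lemma poly_mat_smult: "poly_mat A (Polynomial.smult c f) = c \<cdot>\<^sub>m poly_mat A f"
proof (induction f)
  case 0
  show ?case using A by (simp add: poly_mat_0)
next
  case (pCons a f)
  have "poly_mat A (Polynomial.smult c (pCons a f)) = (c * a) \<cdot>\<^sub>m 1\<^sub>m n + A * (c \<cdot>\<^sub>m poly_mat A f)"
    using pCons A by (simp add: poly_mat_pCons)
  also have "\<dots> = c \<cdot>\<^sub>m (a \<cdot>\<^sub>m 1\<^sub>m n + A * poly_mat A f)"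
  proof -
    have "(c * a) \<cdot>\<^sub>m 1\<^sub>m n + c \<cdot>\<^sub>m M = c \<cdot>\<^sub>m (a \<cdot>\<^sub>m 1\<^sub>m n + M)"
      if "M \<in> carrier_mat n n" for M :: "'a mat"
      using that by (intro eq_matI) (auto simp: algebra_simps)
    from this[of "A * poly_mat A f"] show ?thesis
      using A by (simp add: mult_smult_distrib[OF A poly_mat_closed])
  qed
  finally show ?case using A by (simp add: poly_mat_pCons)
qed

lemma poly_mat_mult: "poly_mat A (f * g) = poly_mat A f * poly_mat A g"
proof (induction f)
  case 0
  show ?case using A left_mult_zero_mat[OF poly_mat_closed[of g], of n] by (simp add: poly_mat_0)
next
  case (pCons a f)
  have "poly_mat A (pCons a f * g) = a \<cdot>\<^sub>m poly_mat A g + A * (poly_mat A f * poly_mat A g)"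
  proof -
    have "poly_mat A (pCons a f * g) = a \<cdot>\<^sub>m poly_mat A g + (0 \<cdot>\<^sub>m 1\<^sub>m n + A * (poly_mat A f * poly_mat A g))"
      using pCons by (simp add: poly_mat_add poly_mat_smult poly_mat_pCons[OF A])
    also have "0 \<cdot>\<^sub>m 1\<^sub>m n + M = M" if "M \<in> carrier_mat n n" for M :: "'a mat"
      using that by (intro eq_matI) auto
    finally show ?thesis using A by (meson mult_carrier_mat poly_mat_closed)
  qed
  also have "\<dots> = (a \<cdot>\<^sub>m 1\<^sub>m n + A * poly_mat A f) * poly_mat A g"
    using A by (simp add: add_mult_distrib_mat[of _ n n _ _ n] assoc_mult_mat[of _ n n _ n _ n]
        mult_smult_assoc_mat[of _ n n _ n] left_mult_one_mat[OF poly_mat_closed])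
  finally show ?case using A by (simp add: poly_mat_pCons)
qed

lemma poly_mat_1: "poly_mat A 1 = 1\<^sub>m n"
  using A by (auto simp: one_pCons poly_mat_pCons poly_mat_0 intro!: eq_matI)

lemma poly_mat_power: "poly_mat A (f ^ k) = poly_mat A f ^\<^sub>m k"
proof (induction k)
  case (Suc k)
  thus ?case using poly_mat_mult[of "f ^ k" f] by (simp add: mult.commute)
next
  case 0
  show ?case using carrier_matD(1)[OF poly_mat_closed[of f]] by (simp add: poly_mat_1)
qed

lemma poly_mat_X_minus_1: "poly_mat A [:-1, 1:] = A - 1\<^sub>m n"
  using A by (auto simp: poly_mat_pCons poly_mat_0 intro!: eq_matI)

lemma poly_mat_X: "poly_mat A [:0, 1:] = A"
  using A by (auto simp: poly_mat_pCons poly_mat_0 intro!: eq_matI)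

end

lemma Frobenius_poly:
  fixes q :: nat
  assumes "prime CHAR('a :: field)" "q = CHAR('a) ^ a"
  shows "[:-1, 1 :: 'a:] ^ q = [:0, 1:] ^ q - 1"
proof -
  have "([:-1, 1 :: 'a:] + 1) ^ q = [:-1, 1:] ^ q + 1 ^ q"
    by (rule freshmans_dream') (use assms in auto)
  moreover have "[:-1, 1 :: 'a:] + 1 = [:0, 1:]" by (simp add: one_pCons)
  ultimately show ?thesis by simp
qed

lemma geometric_poly:
  fixes q :: nat
  assumes "prime CHAR('a :: field)" "q = CHAR('a) ^ a"
  shows "[:-1, 1 :: 'a:] ^ (q - 1) = (\<Sum>i<q. [:0, 1:] ^ i)"
proof -
  have q: "q > 0" using assms prime_gt_0_nat by auto
  have X: "[:0, 1:] - 1 = [:-1, 1 :: 'a:]" by (simp add: one_pCons)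
  have "[:-1, 1 :: 'a:] * [:-1, 1 :: 'a:] ^ (q - 1) = [:-1, 1 :: 'a:] ^ q"
    using q by (metis Suc_pred' power_Suc)
  also have "\<dots> = [:-1, 1 :: 'a:] * (\<Sum>i<q. [:0, 1:] ^ i)"
    unfolding Frobenius_poly[OF assms] power_diff_1_eq X ..
  finally show ?thesis by (metis mult_cancel_left one_neq_zero pCons_eq_0_iff)
qed

primrec mat_sum :: "nat \<Rightarrow> (nat \<Rightarrow> 'a :: semiring_0 mat) \<Rightarrow> nat \<Rightarrow> 'a mat" where
  "mat_sum n f 0 = 0\<^sub>m n n"
| "mat_sum n f (Suc k) = mat_sum n f k + f k"

lemma mat_sum_closed [simp]:
  "(\<And>i. i < k \<Longrightarrow> f i \<in> carrier_mat n n) \<Longrightarrow> mat_sum n f k \<in> carrier_mat n n"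
  by (induction k) auto

lemma mat_sum_cong:
  "(\<And>i. i < k \<Longrightarrow> f i = g i) \<Longrightarrow> mat_sum n f k = mat_sum n g k"
  by (induction k) auto

lemma mat_sum_mult_right:
  assumes "\<And>i. i < k \<Longrightarrow> f i \<in> carrier_mat n n" "B \<in> carrier_mat n n"
  shows "mat_sum n f k * B = mat_sum n (\<lambda>i. f i * B) k"
  using assms(1)
proof (induction k)
  case (Suc k)
  thus ?case using assms(2) by (simp add: add_mult_distrib_mat[of _ n n _ _ n])
qed (use assms in simp)

lemma mat_sum_mult_left:
  assumes "\<And>i. i < k \<Longrightarrow> f i \<in> carrier_mat n n" "B \<in> carrier_mat n n"
  shows "B * mat_sum n f k = mat_sum n (\<lambda>i. B * f i) k"
  using assms(1)
proof (induction k)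
  case (Suc k)
  thus ?case using assms(2) by (simp add: mult_add_distrib_mat[of _ n n _ n])
qed (use assms in simp)

lemma mat_minus_one_pow_char:
  fixes A :: "'a :: field mat"
  assumes A: "A \<in> carrier_mat n n" and q: "prime CHAR('a)" "q = CHAR('a) ^ a"
  shows "(A - 1\<^sub>m n) ^\<^sub>m q = A ^\<^sub>m q - 1\<^sub>m n"
    and "(A - 1\<^sub>m n) ^\<^sub>m (q - 1) = mat_sum n (\<lambda>i. A ^\<^sub>m i) q"
proof -
  have c: "A - 1\<^sub>m n \<in> carrier_mat n n" by (rule minus_carrier_mat) simp
  have "poly_mat A ([:-1, 1:] ^ q + 1) = poly_mat A ([:0, 1:] ^ q)"
    unfolding Frobenius_poly[OF q] by simp
  hence "(A - 1\<^sub>m n) ^\<^sub>m q + 1\<^sub>m n = A ^\<^sub>m q"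
    by (simp only: poly_mat_add[OF A] poly_mat_1[OF A] poly_mat_power[OF A] poly_mat_X[OF A]
          poly_mat_X_minus_1[OF A])
  moreover have "((A - 1\<^sub>m n) ^\<^sub>m q + 1\<^sub>m n) - 1\<^sub>m n = (A - 1\<^sub>m n) ^\<^sub>m q"
    using c by (intro eq_matI) (auto simp: pow_mat_dim_square[OF c] simp del: pow_mat_dim)
  ultimately show "(A - 1\<^sub>m n) ^\<^sub>m q = A ^\<^sub>m q - 1\<^sub>m n" by simp
  have "poly_mat A (\<Sum>i<k. [:0, 1:] ^ i) = mat_sum n (\<lambda>i. A ^\<^sub>m i) k" for k
    using A by (induction k) (auto simp: poly_mat_0 poly_mat_add[OF A] poly_mat_power[OF A] poly_mat_X[OF A])
  thus "(A - 1\<^sub>m n) ^\<^sub>m (q - 1) = mat_sum n (\<lambda>i. A ^\<^sub>m i) q"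
    using geometric_poly[OF q] poly_mat_power[OF A, of "[:-1, 1:]" "q - 1"] poly_mat_X_minus_1[OF A] by metis
qed

text \<open>
  As \<open>A - 1\<close> is nilpotent and \<open>(A - 1)\<^sup>q = A\<^sup>q - 1\<close> for powers \<open>q\<close> of \<open>p\<close>, a large \<open>q\<close> will do. The
  property of having order a power of \<open>p\<close> passes to every representation.
\<close>

lemma unipotent_pow_char_eq_one:
  fixes A :: "'a :: field mat"
  assumes A: "A \<in> carrier_mat n n" and p: "prime CHAR('a)" and k: "(A - 1\<^sub>m n) ^\<^sub>m k = 0\<^sub>m n n"
  obtains a where "A ^\<^sub>m (CHAR('a) ^ a) = 1\<^sub>m n"
proof -
  have "k \<le> CHAR('a) ^ k" using prime_gt_1_nat[OF p] by (intro less_imp_le power_gt_expt) auto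
  then obtain j where j: "CHAR('a) ^ k = k + j" using le_Suc_ex by blast
  have c: "A - 1\<^sub>m n \<in> carrier_mat n n" by (rule minus_carrier_mat) simp
  have "(A - 1\<^sub>m n) ^\<^sub>m (CHAR('a) ^ k) = 0\<^sub>m n n"
    unfolding j mat_pow_add[OF c] k using c by simp
  hence *: "A ^\<^sub>m (CHAR('a) ^ k) - 1\<^sub>m n = 0\<^sub>m n n" using mat_minus_one_pow_char(1)[OF A p refl] by simp
  have "A ^\<^sub>m (CHAR('a) ^ k) = 1\<^sub>m n"
  proof (rule eq_matI)
    fix i j assume ij: "i < dim_row (1\<^sub>m n :: 'a mat)" "j < dim_col (1\<^sub>m n :: 'a mat)"
    from arg_cong[OF *, of "\<lambda>M. M $$ (i, j)"] ij A
    show "(A ^\<^sub>m (CHAR('a) ^ k)) $$ (i, j) = 1\<^sub>m n $$ (i, j)" by simp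
  qed (use A in auto)
  thus ?thesis by (rule that)
qed

text \<open>
  The eigenvalues satisfy \<open>e\<^sup>q = 1\<close>, that is \<open>(e - 1)\<^sup>q = 0\<close>.
\<close>

lemma eigenvalue_eq_one:
  fixes A :: "'a :: field mat"
  assumes A: "A \<in> carrier_mat n n" and p: "prime CHAR('a)" and one: "A ^\<^sub>m (CHAR('a) ^ a) = 1\<^sub>m n"
    and e: "eigenvalue A e"
  shows "e = 1"
proof -
  let ?q = "CHAR('a) ^ a"
  obtain v where v: "eigenvector A v e" using e by (auto simp: eigenvalue_def)
  hence vc: "v \<in> carrier_vec n" "v \<noteq> 0\<^sub>v n" using A by (auto simp: eigenvector_def)
  have "e ^ ?q \<cdot>\<^sub>v v = v" using eigenvector_pow[OF A v, of ?q] one vc by simp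
  moreover obtain i where i: "i < n" "v $ i \<noteq> 0" using vc by (metis eq_vecI carrier_vecD index_zero_vec)
  ultimately have "e ^ ?q = 1" using vc by (metis carrier_vecD index_smult_vec(1) mult_cancel_right1)
  have "((e - 1) + 1) ^ ?q = (e - 1) ^ ?q + 1 ^ ?q" by (rule freshmans_dream') (use p in auto)
  with \<open>e ^ ?q = 1\<close> have "(e - 1) ^ ?q = 0" by simp
  thus ?thesis by simp
qed

section \<open>The trace\<close>

definition mat_trace :: "'a :: comm_ring_1 mat \<Rightarrow> 'a" where
  "mat_trace A = (\<Sum>i < dim_row A. A $$ (i, i))"

lemma mat_trace_mult_comm:
  assumes "A \<in> carrier_mat n m" "B \<in> carrier_mat m n"
  shows "mat_trace (A * B) = mat_trace (B * A)"
proof -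
  have "mat_trace (A * B) = (\<Sum>i<n. \<Sum>j<m. A $$ (i, j) * B $$ (j, i))"
    using assms by (auto simp: mat_trace_def scalar_prod_def atLeast0LessThan intro!: sum.cong)
  also have "\<dots> = (\<Sum>j<m. \<Sum>i<n. B $$ (j, i) * A $$ (i, j))"
    by (subst sum.swap) (simp add: mult.commute)
  also have "\<dots> = mat_trace (B * A)"
    using assms by (auto simp: mat_trace_def scalar_prod_def atLeast0LessThan intro!: sum.cong)
  finally show ?thesis .
qed

lemma mat_trace_add:
  "A \<in> carrier_mat n n \<Longrightarrow> B \<in> carrier_mat n n \<Longrightarrow> mat_trace (A + B) = mat_trace A + mat_trace B"
  by (simp add: mat_trace_def sum.distrib carrier_matD)

lemma mat_trace_smult: "A \<in> carrier_mat n n \<Longrightarrow> mat_trace (c \<cdot>\<^sub>m A) = c * mat_trace A"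
  by (simp add: mat_trace_def sum_distrib_left)

lemma mat_trace_minus:
  "A \<in> carrier_mat n n \<Longrightarrow> B \<in> carrier_mat n n \<Longrightarrow> mat_trace (A - B) = mat_trace A - mat_trace B"
  by (simp add: mat_trace_def sum_subtractf carrier_matD)

lemma mat_trace_zero: "mat_trace (0\<^sub>m n n) = 0" by (simp add: mat_trace_def)

lemma mat_trace_one: "mat_trace (1\<^sub>m n) = of_nat n" by (simp add: mat_trace_def)

lemma mat_trace_similar:
  assumes "X \<in> carrier_mat n n" "P \<in> carrier_mat n n" "Q \<in> carrier_mat n n" "Q * P = 1\<^sub>m n"
  shows "mat_trace (P * X * Q) = mat_trace X"
proof -
  have "mat_trace (P * X * Q) = mat_trace (Q * (P * X))"
    by (rule mat_trace_mult_comm) (use assms in auto)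
  also have "Q * (P * X) = X" using assms by (simp add: assoc_mult_mat[of _ n n _ n _ n, symmetric])
  finally show ?thesis .
qed

section \<open>An averaging matrix for a unipotent map\<close>

text \<open>
  Let \<open>q\<close> divide \<open>d\<close>. A Jordan block \<open>J\<close> of size \<open>d\<close> is multiplication by \<open>x\<close> on
  \<open>K[x]/((x - 1)\<^sup>d)\<close>, which is free over the subalgebra generated by \<open>x\<^sup>q\<close>, with basis
  \<open>1, x, \<dots>, x\<^sup>q\<^sup>-\<^sup>1\<close>. The matrix below is the projection onto the component of the basis element \<open>1\<close>:
  the basis vector of index \<open>d - 1 - c\<close> is \<open>(x - 1)\<^sup>c\<close>, and for \<open>c = q t + k\<close> with \<open>k < q\<close> the
  component of \<open>(x - 1)\<^sup>c = (x\<^sup>q - 1)\<^sup>t (x - 1)\<^sup>k\<close> is \<open>(-1)\<^sup>k (x\<^sup>q - 1)\<^sup>t\<close>. Its conjugate by \<open>x\<^sup>i\<close>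
  projects onto the component of \<open>x\<^sup>i\<close>, so these conjugates for \<open>i < q\<close> add up to the identity.
\<close>

definition block_slice :: "nat \<Rightarrow> nat \<Rightarrow> 'a :: field mat" where
  "block_slice q d = mat d d (\<lambda>(b, a).
     if b div q = a div q \<and> Suc (b mod q) = q then (-1) ^ (q - Suc (a mod q)) else 0)"

lemma block_slice_dim [simp]:
  "dim_row (block_slice q d) = d" "dim_col (block_slice q d) = d"
  by (simp_all add: block_slice_def)

lemma block_slice_closed [simp]: "block_slice q d \<in> carrier_mat d d"
  by (simp add: block_slice_def)

lemma block_slice_trace:
  assumes "q > 0" "q dvd d"
  shows "mat_trace (block_slice q d :: 'a :: field mat) = of_nat (d div q)"
proof -
  obtain t where t: "d = q * t" using assms by auto
  have "mat_trace (block_slice q d :: 'a mat) = (\<Sum>i<d. if Suc (i mod q) = q then 1 else 0)"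
    unfolding mat_trace_def block_slice_def by (intro sum.cong) auto
  also have "\<dots> = of_nat (card {i \<in> {..<d}. Suc (i mod q) = q})"
    by (subst sum.inter_filter[symmetric]) auto
  also have "{i \<in> {..<d}. Suc (i mod q) = q} = (\<lambda>k. q * k + (q - 1)) ` {..<t}"
  proof (intro equalityI subsetI)
    fix i assume i: "i \<in> {i \<in> {..<d}. Suc (i mod q) = q}"
    hence "q - 1 = i mod q" by auto
    hence "i = q * (i div q) + (q - 1)" by simp
    moreover have "i div q < t" using i assms t by (simp add: div_less_iff_less_mult mult.commute)
    ultimately show "i \<in> (\<lambda>k. q * k + (q - 1)) ` {..<t}" by blast
  next
    fix i assume "i \<in> (\<lambda>k. q * k + (q - 1)) ` {..<t}"
    then obtain k where k: "k < t" "i = q * k + (q - 1)" by auto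
    have "q * k + q \<le> q * t" using k(1) by (metis Suc_leI add.commute mult_Suc_right mult_le_mono2)
    moreover have "(q * k + r) mod q = r" if "r < q" for r using that by simp
    from this[of "q - 1"] have "i mod q = q - 1" using k assms by simp
    ultimately show "i \<in> {i \<in> {..<d}. Suc (i mod q) = q}" using k assms t by simp
  qed
  also have "card \<dots> = d div q" using assms t
    by (subst card_image) (auto simp: inj_on_def simp del: add_diff_assoc diff_add_assoc)
  finally show ?thesis .
qed

lemma jordan_block_minus_one:
  "jordan_block d (1 :: 'a :: field) - 1\<^sub>m d = jordan_block d 0"
  unfolding jordan_block_def by (intro eq_matI) auto

lemma mult_shift_right:
  assumes "M \<in> carrier_mat d d" "i < d" "j < d"
  shows "(M * (jordan_block d (0 :: 'a :: field)) ^\<^sub>m k) $$ (i, j) = (if k \<le> j then M $$ (i, j - k) else 0)"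
proof -
  have "(M * (jordan_block d (0 :: 'a :: field)) ^\<^sub>m k) $$ (i, j)
      = (\<Sum>c<d. M $$ (i, c) * (if c \<le> j \<and> j - c = k then 1 else 0))"
    using assms by (auto simp: jordan_block_zero_pow scalar_prod_def atLeast0LessThan intro!: sum.cong)
  also have "\<dots> = (\<Sum>c<d. if c = j - k then (if k \<le> j then M $$ (i, c) else 0) else 0)"
    by (intro sum.cong) auto
  also have "\<dots> = (if k \<le> j then M $$ (i, j - k) else 0)" using assms by auto
  finally show ?thesis .
qed

lemma mult_shift_left:
  assumes "M \<in> carrier_mat d d" "i < d" "j < d"
  shows "((jordan_block d (0 :: 'a :: field)) ^\<^sub>m k * M) $$ (i, j) = (if i + k < d then M $$ (i + k, j) else 0)"
proof -
  have "((jordan_block d (0 :: 'a :: field)) ^\<^sub>m k * M) $$ (i, j)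
      = (\<Sum>c<d. (if i \<le> c \<and> c - i = k then 1 else 0) * M $$ (c, j))"
    using assms by (auto simp: jordan_block_zero_pow scalar_prod_def atLeast0LessThan intro!: sum.cong)
  also have "\<dots> = (\<Sum>c<d. if c = i + k then M $$ (c, j) else 0)"
    by (intro sum.cong) auto
  also have "\<dots> = (if i + k < d then M $$ (i + k, j) else 0)" using assms by auto
  finally show ?thesis .
qed

lemma jordan_block_pow_char:
  assumes "prime CHAR('a)" "q = CHAR('a) ^ a"
  shows "(jordan_block d (1 :: 'a :: field)) ^\<^sub>m q = 1\<^sub>m d + (jordan_block d 0) ^\<^sub>m q"
proof -
  have "(jordan_block d (0 :: 'a)) ^\<^sub>m q = (jordan_block d 1) ^\<^sub>m q - 1\<^sub>m d"
    using mat_minus_one_pow_char(1)[OF jordan_block_carrier[of d 1] assms] unfolding jordan_block_minus_one .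
  thus ?thesis by (intro eq_matI) (auto simp del: jordan_block_zero_pow)
qed

text \<open>
  \<open>J\<^sup>q - 1\<close> is the \<open>q\<close>-th power of the shift, and the entries of the projection are invariant under
  a simultaneous translation of both indices by \<open>q\<close>.
\<close>

lemma block_slice_commute:
  assumes "prime CHAR('a)" "q = CHAR('a) ^ a" "q dvd d"
  shows "block_slice q d * (jordan_block d (1 :: 'a :: field)) ^\<^sub>m q = (jordan_block d 1) ^\<^sub>m q * block_slice q d"
proof -
  let ?S = "(jordan_block d (0 :: 'a)) ^\<^sub>m q" and ?w = "block_slice q d :: 'a mat"
  have q: "q > 0" using assms prime_gt_0_nat by auto
  obtain t where t: "d = q * t" using assms by auto
  have S: "?S \<in> carrier_mat d d" by simp
  have "?w * ?S = ?S * ?w"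
  proof (rule eq_matI)
    fix i j assume "i < dim_row (?S * ?w)" "j < dim_col (?S * ?w)"
    hence ij: "i < d" "j < d" by auto
    have l: "(?w * ?S) $$ (i, j) = (if q \<le> j then ?w $$ (i, j - q) else 0)"
      by (rule mult_shift_right) (use ij in auto)
    have r: "(?S * ?w) $$ (i, j) = (if i + q < d then ?w $$ (i + q, j) else 0)"
      by (rule mult_shift_left) (use ij in auto)
    show "(?w * ?S) $$ (i, j) = (?S * ?w) $$ (i, j)"
    proof (cases "q \<le> j")
      case True
      then obtain k where k: "j = q + k" using le_Suc_ex by blast
      have jd: "j div q = Suc (k div q)" "j mod q = k mod q" using k q by auto
      have "j div q < t" using ij t q by (simp add: div_less_iff_less_mult mult.commute)
      have "i + q < d" if "i div q = k div q"
      proof -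
        have "(i + q) div q < t" using that jd \<open>j div q < t\<close> q by simp
        thus ?thesis using t div_less_iff_less_mult[OF q, of "i + q" t] by (simp add: mult.commute)
      qed
      thus ?thesis unfolding l r using True ij k jd q
        by (auto simp: block_slice_def)
    next
      case False
      thus ?thesis unfolding l r using ij q by (auto simp: block_slice_def)
    qed
  qed auto
  thus ?thesis unfolding jordan_block_pow_char[OF assms(1,2)]
    using S block_slice_closed[of q d, where ?'a = 'a]
    by (simp add: mult_add_distrib_mat[of _ d d _ d] add_mult_distrib_mat[of _ d d _ _ d])
qed

lemma last_block_index:
  fixes q :: nat
  assumes "d = q * Suc t" "k < q"
  shows "(d - 1 - k) div q = t" "(d - 1 - k) mod q = q - Suc k"
    "i < d \<Longrightarrow> i div q = t \<and> Suc (i mod q) = q \<longleftrightarrow> i = d - 1"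
proof -
  have *: "(q * t + r) div q = t" "(q * t + r) mod q = r" if "r < q" for r using that by auto
  have "d - 1 - k = q * t + (q - Suc k)" using assms by simp
  thus "(d - 1 - k) div q = t" "(d - 1 - k) mod q = q - Suc k" using *[of "q - Suc k"] assms by auto
  show "i div q = t \<and> Suc (i mod q) = q \<longleftrightarrow> i = d - 1" if "i < d"
  proof
    assume "i div q = t \<and> Suc (i mod q) = q"
    hence "i = q * t + (q - 1)" by (metis diff_Suc_1 mult_div_mod_eq)
    thus "i = d - 1" using assms by simp
  next
    assume "i = d - 1"
    hence "i = q * t + (q - 1)" using assms by simp
    thus "i div q = t \<and> Suc (i mod q) = q" using *[of "q - 1"] assms(2) by simp
  qed
qed

lemma block_slice_last_cols:
  assumes "q dvd d" "d > 0" "k < q" "i < d"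
  shows "(block_slice q d :: 'a :: field mat) $$ (i, d - 1 - k) = (if i = d - 1 then (-1) ^ k else 0)"
proof -
  obtain t where t: "d = q * t" using assms by auto
  then obtain t' where "t = Suc t'" using assms by (cases t) auto
  note * = last_block_index[OF t[unfolded this] assms(3)]
  have "q - Suc (q - Suc k) = k" using assms by simp
  thus ?thesis using *(3)[OF assms(4)] *(1,2) assms unfolding block_slice_def by simp
qed

text \<open>
  The last basis vector is the cyclic vector \<open>1\<close>, and the statement says that \<open>x\<^sup>m\<close> has no component
  at \<open>1\<close> for \<open>0 < m < q\<close>. In coordinates it is the vanishing of an alternating sum of binomial
  coefficients.
\<close>

lemma block_slice_cyclic:
  assumes "q dvd d" "d > 0" "0 < m" "m < q" "i < d"
  shows "(block_slice q d * (jordan_block d (1 :: 'a :: field)) ^\<^sub>m m) $$ (i, d - 1) = 0"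
proof -
  let ?w = "block_slice q d :: 'a mat" and ?J = "jordan_block d (1 :: 'a)"
  have qd: "q \<le> d" using assms by (simp add: dvd_imp_le)
  have "(?w * ?J ^\<^sub>m m) $$ (i, d - 1) = (\<Sum>c<d. ?w $$ (i, c) * of_nat (m choose (d - 1 - c)))"
    using assms unfolding jordan_block_pow scalar_prod_def
    by (auto simp: scalar_prod_def atLeast0LessThan intro!: sum.cong)
  also have "\<dots> = (\<Sum>k<d. ?w $$ (i, d - 1 - k) * of_nat (m choose k))"
    by (subst sum.nat_diff_reindex[symmetric]) (auto intro!: sum.cong)
  also have "\<dots> = (\<Sum>k\<le>m. ?w $$ (i, d - 1 - k) * of_nat (m choose k))"
    by (rule sum.mono_neutral_right) (use assms qd in \<open>auto simp: binomial_eq_0\<close>)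
  also have "\<dots> = (\<Sum>k\<le>m. (if i = d - 1 then 1 else 0) * ((-1) ^ k * of_nat (m choose k)))"
    by (rule sum.cong) (use assms block_slice_last_cols[OF assms(1,2) _ assms(5), where ?'a = 'a] in auto)
  also have "\<dots> = (if i = d - 1 then 1 else 0) * (\<Sum>k\<le>m. (-1) ^ k * of_nat (m choose k))"
    by (simp add: sum_distrib_left)
  also have "\<dots> = 0" by (simp add: choose_alternating_sum[OF assms(3)])
  finally show ?thesis .
qed

text \<open>
  A matrix that commutes with a Jordan block is determined by its value at the cyclic vector.
\<close>

lemma commute_jordan_block_zero:
  assumes M: "M \<in> carrier_mat d d" and comm: "M * jordan_block d (1 :: 'a :: field) = jordan_block d 1 * M"
    and last: "\<And>i. i < d \<Longrightarrow> M $$ (i, d - 1) = 0"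
  shows "M = 0\<^sub>m d d"
proof -
  let ?S = "jordan_block d (0 :: 'a)" and ?J = "jordan_block d (1 :: 'a)"
  have "M * ?S = ?S * M" unfolding jordan_block_minus_one[symmetric]
    using M comm mult_minus_distrib_mat[OF M jordan_block_carrier[of d 1] one_carrier_mat]
      minus_mult_distrib_mat[OF jordan_block_carrier[of d 1] one_carrier_mat M]
    by simp
  hence *: "M * ?S ^\<^sub>m 1 = ?S ^\<^sub>m 1 * M" by simp
  have "\<forall>i<d. M $$ (i, d - 1 - k) = 0" if "k < d" for k
    using that
  proof (induction k)
    case (Suc k)
    show ?case
    proof (intro allI impI)
      fix i assume i: "i < d"
      let ?j = "d - 1 - k"
      have j: "?j < d" "1 \<le> ?j" using Suc.prems by auto
      have "M $$ (i, ?j - 1) = (if i + 1 < d then M $$ (i + 1, ?j) else 0)"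
        using mult_shift_right[OF M i j(1), of 1] mult_shift_left[OF M i j(1), of 1] j(2) * by metis
      thus "M $$ (i, d - 1 - Suc k) = 0" using Suc by simp
    qed
  qed (use last in simp)
  hence "M $$ (i, j) = 0" if "i < d" "j < d" for i j
    using that(1) \<open>j < d\<close> \<open>\<And>k. k < d \<Longrightarrow> \<forall>i<d. M $$ (i, d - 1 - k) = 0\<close>[of "d - 1 - j"] by simp
  thus ?thesis using M by (intro eq_matI) auto
qed

lemma mat_sum_Suc_shift:
  fixes f :: "nat \<Rightarrow> 'a :: ring mat"
  assumes "\<And>i. i \<le> k \<Longrightarrow> f i \<in> carrier_mat n n"
  shows "mat_sum n (\<lambda>i. f (Suc i)) k + f 0 = mat_sum n f k + f k"
  using assms
proof (induction k)
  case (Suc k)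
  have c: "mat_sum n (\<lambda>i. f (Suc i)) k \<in> carrier_mat n n" "mat_sum n f k \<in> carrier_mat n n"
    by (auto intro!: mat_sum_closed Suc.prems)
  have fs: "f 0 \<in> carrier_mat n n" "f k \<in> carrier_mat n n" "f (Suc k) \<in> carrier_mat n n" using Suc.prems by auto
  have "mat_sum n (\<lambda>i. f (Suc i)) (Suc k) + f 0 = (mat_sum n (\<lambda>i. f (Suc i)) k + f 0) + f (Suc k)"
    using c fs by (intro eq_matI) (auto simp: algebra_simps)
  also have "\<dots> = mat_sum n f (Suc k) + f (Suc k)" using Suc by simp
  finally show ?case .
qed (auto simp: comm_add_mat)

lemma mat_add_right_cancel:
  fixes A B C :: "'a :: ring mat"
  assumes "A + C = B + C" "A \<in> carrier_mat n n" "B \<in> carrier_mat n n" "C \<in> carrier_mat n n"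
  shows "A = B"
proof (rule eq_matI)
  fix i j assume "i < dim_row B" "j < dim_col B"
  thus "A $$ (i, j) = B $$ (i, j)" using arg_cong[OF assms(1), of "\<lambda>M. M $$ (i, j)"] assms(2-) by simp
qed (use assms in auto)

lemma mat_minus_eq_zero:
  fixes A B :: "'a :: ring mat"
  assumes "A - B = 0\<^sub>m n n" "A \<in> carrier_mat n n" "B \<in> carrier_mat n n"
  shows "A = B"
proof (rule eq_matI)
  fix i j assume "i < dim_row B" "j < dim_col B"
  thus "A $$ (i, j) = B $$ (i, j)" using arg_cong[OF assms(1), of "\<lambda>M. M $$ (i, j)"] assms(2-) by simp
qed (use assms in auto)

lemma mat_vec_last_unit:
  assumes "M \<in> carrier_mat d d" "d > 0" "i < d"
  shows "M $$ (i, d - 1) = (M *\<^sub>v unit_vec d (d - 1) :: 'a :: field vec) $ i"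
proof -
  have "(M *\<^sub>v unit_vec d (d - 1)) $ i = (\<Sum>k<d. M $$ (i, k) * (if k = d - 1 then 1 else 0))"
    using assms by (auto simp: scalar_prod_def atLeast0LessThan intro!: sum.cong)
  also have "\<dots> = (\<Sum>k<d. if k = d - 1 then M $$ (i, k) else 0)" by (intro sum.cong) auto
  also have "\<dots> = M $$ (i, d - 1)" using assms by (subst sum.delta) auto
  finally show ?thesis by simp
qed

lemma mult_mat_zero_vec:
  "A \<in> carrier_mat m n \<Longrightarrow> A *\<^sub>v 0\<^sub>v n = (0\<^sub>v m :: 'a :: semiring_0 vec)"
  by (intro eq_vecI) (auto simp: scalar_prod_def)

text \<open>
  Multiplied by \<open>J\<^sup>q\<close> on the right, the sum of the conjugates avoids inverses. The sum commutes with
  \<open>J\<close>, since shifting \<open>i\<close> exchanges the first summand for an equal one (\<open>block_slice_commute\<close>). So it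
  suffices to compare both sides at the cyclic vector, where only the summand for \<open>i = 0\<close> contributes.
\<close>

lemma block_slice_average:
  assumes p: "prime CHAR('a)" "q = CHAR('a) ^ a" and d: "q dvd d" "d > 0"
  defines "J \<equiv> jordan_block d (1 :: 'a :: field)"
  shows "mat_sum d (\<lambda>i. J ^\<^sub>m i * block_slice q d * J ^\<^sub>m (q - i)) q = J ^\<^sub>m q"
proof -
  define w where "w = (block_slice q d :: 'a mat)"
  define Phi where "Phi k = mat_sum d (\<lambda>i. J ^\<^sub>m i * w * J ^\<^sub>m (q - i)) k" for k
  have q: "q > 0" using p prime_gt_0_nat by auto
  have J: "J \<in> carrier_mat d d" by (simp add: J_def)
  have Jk: "J ^\<^sub>m k \<in> carrier_mat d d" for k using J by simp
  have w: "w \<in> carrier_mat d d" by (simp add: w_def)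
  define g where "g i = J ^\<^sub>m i * w * J ^\<^sub>m (Suc q - i)" for i
  have g: "g i \<in> carrier_mat d d" for i using Jk w unfolding g_def by (meson mult_carrier_mat)
  have f: "J ^\<^sub>m i * w * J ^\<^sub>m (q - i) \<in> carrier_mat d d" for i using Jk w by (meson mult_carrier_mat)
  have comm: "w * J ^\<^sub>m q = J ^\<^sub>m q * w" unfolding J_def w_def by (rule block_slice_commute[OF p d(1)])
  have Phi: "Phi k \<in> carrier_mat d d" for k unfolding Phi_def using f by (intro mat_sum_closed) auto
  have JPhi: "J * Phi q = mat_sum d (\<lambda>i. g (Suc i)) q"
    unfolding Phi_def mat_sum_mult_left[OF f J]
  proof (rule mat_sum_cong)
    fix i
    have "J * (J ^\<^sub>m i * w * J ^\<^sub>m (q - i)) = J * (J ^\<^sub>m i * w) * J ^\<^sub>m (q - i)"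
      using assoc_mult_mat[OF J mult_carrier_mat[OF Jk w] Jk] by simp
    also have "J * (J ^\<^sub>m i * w) = J ^\<^sub>m Suc i * w"
      unfolding mat_pow_Suc_left[OF J] using assoc_mult_mat[OF J Jk w] by simp
    finally show "J * (J ^\<^sub>m i * w * J ^\<^sub>m (q - i)) = g (Suc i)" unfolding g_def by simp
  qed
  have PhiJ: "Phi q * J = mat_sum d g q"
    unfolding Phi_def mat_sum_mult_right[OF f J]
  proof (rule mat_sum_cong)
    fix i assume "i < q"
    hence "J ^\<^sub>m (Suc q - i) = J ^\<^sub>m (q - i) * J" by (simp add: Suc_diff_le)
    thus "J ^\<^sub>m i * w * J ^\<^sub>m (q - i) * J = g i"
      unfolding g_def using assoc_mult_mat[OF mult_carrier_mat[OF Jk w] Jk J] by simp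
  qed
  have "g 0 = w * (J ^\<^sub>m q * J)" using J w by (simp add: g_def)
  also have "\<dots> = J ^\<^sub>m q * w * J" unfolding comm[symmetric] using assoc_mult_mat[OF w Jk J] by simp
  also have "\<dots> = g q" using J by (simp add: g_def)
  finally have "mat_sum d (\<lambda>i. g (Suc i)) q + g q = mat_sum d g q + g q"
    using mat_sum_Suc_shift[of q g d] g by simp
  hence eq: "mat_sum d (\<lambda>i. g (Suc i)) q = mat_sum d g q"
    by (rule mat_add_right_cancel) (use g in auto)
  let ?e = "unit_vec d (d - 1) :: 'a vec"
  have zero: "w *\<^sub>v (J ^\<^sub>m m *\<^sub>v ?e) = 0\<^sub>v d" if "0 < m" "m < q" for m
  proof (rule eq_vecI)
    fix i assume "i < dim_vec (0\<^sub>v d :: 'a vec)"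
    hence i: "i < d" by simp
    have "(w *\<^sub>v (J ^\<^sub>m m *\<^sub>v ?e)) $ i = ((w * J ^\<^sub>m m) *\<^sub>v ?e) $ i"
      using assoc_mult_mat_vec[OF w Jk, of ?e] by simp
    also have "\<dots> = (w * J ^\<^sub>m m) $$ (i, d - 1)"
      using mat_vec_last_unit[OF mult_carrier_mat[OF w Jk] d(2) i] by simp
    also have "\<dots> = 0" unfolding J_def w_def by (rule block_slice_cyclic[OF d that i])
    finally show "(w *\<^sub>v (J ^\<^sub>m m *\<^sub>v ?e)) $ i = 0\<^sub>v d $ i" using i by simp
  qed (use w in auto)
  have we: "w *\<^sub>v ?e = ?e"
  proof (rule eq_vecI)
    fix i assume "i < dim_vec ?e"
    hence i: "i < d" by simp
    show "(w *\<^sub>v ?e) $ i = ?e $ i"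
      using mat_vec_last_unit[OF w d(2) i] block_slice_last_cols[OF d q i, where ?'a = 'a] i d
      by (auto simp: w_def)
  qed (use w in auto)
  have summand: "(J ^\<^sub>m i * w * J ^\<^sub>m (q - i)) *\<^sub>v ?e = (if i = 0 then J ^\<^sub>m q *\<^sub>v ?e else 0\<^sub>v d)" if "i < q" for i
  proof (cases "i = 0")
    case True
    have "(J ^\<^sub>m i * w * J ^\<^sub>m (q - i)) *\<^sub>v ?e = (J ^\<^sub>m q * w) *\<^sub>v ?e"
      unfolding comm[symmetric] True using left_mult_one_mat[OF w] carrier_matD(1)[OF J] by simp
    also have "\<dots> = J ^\<^sub>m q *\<^sub>v ?e" using assoc_mult_mat_vec[OF Jk w, of ?e] we by simp
    finally show ?thesis using True by simp
  next
    case False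
    have "(J ^\<^sub>m i * w * J ^\<^sub>m (q - i)) *\<^sub>v ?e = J ^\<^sub>m i *\<^sub>v (w *\<^sub>v (J ^\<^sub>m (q - i) *\<^sub>v ?e))"
      unfolding assoc_mult_mat_vec[OF mult_carrier_mat[OF Jk w] Jk unit_vec_carrier]
        assoc_mult_mat_vec[OF Jk w mult_mat_vec_carrier[OF Jk unit_vec_carrier]] ..
    also have "\<dots> = 0\<^sub>v d" using zero[of "q - i"] False that by (simp add: mult_mat_zero_vec[OF Jk])
    finally show ?thesis using False by simp
  qed
  have PhiE: "Phi k *\<^sub>v ?e = (if k = 0 then 0\<^sub>v d else J ^\<^sub>m q *\<^sub>v ?e)" if "k \<le> q" for k
    using that
  proof (induction k)
    case 0
    show ?case by (intro eq_vecI) (auto simp: Phi_def scalar_prod_def)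
  next
    case (Suc k)
    have "Phi (Suc k) *\<^sub>v ?e = Phi k *\<^sub>v ?e + (J ^\<^sub>m k * w * J ^\<^sub>m (q - k)) *\<^sub>v ?e"
      using add_mult_distrib_mat_vec[OF Phi f, of ?e] by (simp add: Phi_def)
    also have "\<dots> = J ^\<^sub>m q *\<^sub>v ?e"
    proof (cases "k = 0")
      case True
      hence "Phi k *\<^sub>v ?e = 0\<^sub>v d" using Suc by simp
      moreover have "(J ^\<^sub>m k * w * J ^\<^sub>m (q - k)) *\<^sub>v ?e = J ^\<^sub>m q *\<^sub>v ?e"
        using summand[of k] True Suc.prems by simp
      ultimately show ?thesis using left_zero_vec[OF mult_mat_vec_carrier[OF Jk unit_vec_carrier]] by metis
    next
      case False
      hence "Phi k *\<^sub>v ?e = J ^\<^sub>m q *\<^sub>v ?e" using Suc by simp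
      moreover have "(J ^\<^sub>m k * w * J ^\<^sub>m (q - k)) *\<^sub>v ?e = 0\<^sub>v d"
        using summand[of k] False Suc.prems by simp
      ultimately show ?thesis using right_zero_vec[OF mult_mat_vec_carrier[OF Jk unit_vec_carrier]] by metis
    qed
    finally show ?case by simp
  qed
  have "Phi q - J ^\<^sub>m q = 0\<^sub>m d d"
  proof (rule commute_jordan_block_zero)
    have "J * J ^\<^sub>m q = J ^\<^sub>m q * J" using mat_pow_Suc_left[OF J, of q] by simp
    thus "(Phi q - J ^\<^sub>m q) * jordan_block d 1 = jordan_block d 1 * (Phi q - J ^\<^sub>m q)"
      unfolding J_def[symmetric] mult_minus_distrib_mat[OF J Phi Jk] minus_mult_distrib_mat[OF Phi Jk J]
        JPhi PhiJ eq by simp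
    show "(Phi q - J ^\<^sub>m q) $$ (i, d - 1) = 0" if i: "i < d" for i
    proof -
      have "(Phi q *\<^sub>v ?e) = (J ^\<^sub>m q *\<^sub>v ?e)" using PhiE[of q] q by simp
      hence "Phi q $$ (i, d - 1) = (J ^\<^sub>m q) $$ (i, d - 1)"
        unfolding mat_vec_last_unit[OF Phi d(2) i] mat_vec_last_unit[OF Jk d(2) i] by (rule arg_cong)
      thus ?thesis using i d carrier_matD[OF Phi] carrier_matD[OF Jk] by (subst index_minus_mat) simp_all
    qed
  qed (use J in auto)
  thus ?thesis using mat_minus_eq_zero[OF _ Phi Jk] unfolding Phi_def w_def by blast
qed

definition dsum :: "'a :: zero mat \<Rightarrow> 'a mat \<Rightarrow> 'a mat" where
  "dsum A B = four_block_mat A (0\<^sub>m (dim_row A) (dim_col B)) (0\<^sub>m (dim_row B) (dim_col A)) B"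

lemma dsum_closed [simp]:
  "A \<in> carrier_mat a a \<Longrightarrow> B \<in> carrier_mat b b \<Longrightarrow> dsum A B \<in> carrier_mat (a + b) (a + b)"
  unfolding dsum_def by auto

lemma dsum_mult:
  fixes A B C D :: "'a :: semiring_0 mat"
  assumes "A \<in> carrier_mat a a" "B \<in> carrier_mat b b" "C \<in> carrier_mat a a" "D \<in> carrier_mat b b"
  shows "dsum A B * dsum C D = dsum (A * C) (B * D)"
  using assms unfolding dsum_def
  by (subst mult_four_block_mat[of _ a a _ b _ b _ _ a _ b]) auto

lemma dsum_add:
  fixes A B C D :: "'a :: monoid_add mat"
  assumes "A \<in> carrier_mat a a" "B \<in> carrier_mat b b" "C \<in> carrier_mat a a" "D \<in> carrier_mat b b"
  shows "dsum A B + dsum C D = dsum (A + C) (B + D)"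
  using assms unfolding dsum_def
  by (subst add_four_block_mat[of _ a a _ b _ b]) auto

lemma dsum_one: "dsum (1\<^sub>m a) (1\<^sub>m b) = 1\<^sub>m (a + b)"
  unfolding dsum_def by (intro eq_matI) auto

lemma dsum_zero: "dsum (0\<^sub>m a a) (0\<^sub>m b b) = 0\<^sub>m (a + b) (a + b)"
  unfolding dsum_def by (intro eq_matI) auto

lemma dsum_pow:
  fixes A B :: "'a :: semiring_1 mat"
  assumes "A \<in> carrier_mat a a" "B \<in> carrier_mat b b"
  shows "dsum A B ^\<^sub>m k = dsum (A ^\<^sub>m k) (B ^\<^sub>m k)"
proof (induction k)
  case 0
  show ?case using assms carrier_matD(1)[OF dsum_closed[OF assms]] by (simp add: dsum_one)
next
  case (Suc k)
  thus ?case using assms by (simp add: dsum_mult[of _ a _ b])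
qed

lemma dsum_mat_sum:
  fixes f g :: "nat \<Rightarrow> 'a :: semiring_0 mat"
  assumes "\<And>i. i < k \<Longrightarrow> f i \<in> carrier_mat a a" "\<And>i. i < k \<Longrightarrow> g i \<in> carrier_mat b b"
  shows "mat_sum (a + b) (\<lambda>i. dsum (f i) (g i)) k = dsum (mat_sum a f k) (mat_sum b g k)"
  using assms by (induction k) (auto simp: dsum_zero dsum_add[of _ a _ b])

lemma dsum_trace:
  assumes "A \<in> carrier_mat a a" "B \<in> carrier_mat b b"
  shows "mat_trace (dsum A B) = mat_trace A + mat_trace B"
proof -
  have "mat_trace (dsum A B) = (\<Sum>i<a + b. if i < a then A $$ (i, i) else B $$ (i - a, i - a))"
    using assms unfolding mat_trace_def dsum_def by (intro sum.cong) auto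
  also have "\<dots> = (\<Sum>i<a. A $$ (i, i)) + (\<Sum>i<b. B $$ (i, i))"
  proof -
    have "(\<Sum>i<a + b. g i) = (\<Sum>i<a. g i) + (\<Sum>i<b. g (a + i))" for g :: "nat \<Rightarrow> 'a"
      by (induction b) (simp_all add: add.assoc)
    from this[of "\<lambda>i. if i < a then A $$ (i, i) else B $$ (i - a, i - a)"] show ?thesis by simp
  qed
  finally show ?thesis using assms by (simp add: mat_trace_def)
qed

abbreviation unipotent_jordan_matrix :: "nat list \<Rightarrow> 'a :: field mat" where
  "unipotent_jordan_matrix ds \<equiv> jordan_matrix (map (\<lambda>d. (d, 1)) ds)"

lemma unipotent_jordan_matrix_Cons:
  "unipotent_jordan_matrix (d # ds) = dsum (jordan_block d (1 :: 'a :: field)) (unipotent_jordan_matrix ds)"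
  by (simp add: jordan_matrix_Cons dsum_def comp_def)

lemma unipotent_jordan_matrix_carrier:
  "unipotent_jordan_matrix ds \<in> carrier_mat (sum_list ds) (sum_list ds)"
  using jordan_matrix_carrier[of "map (\<lambda>d. (d, 1)) ds"] by (simp add: comp_def)

text \<open>Take the direct sum of the slices of the blocks.\<close>

lemma unipotent_jordan_average:
  fixes ds :: "nat list"
  assumes p: "prime CHAR('a)" "q = CHAR('a) ^ a" and ds: "\<And>d. d \<in> set ds \<Longrightarrow> q dvd d \<and> d > 0"
  defines "J \<equiv> (unipotent_jordan_matrix ds :: 'a :: field mat)"
  shows "\<exists>w \<in> carrier_mat (sum_list ds) (sum_list ds). w * J ^\<^sub>m q = J ^\<^sub>m q * w \<and>
      mat_sum (sum_list ds) (\<lambda>i. J ^\<^sub>m i * w * J ^\<^sub>m (q - i)) q = J ^\<^sub>m q \<and>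
      mat_trace w = of_nat (sum_list ds div q)"
  using ds unfolding J_def
proof (induction ds)
  case Nil
  have c: "A = 0\<^sub>m 0 0" if "A \<in> carrier_mat 0 0" for A :: "'a mat" using that by auto
  have eq: "A = B" if "A \<in> carrier_mat 0 0" "B \<in> carrier_mat 0 0" for A B :: "'a mat"
    using c[OF that(1)] c[OF that(2)] by simp
  let ?J = "unipotent_jordan_matrix [] :: 'a mat"
  have J: "?J ^\<^sub>m k \<in> carrier_mat 0 0" for k
    by (rule pow_carrier_mat) (use unipotent_jordan_matrix_carrier[of "[]", where ?'a = 'a] in simp)
  have z: "(0\<^sub>m 0 0 :: 'a mat) \<in> carrier_mat 0 0" by simp
  note m = mult_carrier_mat[OF z J] mult_carrier_mat[OF J z]
  have "mat_sum 0 (\<lambda>i. ?J ^\<^sub>m i * 0\<^sub>m 0 0 * ?J ^\<^sub>m (q - i)) q \<in> carrier_mat 0 0"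
    by (rule mat_sum_closed) (rule mult_carrier_mat[OF m(2) J])
  note sum = eq[OF this J]
  have "mat_trace (0\<^sub>m 0 0 :: 'a mat) = of_nat (sum_list [] div q)" by (simp add: mat_trace_def)
  with sum eq[OF m] z show ?case unfolding sum_list.Nil by blast
next
  case (Cons d ds)
  let ?n = "sum_list ds" and ?K = "unipotent_jordan_matrix ds :: 'a mat" and ?J = "jordan_block d (1 :: 'a)"
  have q: "q > 0" using p prime_gt_0_nat by auto
  obtain w where w: "w \<in> carrier_mat ?n ?n" "w * ?K ^\<^sub>m q = ?K ^\<^sub>m q * w"
    "mat_sum ?n (\<lambda>i. ?K ^\<^sub>m i * w * ?K ^\<^sub>m (q - i)) q = ?K ^\<^sub>m q" "mat_trace w = of_nat (?n div q)"
    using Cons.IH[OF Cons.prems] by (meson list.set_intros(2))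
  let ?b = "block_slice q d :: 'a mat"
  have d: "q dvd d" "d > 0" using Cons.prems by auto
  note K = unipotent_jordan_matrix_carrier[of ds, where ?'a = 'a]
  have Kk: "?K ^\<^sub>m k \<in> carrier_mat ?n ?n" for k using K by (rule pow_carrier_mat)
  have Jk: "?J ^\<^sub>m k \<in> carrier_mat d d" for k by (rule pow_carrier_mat) simp
  have b: "?b \<in> carrier_mat d d" by simp
  have pow: "unipotent_jordan_matrix (d # ds) ^\<^sub>m k = dsum (?J ^\<^sub>m k) (?K ^\<^sub>m k)" for k
    unfolding unipotent_jordan_matrix_Cons by (rule dsum_pow[OF jordan_block_carrier K])
  show ?case
  proof (intro bexI[of _ "dsum ?b w"] conjI)
    show "dsum ?b w * unipotent_jordan_matrix (d # ds) ^\<^sub>m q = unipotent_jordan_matrix (d # ds) ^\<^sub>m q * dsum ?b w"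
      unfolding pow dsum_mult[OF b w(1) Jk Kk] dsum_mult[OF Jk Kk b w(1)] w(2) block_slice_commute[OF p d(1)] ..
    have "mat_sum (d + ?n) (\<lambda>i. unipotent_jordan_matrix (d # ds) ^\<^sub>m i * dsum ?b w * unipotent_jordan_matrix (d # ds) ^\<^sub>m (q - i)) q
      = mat_sum (d + ?n) (\<lambda>i. dsum (?J ^\<^sub>m i * ?b * ?J ^\<^sub>m (q - i)) (?K ^\<^sub>m i * w * ?K ^\<^sub>m (q - i))) q"
      unfolding pow dsum_mult[OF Jk Kk b w(1)]
        dsum_mult[OF mult_carrier_mat[OF Jk b] mult_carrier_mat[OF Kk w(1)] Jk Kk] ..
    also have "\<dots> = dsum (?J ^\<^sub>m q) (?K ^\<^sub>m q)"
      unfolding dsum_mat_sum[OF mult_carrier_mat[OF mult_carrier_mat[OF Jk b] Jk]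
          mult_carrier_mat[OF mult_carrier_mat[OF Kk w(1)] Kk]] w(3) block_slice_average[OF p d] ..
    finally show "mat_sum (sum_list (d # ds)) (\<lambda>i. unipotent_jordan_matrix (d # ds) ^\<^sub>m i * dsum ?b w *
        unipotent_jordan_matrix (d # ds) ^\<^sub>m (q - i)) q = unipotent_jordan_matrix (d # ds) ^\<^sub>m q"
      unfolding pow by simp
    show "mat_trace (dsum ?b w) = of_nat (sum_list (d # ds) div q)"
      unfolding dsum_trace[OF b w(1)] w(4) block_slice_trace[OF q d(1)] sum_list.Cons
        div_plus_div_distrib_dvd_left[OF d(1)] of_nat_add ..
    show "dsum ?b w \<in> carrier_mat (sum_list (d # ds)) (sum_list (d # ds))" using b w(1) by simp
  qed
qed

text \<open>Take the slice on one block of size \<open>e\<close> and zero on all others.\<close>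

lemma unipotent_jordan_centralizer_trace:
  fixes ds :: "nat list"
  assumes p: "prime CHAR('a)" "q = CHAR('a) ^ a" and e: "e \<in> set ds" "q dvd e"
  defines "J \<equiv> (unipotent_jordan_matrix ds :: 'a :: field mat)"
  shows "\<exists>w \<in> carrier_mat (sum_list ds) (sum_list ds). w * J ^\<^sub>m q = J ^\<^sub>m q * w \<and>
      mat_trace w = of_nat (e div q)"
  using e unfolding J_def
proof (induction ds)
  case (Cons d ds)
  let ?n = "sum_list ds" and ?K = "unipotent_jordan_matrix ds :: 'a mat" and ?J = "jordan_block d (1 :: 'a)"
  have q: "q > 0" using p prime_gt_0_nat by auto
  note K = unipotent_jordan_matrix_carrier[of ds, where ?'a = 'a]
  have Kk: "?K ^\<^sub>m k \<in> carrier_mat ?n ?n" for k using K by (rule pow_carrier_mat)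
  have Jk: "?J ^\<^sub>m k \<in> carrier_mat d d" for k by (rule pow_carrier_mat) simp
  have pow: "unipotent_jordan_matrix (d # ds) ^\<^sub>m k = dsum (?J ^\<^sub>m k) (?K ^\<^sub>m k)" for k
    unfolding unipotent_jordan_matrix_Cons by (rule dsum_pow[OF jordan_block_carrier K])
  obtain b w where bw: "b \<in> carrier_mat d d" "w \<in> carrier_mat ?n ?n" "b * ?J ^\<^sub>m q = ?J ^\<^sub>m q * b"
    "w * ?K ^\<^sub>m q = ?K ^\<^sub>m q * w" "mat_trace b + mat_trace w = of_nat (e div q)"
  proof (cases "e = d")
    case True
    show ?thesis
    proof (rule that[of "block_slice q d" "0\<^sub>m ?n ?n"])
      show "block_slice q d * ?J ^\<^sub>m q = ?J ^\<^sub>m q * block_slice q d"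
        by (rule block_slice_commute[OF p]) (use True Cons.prems in simp)
      show "0\<^sub>m ?n ?n * ?K ^\<^sub>m q = ?K ^\<^sub>m q * 0\<^sub>m ?n ?n"
        using left_mult_zero_mat[OF Kk] right_mult_zero_mat[OF Kk] by simp
      show "mat_trace (block_slice q d) + mat_trace (0\<^sub>m ?n ?n :: 'a mat) = of_nat (e div q)"
        using block_slice_trace[OF q, of d, where ?'a = 'a] True Cons.prems by (simp add: mat_trace_zero)
    qed simp_all
  next
    case False
    hence "e \<in> set ds" using Cons.prems by simp
    from Cons.IH[OF this Cons.prems(2)] obtain w where
      "w \<in> carrier_mat ?n ?n" "w * ?K ^\<^sub>m q = ?K ^\<^sub>m q * w" "mat_trace w = of_nat (e div q)"
      by blast
    thus ?thesis using that[of "0\<^sub>m d d" w] left_mult_zero_mat[OF Jk] right_mult_zero_mat[OF Jk]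
      by (simp add: mat_trace_zero)
  qed
  show ?case
  proof (intro bexI[of _ "dsum b w"] conjI)
    show "dsum b w * unipotent_jordan_matrix (d # ds) ^\<^sub>m q = unipotent_jordan_matrix (d # ds) ^\<^sub>m q * dsum b w"
      unfolding pow dsum_mult[OF bw(1,2) Jk Kk] dsum_mult[OF Jk Kk bw(1,2)] bw(3,4) ..
    show "mat_trace (dsum b w) = of_nat (e div q)" unfolding dsum_trace[OF bw(1,2)] by (rule bw(5))
    show "dsum b w \<in> carrier_mat (sum_list (d # ds)) (sum_list (d # ds))" using bw(1,2) by simp
  qed
qed simp

lemma assoc_mult_dim:
  fixes A B C :: "'a :: semiring_0 mat"
  shows "dim_col A = dim_row B \<Longrightarrow> dim_col B = dim_row C \<Longrightarrow> A * B * C = A * (B * C)"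
  by (rule assoc_mult_mat) (auto intro: carrier_matI)

lemma mat_pow_mult_inverse:
  assumes "u \<in> carrier_mat n n" "v \<in> carrier_mat n n" "u * v = (1\<^sub>m n :: 'a :: field mat)"
  shows "u ^\<^sub>m k * v ^\<^sub>m k = 1\<^sub>m n"
proof (induction k)
  case (Suc k)
  note d = carrier_matD[OF assms(1)] carrier_matD[OF assms(2)]
  have "u ^\<^sub>m Suc k * v ^\<^sub>m Suc k = u ^\<^sub>m k * u * (v * v ^\<^sub>m k)"
    using mat_pow_Suc_left[OF assms(2), of k] by simp
  also have "\<dots> = u ^\<^sub>m k * ((u * v) * v ^\<^sub>m k)" by (simp add: assoc_mult_dim d)
  finally show ?case using Suc left_mult_one_mat[OF pow_carrier_mat[OF assms(2)]] by (simp add: assms(3))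
qed (use assms in simp)

lemma jordan_nf_unipotent_dim:
  fixes u :: "'a :: field mat"
  assumes "u \<in> carrier_mat n n" "jordan_nf u (map (\<lambda>d. (d, 1)) ds)"
  shows "sum_list ds = n" "0 \<notin> set ds"
proof -
  from assms(2) obtain P Q where "similar_mat_wit u (unipotent_jordan_matrix ds) P Q"
    unfolding jordan_nf_def similar_mat_def by blast
  from similar_mat_witD2(5)[OF assms(1) this] show "sum_list ds = n"
    using unipotent_jordan_matrix_carrier[of ds, where ?'a = 'a] by (metis carrier_matD(1))
  show "0 \<notin> set ds" using assms(2) unfolding jordan_nf_def by force
qed

lemma conj_mult:
  fixes P Q A B :: "'a :: semiring_1 mat"
  assumes c: "P \<in> carrier_mat n n" "Q \<in> carrier_mat n n" "Q * P = 1\<^sub>m n"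
    and AB: "A \<in> carrier_mat n n" "B \<in> carrier_mat n n"
  shows "(P * A * Q) * (P * B * Q) = P * (A * B) * Q"
proof -
  note d = carrier_matD[OF c(1)] carrier_matD[OF c(2)] carrier_matD[OF AB(1)] carrier_matD[OF AB(2)]
  have "(P * A * Q) * (P * B * Q) = P * A * ((Q * P) * (B * Q))"
    by (simp add: assoc_mult_dim d)
  also have "\<dots> = P * A * (B * Q)" using c AB left_mult_one_mat[OF mult_carrier_mat[OF AB(2) c(2)]] by simp
  also have "\<dots> = P * (A * B) * Q" by (simp add: assoc_mult_dim d)
  finally show ?thesis .
qed

lemma unipotent_average:
  fixes u :: "'a :: field mat"
  assumes p: "prime CHAR('a)" "q = CHAR('a) ^ a" and ds: "\<And>d. d \<in> set ds \<Longrightarrow> q dvd d"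
    and u: "u \<in> carrier_mat n n" and jnf: "jordan_nf u (map (\<lambda>d. (d, 1)) ds)"
    and v: "v \<in> carrier_mat n n" "u * v = 1\<^sub>m n"
  obtains w where "w \<in> carrier_mat n n" "w * u ^\<^sub>m q = u ^\<^sub>m q * w"
    "mat_sum n (\<lambda>i. u ^\<^sub>m i * w * v ^\<^sub>m i) q = 1\<^sub>m n" "mat_trace w = of_nat (n div q)"
proof -
  note n = jordan_nf_unipotent_dim[OF u jnf]
  let ?J = "unipotent_jordan_matrix ds :: 'a mat"
  obtain P Q where PQ: "similar_mat_wit u ?J P Q"
    using jnf unfolding jordan_nf_def similar_mat_def by blast
  note D = similar_mat_witD2[OF u PQ]
  have pow: "u ^\<^sub>m k = P * ?J ^\<^sub>m k * Q" for k by (rule similar_mat_wit_pow_id[OF PQ])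
  have pos: "q dvd d \<and> d > 0" if "d \<in> set ds" for d using ds[OF that] n(2) that by (metis gr0I)
  have "\<exists>w \<in> carrier_mat n n. w * ?J ^\<^sub>m q = ?J ^\<^sub>m q * w \<and>
      mat_sum n (\<lambda>i. ?J ^\<^sub>m i * w * ?J ^\<^sub>m (q - i)) q = ?J ^\<^sub>m q \<and> mat_trace w = of_nat (n div q)"
    unfolding n(1)[symmetric] by (rule unipotent_jordan_average[OF p pos])
  then obtain w where w: "w \<in> carrier_mat n n" "w * ?J ^\<^sub>m q = ?J ^\<^sub>m q * w"
    "mat_sum n (\<lambda>i. ?J ^\<^sub>m i * w * ?J ^\<^sub>m (q - i)) q = ?J ^\<^sub>m q" "mat_trace w = of_nat (n div q)"
    by blast
  have Jk: "?J ^\<^sub>m k \<in> carrier_mat n n" for k using D(5) by (rule pow_carrier_mat)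
  have conj: "(P * A * Q) * (P * B * Q) = P * (A * B) * Q"
    if "A \<in> carrier_mat n n" "B \<in> carrier_mat n n" for A B
    using conj_mult[OF D(6,7,2) that] .
  define w' where "w' = P * w * Q"
  have w': "w' \<in> carrier_mat n n" using w(1) D(6,7) by (simp add: w'_def)
  have uk: "u ^\<^sub>m k \<in> carrier_mat n n" "v ^\<^sub>m k \<in> carrier_mat n n" for k using u v by simp_all
  have s: "u ^\<^sub>m i * w' * u ^\<^sub>m (q - i) = P * (?J ^\<^sub>m i * w * ?J ^\<^sub>m (q - i)) * Q" for i
    unfolding pow w'_def conj[OF Jk w(1)] conj[OF mult_carrier_mat[OF Jk w(1)] Jk] ..
  have c: "?J ^\<^sub>m i * w * ?J ^\<^sub>m (q - i) \<in> carrier_mat n n" for i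
    by (rule mult_carrier_mat[OF mult_carrier_mat[OF Jk w(1)] Jk])
  have c': "u ^\<^sub>m i * w' * u ^\<^sub>m (q - i) \<in> carrier_mat n n" for i
    by (rule mult_carrier_mat[OF mult_carrier_mat[OF uk(1) w'] uk(1)])
  have "mat_sum n (\<lambda>i. u ^\<^sub>m i * w' * u ^\<^sub>m (q - i)) q =
      P * mat_sum n (\<lambda>i. ?J ^\<^sub>m i * w * ?J ^\<^sub>m (q - i)) q * Q"
    unfolding s mat_sum_mult_left[OF c D(6)] mat_sum_mult_right[OF mult_carrier_mat[OF D(6) c] D(7)] ..
  hence sum: "mat_sum n (\<lambda>i. u ^\<^sub>m i * w' * u ^\<^sub>m (q - i)) q = u ^\<^sub>m q"
    unfolding w(3) pow[of q] .
  show ?thesis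
  proof (rule that[of w'])
    show "w' * u ^\<^sub>m q = u ^\<^sub>m q * w'"
      unfolding pow w'_def conj[OF Jk w(1)] conj[OF w(1) Jk] w(2) ..
    show "mat_trace w' = of_nat (n div q)" unfolding w'_def
      using mat_trace_similar[OF w(1) D(6,7,2)] w(4) by simp
    have "mat_sum n (\<lambda>i. u ^\<^sub>m i * w' * v ^\<^sub>m i) q = mat_sum n (\<lambda>i. u ^\<^sub>m i * w' * u ^\<^sub>m (q - i) * v ^\<^sub>m q) q"
    proof (rule mat_sum_cong)
      fix i assume "i < q"
      hence vq: "v ^\<^sub>m q = v ^\<^sub>m (q - i) * v ^\<^sub>m i" using mat_pow_add[OF v(1), of "q - i" i] by simp
      have uv: "u ^\<^sub>m (q - i) * v ^\<^sub>m q = v ^\<^sub>m i"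
        unfolding vq assoc_mult_mat[OF uk(1) uk(2) uk(2), symmetric] mat_pow_mult_inverse[OF u v]
        by (rule left_mult_one_mat[OF uk(2)])
      show "u ^\<^sub>m i * w' * v ^\<^sub>m i = u ^\<^sub>m i * w' * u ^\<^sub>m (q - i) * v ^\<^sub>m q"
        unfolding assoc_mult_mat[OF mult_carrier_mat[OF uk(1) w'] uk(1) uk(2)] uv ..
    qed
    also have "\<dots> = u ^\<^sub>m q * v ^\<^sub>m q"
      unfolding mat_sum_mult_right[OF c' uk(2), symmetric] sum ..
    also have "\<dots> = 1\<^sub>m n" by (rule mat_pow_mult_inverse[OF u v])
    finally show "mat_sum n (\<lambda>i. u ^\<^sub>m i * w' * v ^\<^sub>m i) q = 1\<^sub>m n" .
  qed (rule w')
qed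

lemma unipotent_centralizer_trace:
  fixes u :: "'a :: field mat"
  assumes p: "prime CHAR('a)" "q = CHAR('a) ^ a" and e: "e \<in> set ds" "q dvd e"
    and u: "u \<in> carrier_mat n n" and jnf: "jordan_nf u (map (\<lambda>d. (d, 1)) ds)"
  obtains w where "w \<in> carrier_mat n n" "w * u ^\<^sub>m q = u ^\<^sub>m q * w" "mat_trace w = of_nat (e div q)"
proof -
  note n = jordan_nf_unipotent_dim[OF u jnf]
  let ?J = "unipotent_jordan_matrix ds :: 'a mat"
  obtain P Q where PQ: "similar_mat_wit u ?J P Q"
    using jnf unfolding jordan_nf_def similar_mat_def by blast
  note D = similar_mat_witD2[OF u PQ]
  have pow: "u ^\<^sub>m k = P * ?J ^\<^sub>m k * Q" for k by (rule similar_mat_wit_pow_id[OF PQ])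
  obtain w where w: "w \<in> carrier_mat n n" "w * ?J ^\<^sub>m q = ?J ^\<^sub>m q * w" "mat_trace w = of_nat (e div q)"
    using unipotent_jordan_centralizer_trace[OF p e] unfolding n(1) by blast
  have Jk: "?J ^\<^sub>m k \<in> carrier_mat n n" for k using D(5) by (rule pow_carrier_mat)
  have conj: "(P * A * Q) * (P * B * Q) = P * (A * B) * Q"
    if "A \<in> carrier_mat n n" "B \<in> carrier_mat n n" for A B
    using conj_mult[OF D(6,7,2) that] .
  show ?thesis
  proof (rule that[of "P * w * Q"])
    show "P * w * Q * u ^\<^sub>m q = u ^\<^sub>m q * (P * w * Q)"
      unfolding pow conj[OF Jk w(1)] conj[OF w(1) Jk] w(2) ..
    show "mat_trace (P * w * Q) = of_nat (e div q)"
      using mat_trace_similar[OF w(1) D(6,7,2)] w(3) by simp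
  qed (use w(1) D(6,7) in simp)
qed

section \<open>The special linear group and its big cell\<close>

lemma SL_carrier: "g \<in> carrier (SL_grp n) \<longleftrightarrow> g \<in> carrier_mat n n \<and> det g = 1"
  by (simp add: SL_grp_def)

lemma SL_mult: "mult (SL_grp n) = (*)"
  by (simp add: SL_grp_def GL_grp_def units_of_def ring_mat_simps)

lemma SL_mult_closed:
  "g \<in> carrier (SL_grp n) \<Longrightarrow> h \<in> carrier (SL_grp n) \<Longrightarrow> g * h \<in> carrier (SL_grp n)"
  by (auto simp: SL_carrier det_mult)

lemma SL_one: "1\<^sub>m n \<in> carrier (SL_grp n)"
  by (simp add: SL_carrier)

lemma SL_adj_mat:
  assumes "g \<in> carrier (SL_grp n)"
  shows "adj_mat g \<in> carrier (SL_grp n)" "g * adj_mat g = 1\<^sub>m n" "adj_mat g * g = 1\<^sub>m n"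
proof -
  have g: "g \<in> carrier_mat n n" "det g = 1" using assms by (auto simp: SL_carrier)
  show 2: "g * adj_mat g = 1\<^sub>m n" "adj_mat g * g = 1\<^sub>m n" using adj_mat[OF g(1)] g(2)
    by (auto intro!: eq_matI)
  have "det g * det (adj_mat g) = 1"
    using arg_cong[OF 2(1), of det] det_mult[OF g(1) adj_mat(1)[OF g(1)]] by simp
  thus "adj_mat g \<in> carrier (SL_grp n)" using adj_mat(1)[OF g(1)] g(2) by (simp add: SL_carrier)
qed

lemma entry_polynomials_sum:
  "(\<And>x. x \<in> I \<Longrightarrow> F x \<in> entry_polynomials n) \<Longrightarrow> (\<lambda>A. \<Sum>x\<in>I. F x A) \<in> entry_polynomials n"
proof (induction I rule: infinite_finite_induct)
  case (insert x I)
  thus ?case using entry_polynomials.add[of "F x" n "\<lambda>A. \<Sum>x\<in>I. F x A"] by simp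
qed (auto intro: entry_polynomials.const)

lemma entry_polynomials_prod:
  "(\<And>x. x \<in> I \<Longrightarrow> F x \<in> entry_polynomials n) \<Longrightarrow> (\<lambda>A. \<Prod>x\<in>I. F x A) \<in> entry_polynomials n"
proof (induction I rule: infinite_finite_induct)
  case (insert x I)
  thus ?case using entry_polynomials.mult[of "F x" n "\<lambda>A. \<Prod>x\<in>I. F x A"] by simp
qed (auto intro: entry_polynomials.const)

definition leading_block :: "nat \<Rightarrow> 'a mat \<Rightarrow> 'a mat" where
  "leading_block k A = mat k k (\<lambda>(i, j). A $$ (i, j))"

lemma leading_block_closed [simp]: "leading_block k A \<in> carrier_mat k k"
  by (simp add: leading_block_def)

lemma entry_polynomials_leading_minor:
  assumes "k \<le> n"
  shows "(\<lambda>A :: 'a :: field mat. det (leading_block k A)) \<in> entry_polynomials n"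
proof -
  have "(\<lambda>A :: 'a mat. \<Sum>p | p permutes {0..<k}. signof p * (\<Prod>i = 0..<k. A $$ (i, p i))) \<in> entry_polynomials n"
  proof (intro entry_polynomials_sum entry_polynomials.mult entry_polynomials.const entry_polynomials_prod)
    fix p i assume "p \<in> {p. p permutes {0..<k}}" "i \<in> {0..<k}"
    hence "p i < k" "i < k" using permutes_in_image[of p "{0..<k}" i] by auto
    thus "(\<lambda>A :: 'a mat. A $$ (i, p i)) \<in> entry_polynomials n"
      using assms by (intro entry_polynomials.entry) auto
  qed
  also have "(\<lambda>A :: 'a mat. \<Sum>p | p permutes {0..<k}. signof p * (\<Prod>i = 0..<k. A $$ (i, p i)))
      = (\<lambda>A. det (leading_block k A))"
  proof
    fix A :: "'a mat"
    show "(\<Sum>p | p permutes {0..<k}. signof p * (\<Prod>i = 0..<k. A $$ (i, p i))) = det (leading_block k A)"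
      unfolding det_def'[OF leading_block_closed]
    proof (intro sum.cong refl arg_cong2[of _ _ _ _ "(*)"] prod.cong)
      fix p i assume "p \<in> {p. p permutes {0..<k}}" "i \<in> {0..<k}"
      hence "p i < k" "i < k" using permutes_in_image[of p "{0..<k}" i] by auto
      thus "A $$ (i, p i) = leading_block k A $$ (i, p i)" by (simp add: leading_block_def)
    qed
  qed
  finally show ?thesis .
qed

text \<open>
  A polynomial function along a curve whose coordinates are rational functions with denominator \<open>d\<close>
  is a rational function with denominator a power of \<open>d\<close>.
\<close>

lemma entry_polynomials_curve:
  fixes A :: "'a :: field \<Rightarrow> 'a mat" and d :: "'a poly"
  assumes F: "F \<in> entry_polynomials n"
    and A: "\<And>i j. i < n \<Longrightarrow> j < n \<Longrightarrow> \<exists>q. \<forall>s. poly d s \<noteq> 0 \<longrightarrow> poly d s * A s $$ (i, j) = poly q s"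
  shows "\<exists>D q. \<forall>s. poly d s \<noteq> 0 \<longrightarrow> poly d s ^ D * F (A s) = poly q s"
  using F
proof induction
  case (const c)
  show ?case by (rule exI[of _ 0], rule exI[of _ "[:c:]"]) simp
next
  case (entry i j)
  from A[OF this] obtain q where "\<forall>s. poly d s \<noteq> 0 \<longrightarrow> poly d s * A s $$ (i, j) = poly q s" by blast
  thus ?case by (intro exI[of _ 1] exI[of _ q]) simp
next
  case (add f g)
  then obtain D q E r where
    q: "\<And>s. poly d s \<noteq> 0 \<Longrightarrow> poly d s ^ D * f (A s) = poly q s" and
    r: "\<And>s. poly d s \<noteq> 0 \<Longrightarrow> poly d s ^ E * g (A s) = poly r s" by blast
  have "poly d s ^ (D + E) * (f (A s) + g (A s)) = poly (d ^ E * q + d ^ D * r) s" if "poly d s \<noteq> 0" for s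
    using q[OF that, symmetric] r[OF that, symmetric] by (simp add: poly_power power_add algebra_simps)
  thus ?case by blast
next
  case (mult f g)
  then obtain D q E r where
    q: "\<And>s. poly d s \<noteq> 0 \<Longrightarrow> poly d s ^ D * f (A s) = poly q s" and
    r: "\<And>s. poly d s \<noteq> 0 \<Longrightarrow> poly d s ^ E * g (A s) = poly r s" by blast
  have "poly d s ^ (D + E) * (f (A s) * g (A s)) = poly (q * r) s" if "poly d s \<noteq> 0" for s
    using q[OF that, symmetric] r[OF that, symmetric] by (simp add: poly_power power_add algebra_simps)
  thus ?case by blast
qed

lemma poly_eqI_cofinite:
  fixes f g :: "'a :: field poly"
  assumes inf: "infinite (UNIV :: 'a set)" and fin: "finite X" and eq: "\<And>s. s \<notin> X \<Longrightarrow> poly f s = poly g s"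
  shows "f = g"
proof (rule ccontr)
  assume "f \<noteq> g"
  hence "finite {s. poly (f - g) s = 0}" by (intro poly_roots_finite) simp
  moreover have "UNIV - X \<subseteq> {s. poly (f - g) s = 0}" using eq by auto
  ultimately have "finite (UNIV - X)" by (rule finite_subset[rotated])
  with inf fin show False by simp
qed

lemma alg_closed_infinite: "infinite (UNIV :: 'a :: alg_closed_field set)"
proof
  assume fin: "finite (UNIV :: 'a set)"
  let ?f = "(\<Prod>a\<in>UNIV. [:-a, 1:]) + 1 :: 'a poly"
  have "degree (\<Prod>a\<in>(UNIV :: 'a set). [:-a, 1:]) = card (UNIV :: 'a set)"
    by (subst degree_prod_eq_sum_degree) auto
  moreover have "card (UNIV :: 'a set) > 0" using fin by (simp add: card_gt_0_iff)
  ultimately have "degree ?f > 0" by (subst degree_add_eq_left) auto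
  then obtain x where "poly ?f x = 0" using alg_closed_imp_poly_has_root by blast
  moreover have "poly ?f x = 1" using fin by (simp add: poly_prod prod_zero_iff)
  ultimately show False by simp
qed

text \<open>
  The matrices with nonzero leading minors are dense in \<open>SL\<^sub>n(K)\<close>. Instead of the Zariski topology,
  the proof uses for each \<open>g\<close> a rational curve in \<open>SL\<^sub>n(K)\<close> through \<open>1\<close> and \<open>g\<close>. Along it the leading
  minors are rational functions that do not vanish at \<open>1\<close>, so only finitely many points of the curve
  are outside the big cell; and \<open>K\<close> is infinite.
\<close>

lemma SL_density:
  fixes F :: "'a :: alg_closed_field mat \<Rightarrow> 'a"
  assumes F: "F \<in> entry_polynomials n" and n: "n > 0"
    and big: "\<And>g. g \<in> carrier (SL_grp n) \<Longrightarrow> (\<And>k. k \<le> n \<Longrightarrow> det (leading_block k g) \<noteq> 0) \<Longrightarrow> F g = 0"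
    and g: "g \<in> carrier (SL_grp n)"
  shows "F g = 0"
proof -
  have gc: "g \<in> carrier_mat n n" "det g = 1" using g by (auto simp: SL_carrier)
  \<comment> \<open>The segment from \<open>1\<close> to \<open>g\<close>. Its first column is then divided by the determinant.\<close>
  define B where "B s = mat n n (\<lambda>(i, j). (1 - s) * (if i = j then 1 else 0) + s * g $$ (i, j))" for s
  have Bc: "B s \<in> carrier_mat n n" for s by (simp add: B_def)
  define b where "b i j = [:if i = j then 1 else 0, g $$ (i, j) - (if i = j then 1 else 0):]" for i j
  have b: "B s $$ (i, j) = poly (b i j) s" if "i < n" "j < n" for i j s
    using that by (simp add: B_def b_def algebra_simps)
  have lb: "leading_block n (B s) = B s" for s using carrier_matD[OF Bc[of s]] by (intro eq_matI) (auto simp: leading_block_def)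
  have "\<exists>q. \<forall>s. poly 1 s \<noteq> 0 \<longrightarrow> poly 1 s * B s $$ (i, j) = poly q s" if "i < n" "j < n" for i j
    using b[OF that] by auto
  from entry_polynomials_curve[OF entry_polynomials_leading_minor[OF le_refl[of n]] this]
  obtain \<delta> where "\<And>s. det (leading_block n (B s)) = poly \<delta> s" by auto
  hence \<delta>: "det (B s) = poly \<delta> s" for s by (simp add: lb)
  define E where "E s = mat n n (\<lambda>(i, j). if i = j then if i = 0 then 1 / poly \<delta> s else 1 else 0)" for s
  have Ec: "E s \<in> carrier_mat n n" for s by (simp add: E_def)
  have detE: "det (E s) = 1 / poly \<delta> s" for s
  proof -
    have "det (E s) = prod_list (diag_mat (E s))"
      by (rule det_upper_triangular[OF _ Ec]) (auto simp: E_def)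
    also have "\<dots> = (\<Prod>i\<in>{0..<n}. E s $$ (i, i))" using carrier_matD[OF Ec[of s]] by (simp add: prod_list_diag_prod)
    also have "\<dots> = (\<Prod>i\<in>{0..<n}. if i = 0 then 1 / poly \<delta> s else 1)" by (intro prod.cong) (auto simp: E_def)
    also have "\<dots> = 1 / poly \<delta> s" using n by (subst prod.delta) auto
    finally show ?thesis .
  qed
  define y where "y s = B s * E s" for s
  have yc: "y s \<in> carrier_mat n n" for s using mult_carrier_mat[OF Bc Ec] by (simp add: y_def)
  have yij: "y s $$ (i, j) = B s $$ (i, j) * (if j = 0 then 1 / poly \<delta> s else 1)" if "i < n" "j < n" for i j s
  proof -
    have "y s $$ (i, j) = (\<Sum>k<n. B s $$ (i, k) * (if k = j then if j = 0 then 1 / poly \<delta> s else 1 else 0))"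
      using that Bc[of s] Ec[of s] by (auto simp: y_def E_def scalar_prod_def atLeast0LessThan intro!: sum.cong)
    also have "\<dots> = (\<Sum>k<n. if k = j then B s $$ (i, k) * (if j = 0 then 1 / poly \<delta> s else 1) else 0)"
      by (intro sum.cong) auto
    finally show ?thesis using that by simp
  qed
  have curve: "\<exists>q. \<forall>s. poly \<delta> s \<noteq> 0 \<longrightarrow> poly \<delta> s * y s $$ (i, j) = poly q s" if "i < n" "j < n" for i j
    using yij[OF that] b[OF that]
    by (intro exI[of _ "if j = 0 then b i j else \<delta> * b i j"]) auto
  have B0: "B 0 = 1\<^sub>m n" by (intro eq_matI) (auto simp: B_def)
  have B1: "B 1 = g" using gc by (intro eq_matI) (auto simp: B_def)
  have d0: "poly \<delta> 0 = 1" using \<delta>[of 0] B0 by simp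
  have d1: "poly \<delta> 1 = 1" using \<delta>[of 1] B1 gc by simp
  have y0: "y 0 = 1\<^sub>m n" using yc[of 0] by (intro eq_matI) (auto simp: yij d0 B0)
  have y1: "y 1 = g" using yc[of 1] gc by (intro eq_matI) (auto simp: yij d1 B1)
  have "\<exists>D q. \<forall>s. poly \<delta> s \<noteq> 0 \<longrightarrow> poly \<delta> s ^ D * det (leading_block k (y s)) = poly q s" if "k \<le> n" for k
    by (rule entry_polynomials_curve[OF entry_polynomials_leading_minor[OF that] curve])
  then obtain D q where q: "\<And>k s. k \<le> n \<Longrightarrow> poly \<delta> s \<noteq> 0 \<Longrightarrow> poly \<delta> s ^ D k * det (leading_block k (y s)) = poly (q k) s"
    by metis
  obtain D' r where r: "\<And>s. poly \<delta> s \<noteq> 0 \<Longrightarrow> poly \<delta> s ^ D' * F (y s) = poly r s"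
    using entry_polynomials_curve[OF F curve] by blast
  have q0: "q k \<noteq> 0" if "k \<le> n" for k
  proof -
    have "leading_block k (1\<^sub>m n) = (1\<^sub>m k :: 'a mat)" using that by (intro eq_matI) (auto simp: leading_block_def)
    hence "poly (q k) 0 = 1" using q[OF that, of 0] d0 y0 by simp
    thus ?thesis by auto
  qed
  have "\<delta> \<noteq> 0" using d0 by auto
  \<comment> \<open>The parameters at which the curve is undefined or meets the complement of the big cell.\<close>
  define X where "X = {s. poly \<delta> s = 0} \<union> (\<Union>k\<le>n. {s. poly (q k) s = 0})"
  have "finite X" unfolding X_def using \<open>\<delta> \<noteq> 0\<close> q0 by (auto intro: poly_roots_finite)
  have "r = 0"
  proof (rule poly_eqI_cofinite[OF alg_closed_infinite \<open>finite X\<close>])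
    fix s assume s: "s \<notin> X"
    hence ds: "poly \<delta> s \<noteq> 0" by (auto simp: X_def)
    have "det (y s) = 1" using det_mult[OF Bc Ec, of s s] \<delta> detE ds by (simp add: y_def)
    hence "y s \<in> carrier (SL_grp n)" using yc by (simp add: SL_carrier)
    moreover have "det (leading_block k (y s)) \<noteq> 0" if "k \<le> n" for k
      using q[OF that ds] s that ds by (auto simp: X_def)
    ultimately have "F (y s) = 0" by (rule big)
    thus "poly r s = poly 0 s" using r[OF ds] by simp
  qed
  thus ?thesis using r[of 1] d1 y1 by simp
qed

section \<open>The matrix coefficient of the highest weight vector\<close>

definition lower_unitriangular :: "nat \<Rightarrow> 'a :: field mat \<Rightarrow> bool" where
  "lower_unitriangular n x \<longleftrightarrow> x \<in> carrier_mat n n \<and> (\<forall>i<n. x $$ (i, i) = 1) \<and>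
     (\<forall>j<n. \<forall>i<j. x $$ (i, j) = 0)"

lemma lower_triangular_det:
  assumes "c \<in> carrier_mat n n" "\<And>i j. i < j \<Longrightarrow> j < n \<Longrightarrow> c $$ (i, j) = 0"
  shows "det c = (\<Prod>i<n. c $$ (i, i) :: 'a :: field)"
proof -
  have "det c = prod_list (diag_mat c)" by (rule det_lower_triangular[OF _ assms(1)]) (use assms in auto)
  also have "\<dots> = (\<Prod>i<n. c $$ (i, i))"
    using carrier_matD[OF assms(1)] by (simp add: prod_list_diag_prod atLeast0LessThan)
  finally show ?thesis .
qed

lemma lower_unitriangular_SL: "lower_unitriangular n x \<Longrightarrow> x \<in> carrier (SL_grp n)"
  using lower_triangular_det[of x n] by (simp add: lower_unitriangular_def SL_carrier)

lemma upper_unitriangular_det: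
  assumes "y \<in> carrier_mat n n" "\<And>i. i < n \<Longrightarrow> y $$ (i, i) = 1" "\<And>i j. j < i \<Longrightarrow> i < n \<Longrightarrow> y $$ (i, j) = 0"
  shows "det y = (1 :: 'a :: field)"
proof -
  have "det y = prod_list (diag_mat y)"
    by (rule det_upper_triangular[OF _ assms(1)]) (use assms in \<open>auto intro!: upper_triangularI\<close>)
  also have "\<dots> = (\<Prod>i<n. y $$ (i, i))"
    using carrier_matD[OF assms(1)] by (simp add: prod_list_diag_prod atLeast0LessThan)
  also have "\<dots> = 1" using assms(2) by simp
  finally show ?thesis .
qed

text \<open>
  Gaussian elimination by columns: the entries of \<open>y\<close> above the diagonal in column \<open>k\<close> solve a linear
  system whose matrix is the leading block of size \<open>k\<close>.
\<close>

lemma leading_minors_factorization: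
  fixes g :: "'a :: field mat"
  assumes g: "g \<in> carrier_mat n n" and minors: "\<And>k. k \<le> n \<Longrightarrow> det (leading_block k g) \<noteq> 0"
  obtains y where "y \<in> SL_max_unipotent n" "\<And>i k. i < k \<Longrightarrow> k < n \<Longrightarrow> (g * y) $$ (i, k) = 0"
proof -
  have "\<exists>x \<in> carrier_vec k. leading_block k g *\<^sub>v x = vec k (\<lambda>i. - g $$ (i, k))" if k: "k < n" for k
  proof -
    have "det (leading_block k g) \<noteq> 0" using minors k by simp
    from det_non_zero_imp_unit[OF leading_block_closed this, of "()"] obtain M where
      M: "M \<in> carrier_mat k k" "leading_block k g * M = 1\<^sub>m k" by (auto simp: Units_def ring_mat_simps)
    let ?b = "vec k (\<lambda>i. - g $$ (i, k))"
    have "leading_block k g *\<^sub>v (M *\<^sub>v ?b) = (leading_block k g * M) *\<^sub>v ?b"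
      using assoc_mult_mat_vec[OF leading_block_closed M(1), of ?b g] by simp
    also have "\<dots> = ?b" unfolding M(2) by simp
    finally show ?thesis using M(1) by (intro bexI[of _ "M *\<^sub>v ?b"]) auto
  qed
  then obtain X where X: "\<And>k. k < n \<Longrightarrow> X k \<in> carrier_vec k"
    "\<And>k. k < n \<Longrightarrow> leading_block k g *\<^sub>v X k = vec k (\<lambda>i. - g $$ (i, k))" by metis
  define y where "y = mat n n (\<lambda>(j, k). if j < k then X k $ j else if j = k then 1 else 0)"
  have yc: "y \<in> carrier_mat n n" by (simp add: y_def)
  have "det y = 1" by (rule upper_unitriangular_det[OF yc]) (auto simp: y_def)
  hence "y \<in> SL_max_unipotent n"
    using yc by (auto simp: SL_max_unipotent_def SL_carrier y_def intro!: upper_triangularI)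
  moreover have "(g * y) $$ (i, k) = 0" if "i < k" "k < n" for i k
  proof -
    have "(g * y) $$ (i, k) = (\<Sum>j<n. g $$ (i, j) * y $$ (j, k))"
      using that g yc by (auto simp: scalar_prod_def atLeast0LessThan)
    also have "\<dots> = (\<Sum>j\<in>{..<k} \<union> {k}. g $$ (i, j) * y $$ (j, k))"
      by (rule sum.mono_neutral_right) (use that in \<open>auto simp: y_def\<close>)
    also have "\<dots> = (\<Sum>j<k. g $$ (i, j) * y $$ (j, k)) + g $$ (i, k) * y $$ (k, k)"
      by (subst sum.union_disjoint) auto
    also have "(\<Sum>j<k. g $$ (i, j) * y $$ (j, k)) = (\<Sum>j<k. g $$ (i, j) * X k $ j)"
      using that by (intro sum.cong) (auto simp: y_def)
    also have "\<dots> = (leading_block k g *\<^sub>v X k) $ i"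
      using that X(1)[OF that(2)] by (auto simp: scalar_prod_def atLeast0LessThan leading_block_def intro!: sum.cong)
    also have "\<dots> = - g $$ (i, k)" using X(2)[OF that(2)] that by simp
    finally show ?thesis using that by (simp add: y_def)
  qed
  ultimately show ?thesis by (rule that)
qed

lemma leading_block_mult_upper:
  assumes "g \<in> carrier_mat n n" "y \<in> carrier_mat n n" "\<And>i j. j < i \<Longrightarrow> i < n \<Longrightarrow> y $$ (i, j) = 0" "k \<le> n"
  shows "leading_block k (g * y :: 'a :: field mat) = leading_block k g * leading_block k y"
proof (rule eq_matI)
  fix i j assume "i < dim_row (leading_block k g * leading_block k y)" "j < dim_col (leading_block k g * leading_block k y)"
  hence ij: "i < k" "j < k" by (auto simp: leading_block_def)
  have "leading_block k (g * y) $$ (i, j) = (\<Sum>l<n. g $$ (i, l) * y $$ (l, j))"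
    using ij assms by (auto simp: leading_block_def scalar_prod_def atLeast0LessThan)
  also have "\<dots> = (\<Sum>l<k. g $$ (i, l) * y $$ (l, j))"
    by (rule sum.mono_neutral_right) (use ij assms in auto)
  also have "\<dots> = (leading_block k g * leading_block k y) $$ (i, j)"
    using ij by (auto simp: leading_block_def scalar_prod_def atLeast0LessThan intro!: sum.cong)
  finally show "leading_block k (g * y) $$ (i, j) = (leading_block k g * leading_block k y) $$ (i, j)" .
qed (auto simp: leading_block_def)

text \<open>
  The coefficient of the highest weight vector of \<open>V\<close> times that of \<open>V\<^sup>*\<close>, the latter being the
  minor of the first \<open>n - 1\<close> rows and columns.
\<close>

definition hw_coeff :: "nat \<Rightarrow> 'a :: field mat \<Rightarrow> 'a" where
  "hw_coeff n g = g $$ (0, 0) * det (leading_block (n - 1) g)"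

lemma hw_coeff_mult_upper:
  assumes g: "g \<in> carrier_mat n n" and y: "y \<in> SL_max_unipotent n" and n: "n \<ge> 2"
  shows "hw_coeff n (g * y :: 'a :: field mat) = hw_coeff n g"
proof -
  have yc: "y \<in> carrier_mat n n" "\<And>i j. j < i \<Longrightarrow> i < n \<Longrightarrow> y $$ (i, j) = 0" "\<And>i. i < n \<Longrightarrow> y $$ (i, i) = 1"
    using y by (auto simp: SL_max_unipotent_def SL_carrier)
  have "det (leading_block (n - 1) y) = 1"
    by (rule upper_unitriangular_det[OF leading_block_closed]) (use yc in \<open>auto simp: leading_block_def\<close>)
  hence 1: "det (leading_block (n - 1) (g * y)) = det (leading_block (n - 1) g)"
    using leading_block_mult_upper[OF g yc(1,2), of "n - 1"]
      det_mult[OF leading_block_closed leading_block_closed, of "n - 1" g y] by simp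
  have "(g * y) $$ (0, 0) = (\<Sum>l<n. g $$ (0, l) * y $$ (l, 0))"
    using g yc n by (auto simp: scalar_prod_def atLeast0LessThan)
  also have "\<dots> = (\<Sum>l\<in>{0}. g $$ (0, l) * y $$ (l, 0))"
    by (rule sum.mono_neutral_right) (use yc n in auto)
  finally show ?thesis using 1 yc n by (simp add: hw_coeff_def)
qed

lemma hw_coeff_lower:
  assumes c: "c \<in> carrier_mat n n" and l: "\<And>i j. i < j \<Longrightarrow> j < n \<Longrightarrow> c $$ (i, j) = 0" and n: "n \<ge> 2"
  shows "hw_coeff n c = c $$ (0, 0) * (\<Prod>j<n - 1. c $$ (j, j) :: 'a :: field)"
proof -
  have "det (leading_block (n - 1) c) = (\<Prod>j<n - 1. leading_block (n - 1) c $$ (j, j))"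
    by (rule lower_triangular_det[OF leading_block_closed]) (use l in \<open>auto simp: leading_block_def\<close>)
  also have "\<dots> = (\<Prod>j<n - 1. c $$ (j, j))" by (intro prod.cong) (auto simp: leading_block_def)
  finally show ?thesis by (simp add: hw_coeff_def)
qed

text \<open>
  A rational representation with a highest weight vector \<open>v\<close> of weight \<open>\<varpi>\<^sub>1 + \<varpi>\<^sub>n\<^sub>-\<^sub>1\<close>.
  As a character of the torus, this weight is \<open>t \<mapsto> t\<^sub>1\<^sub>1 \<sqdot> (t\<^sub>1\<^sub>1 \<dots> t\<^sub>n\<^sub>-\<^sub>1\<^sub>,\<^sub>n\<^sub>-\<^sub>1)\<close>.
\<close>

locale hw_rep =
  fixes n N :: nat and \<rho> :: "'a :: alg_closed_field mat \<Rightarrow> 'a mat" and v :: "'a vec"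
  assumes n: "n \<ge> 2" and rational: "rational_SL_rep n N \<rho>"
    and v: "v \<in> carrier_vec N" "v \<noteq> 0\<^sub>v N"
    and fixed: "\<And>x. x \<in> SL_max_unipotent n \<Longrightarrow> \<rho> x *\<^sub>v v = v"
    and weight: "\<And>t. t \<in> SL_torus n \<Longrightarrow> \<rho> t *\<^sub>v v = (t $$ (0, 0) * (\<Prod>j<n - 1. t $$ (j, j))) \<cdot>\<^sub>v v"
begin

lemma rho_closed: "g \<in> carrier (SL_grp n) \<Longrightarrow> \<rho> g \<in> carrier_mat N N"
  using rational by (auto simp: rational_SL_rep_def hom_def GL_grp_def units_of_def Units_def ring_mat_simps Pi_def)

lemma rho_mult:
  "g \<in> carrier (SL_grp n) \<Longrightarrow> h \<in> carrier (SL_grp n) \<Longrightarrow> \<rho> (g * h) = \<rho> g * \<rho> h"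
  using rational by (auto simp: rational_SL_rep_def hom_def SL_mult GL_grp_def units_of_def ring_mat_simps)

lemma rho_one: "\<rho> (1\<^sub>m n) = 1\<^sub>m N"
proof -
  have "\<rho> (1\<^sub>m n) \<in> Units (ring_mat TYPE('a) N ())"
    using rational SL_one[of n] by (auto simp: rational_SL_rep_def hom_def GL_grp_def units_of_def Pi_def)
  then obtain M where M: "M \<in> carrier_mat N N" "M * \<rho> (1\<^sub>m n) = 1\<^sub>m N"
    by (auto simp: Units_def ring_mat_simps)
  note r = rho_closed[OF SL_one]
  have "\<rho> (1\<^sub>m n) * \<rho> (1\<^sub>m n) = \<rho> (1\<^sub>m n)" using rho_mult[OF SL_one SL_one] by simp
  hence "(M * \<rho> (1\<^sub>m n)) * \<rho> (1\<^sub>m n) = 1\<^sub>m N" unfolding assoc_mult_mat[OF M(1) r r] using M(2) by simp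
  thus ?thesis unfolding M(2) left_mult_one_mat[OF r] .
qed

lemma rho_entry:
  "\<exists>F \<in> entry_polynomials n. \<forall>g \<in> carrier (SL_grp n). \<rho> g $$ (i, j) = F g" if "i < N" "j < N"
  using rational that by (auto simp: rational_SL_rep_def)

lemma rho_curve:
  fixes A :: "'a \<Rightarrow> 'a mat" and d :: "'a poly"
  assumes A: "\<And>i j. i < n \<Longrightarrow> j < n \<Longrightarrow> \<exists>q. \<forall>s. poly d s \<noteq> 0 \<longrightarrow> poly d s * A s $$ (i, j) = poly q s"
    and SL: "\<And>s. poly d s \<noteq> 0 \<Longrightarrow> A s \<in> carrier (SL_grp n)"
  shows "\<exists>D Q. \<forall>i<N. \<forall>j<N. \<forall>s. poly d s \<noteq> 0 \<longrightarrow> poly d s ^ D * \<rho> (A s) $$ (i, j) = poly (Q i j) s"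
proof -
  have "\<exists>E q. i < N \<longrightarrow> j < N \<longrightarrow> (\<forall>s. poly d s \<noteq> 0 \<longrightarrow> poly d s ^ E * \<rho> (A s) $$ (i, j) = poly q s)" for i j
  proof (cases "i < N \<and> j < N")
    case True
    with rho_entry[of i j] obtain F where F: "F \<in> entry_polynomials n" "\<And>g. g \<in> carrier (SL_grp n) \<Longrightarrow> \<rho> g $$ (i, j) = F g"
      by blast
    from entry_polynomials_curve[OF F(1) A] obtain E q where
      "\<And>s. poly d s \<noteq> 0 \<Longrightarrow> poly d s ^ E * F (A s) = poly q s" by blast
    thus ?thesis using F(2) SL by auto
  qed auto
  then obtain E q where Eq: "\<And>i j s. i < N \<Longrightarrow> j < N \<Longrightarrow> poly d s \<noteq> 0 \<Longrightarrow>
      poly d s ^ E i j * \<rho> (A s) $$ (i, j) = poly (q i j) s" by metis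
  define D where "D = (\<Sum>i<N. \<Sum>j<N. E i j)"
  have "poly d s ^ D * \<rho> (A s) $$ (i, j) = poly (d ^ (D - E i j) * q i j) s"
    if "i < N" "j < N" "poly d s \<noteq> 0" for i j s
  proof -
    have "E i j \<le> (\<Sum>j<N. E i j)" using that by (intro member_le_sum) auto
    also have "\<dots> \<le> D" unfolding D_def using that by (intro member_le_sum[of i _ "\<lambda>i. \<Sum>j<N. E i j"]) auto
    finally have "poly d s ^ D = poly d s ^ (D - E i j) * poly d s ^ E i j" by (simp add: power_add[symmetric])
    thus ?thesis using Eq[OF that, symmetric] by (simp add: poly_power algebra_simps)
  qed
  thus ?thesis by (intro exI[of _ D] exI[of _ "\<lambda>i j. d ^ (D - E i j) * q i j"]) auto
qed

text \<open>
  The map \<open>P\<close> plays the role of the projection to the weight space of \<open>v\<close>. Let \<open>\<gamma>\<close> be a one-parameter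
  subgroup of the torus such that conjugation by \<open>\<gamma>(s)\<close> multiplies the entry \<open>(i, j)\<close> by
  \<open>s\<^sup>2\<^sup>(\<^sup>i\<^sup>-\<^sup>j\<^sup>)\<close>. For lower unitriangular \<open>x\<close> the conjugate \<open>y(s)\<close> of \<open>x\<close> is polynomial in \<open>s\<close> with
  \<open>y(0) = 1\<close>. If \<open>\<gamma>(s) v = s\<^sup>-\<^sup>m v\<close>, then \<open>s\<^sup>m \<gamma>(s) x v = y(s) v\<close>, so the constant coefficient of the left
  hand side is \<open>v\<close>. It depends linearly on the vector \<open>x v\<close>, and \<open>P\<close> is the map which extracts it.
\<close>

lemma highest_coefficient_exists:
  "\<exists>P \<in> carrier_mat N N. \<forall>x. lower_unitriangular n x \<longrightarrow> P *\<^sub>v (\<rho> x *\<^sub>v v) = v"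
proof -
  define c where "c = n - 1"
  \<comment> \<open>The exponents \<open>2 i - (n - 1)\<close> add up to zero, so the determinant is 1.\<close>
  define \<gamma> where "\<gamma> s = mat n n (\<lambda>(i, j). if i = j then s ^ (2 * i) / s ^ c else 0)" for s :: 'a
  have \<gamma>c: "\<gamma> s \<in> carrier_mat n n" for s by (simp add: \<gamma>_def)
  have \<gamma>prod: "(\<Prod>i<k. \<gamma> s $$ (i, i)) = s ^ (k * (k - 1)) / s ^ (c * k)" if "k \<le> n" for s k
    using that
  proof (induction k)
    case (Suc k)
    have k: "k * (k - 1) + 2 * k = Suc k * (Suc k - 1)" by (cases k) auto
    have "s ^ (Suc k * (Suc k - 1)) = s ^ (k * (k - 1)) * s ^ (2 * k)" unfolding power_add[symmetric] k ..
    moreover have "\<gamma> s $$ (k, k) = s ^ (2 * k) / s ^ c" using Suc.prems by (simp add: \<gamma>_def)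
    moreover have "s ^ (c * Suc k) = s ^ (c * k) * s ^ c" by (simp only: mult_Suc_right power_add mult.commute)
    moreover have "(\<Prod>i<k. \<gamma> s $$ (i, i)) = s ^ (k * (k - 1)) / s ^ (c * k)" using Suc by simp
    ultimately show ?case by (simp only: prod.lessThan_Suc times_divide_times_eq)
  qed simp
  have \<gamma>SL: "\<gamma> s \<in> carrier (SL_grp n)" "\<gamma> s \<in> SL_torus n" if "s \<noteq> 0" for s
  proof -
    have "det (\<gamma> s) = (\<Prod>i<n. \<gamma> s $$ (i, i))"
      by (rule lower_triangular_det[OF \<gamma>c]) (auto simp: \<gamma>_def)
    also have "\<dots> = 1" using that \<gamma>prod[of n s] by (simp add: mult.commute c_def)
    finally have "det (\<gamma> s) = 1" .
    thus "\<gamma> s \<in> carrier (SL_grp n)" unfolding SL_carrier using \<gamma>c by blast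
    moreover have "diagonal_mat (\<gamma> s)" by (simp add: diagonal_mat_def \<gamma>_def)
    ultimately show "\<gamma> s \<in> SL_torus n" by (simp only: SL_torus_def mem_Collect_eq)
  qed
  define m where "m = 2 * c"
  have \<gamma>v: "s ^ m \<cdot>\<^sub>v (\<rho> (\<gamma> s) *\<^sub>v v) = v" if "s \<noteq> 0" for s
  proof -
    obtain k where k: "n = Suc (Suc k)" using le_Suc_ex[OF n] by auto
    hence c: "c = Suc k" by (simp add: c_def)
    have "(\<Prod>j<c. \<gamma> s $$ (j, j)) = s ^ (c * k) / s ^ (c * c)"
      using \<gamma>prod[of c s] by (simp add: c k)
    also have "c * c = c * k + c" by (simp add: c)
    also have "s ^ (c * k) / s ^ \<dots> = 1 / s ^ c" using that by (simp add: power_add)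
    finally have p: "(\<Prod>j<c. \<gamma> s $$ (j, j)) = 1 / s ^ c" .
    have g0: "\<gamma> s $$ (0, 0) = 1 / s ^ c" using n by (simp add: \<gamma>_def)
    have "\<gamma> s $$ (0, 0) * (\<Prod>j<n - 1. \<gamma> s $$ (j, j)) = 1 / s ^ m"
      unfolding c_def[symmetric] p g0 m_def mult_2 power_add by simp
    thus ?thesis using weight[OF \<gamma>SL(2)[OF that]] v that by (simp add: smult_smult_assoc)
  qed
  have "\<exists>q. \<forall>s. poly (monom 1 c) s \<noteq> 0 \<longrightarrow> poly (monom 1 c) s * \<gamma> s $$ (i, j) = poly q s"
    if "i < n" "j < n" for i j
    using that by (intro exI[of _ "if i = j then monom 1 (2 * i) else 0"]) (auto simp: \<gamma>_def poly_monom)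
  from rho_curve[OF this \<gamma>SL(1)] obtain D Q where
    "\<forall>i<N. \<forall>j<N. \<forall>s. poly (monom 1 c) s \<noteq> 0 \<longrightarrow> poly (monom 1 c) s ^ D * \<rho> (\<gamma> s) $$ (i, j) = poly (Q i j) s"
    using n by (auto simp: poly_monom c_def)
  hence Q: "(s ^ c) ^ D * \<rho> (\<gamma> s) $$ (i, j) = poly (Q i j) s" if "i < N" "j < N" "s \<noteq> 0" for i j s
    using that by (simp add: poly_monom)
  \<comment> \<open>Denominators are cleared by \<open>s\<close> to the power \<open>D'\<close>, so the constant coefficient moves to degree \<open>D'\<close>.\<close>
  define D' where "D' = c * D"
  define P where "P = mat N N (\<lambda>(i, j). coeff (monom 1 m * Q i j) D')"
  have Pc: "P \<in> carrier_mat N N" by (simp add: P_def)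
  have "P *\<^sub>v (\<rho> x *\<^sub>v v) = v" if x: "lower_unitriangular n x" for x
  proof -
    have xc: "x \<in> carrier_mat n n" "\<And>i. i < n \<Longrightarrow> x $$ (i, i) = 1" "\<And>i j. i < j \<Longrightarrow> j < n \<Longrightarrow> x $$ (i, j) = 0"
      using x by (auto simp: lower_unitriangular_def)
    define y where "y s = mat n n (\<lambda>(i, j). if j \<le> i then x $$ (i, j) * s ^ (2 * (i - j)) else 0)" for s
    have yl: "lower_unitriangular n (y s)" for s using xc by (auto simp: lower_unitriangular_def y_def)
    have yc: "y s \<in> carrier_mat n n" for s by (simp add: y_def)
    have y0: "y 0 = 1\<^sub>m n" using xc by (intro eq_matI) (auto simp: y_def)
    have comm: "\<gamma> s * x = y s * \<gamma> s" if "s \<noteq> 0" for s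
    proof (rule eq_matI)
      fix i j assume "i < dim_row (y s * \<gamma> s)" "j < dim_col (y s * \<gamma> s)"
      hence ij: "i < n" "j < n" by (auto simp: y_def \<gamma>_def)
      have "(\<gamma> s * x) $$ (i, j) = (\<Sum>k<n. (if i = k then s ^ (2 * i) / s ^ c else 0) * x $$ (k, j))"
        using ij xc by (auto simp: \<gamma>_def scalar_prod_def atLeast0LessThan intro!: sum.cong)
      also have "\<dots> = (\<Sum>k<n. if i = k then s ^ (2 * i) / s ^ c * x $$ (k, j) else 0)" by (intro sum.cong) auto
      also have "\<dots> = s ^ (2 * i) / s ^ c * x $$ (i, j)" using ij by simp
      finally have 1: "(\<gamma> s * x) $$ (i, j) = s ^ (2 * i) / s ^ c * x $$ (i, j)" .
      have "(y s * \<gamma> s) $$ (i, j) = (\<Sum>k<n. y s $$ (i, k) * (if k = j then s ^ (2 * k) / s ^ c else 0))"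
        using ij yc[of s] by (auto simp: \<gamma>_def scalar_prod_def atLeast0LessThan intro!: sum.cong)
      also have "\<dots> = (\<Sum>k<n. if k = j then y s $$ (i, k) * (s ^ (2 * k) / s ^ c) else 0)" by (intro sum.cong) auto
      also have "\<dots> = y s $$ (i, j) * (s ^ (2 * j) / s ^ c)" using ij by simp
      also have "\<dots> = s ^ (2 * i) / s ^ c * x $$ (i, j)"
      proof (cases "j \<le> i")
        case True
        hence e: "2 * (i - j) + 2 * j = 2 * i" by simp
        have "s ^ (2 * i) = s ^ (2 * (i - j)) * s ^ (2 * j)" unfolding power_add[symmetric] e ..
        thus ?thesis using True ij by (simp add: y_def)
      next
        case False
        thus ?thesis using ij xc(3)[of i j] by (simp add: y_def)
      qed
      finally show "(\<gamma> s * x) $$ (i, j) = (y s * \<gamma> s) $$ (i, j)" using 1 by simp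
    qed (use xc in \<open>auto simp: \<gamma>_def y_def\<close>)
    have "\<exists>q. \<forall>s. poly 1 s \<noteq> 0 \<longrightarrow> poly 1 s * y s $$ (i, j) = poly q s" if "i < n" "j < n" for i j
      using that by (intro exI[of _ "if j \<le> i then monom (x $$ (i, j)) (2 * (i - j)) else 0"]) (auto simp: y_def poly_monom)
    from rho_curve[OF this lower_unitriangular_SL[OF yl]] obtain R where
      R: "\<And>i j s. i < N \<Longrightarrow> j < N \<Longrightarrow> \<rho> (y s) $$ (i, j) = poly (R i j) s" by auto
    define w where "w = \<rho> x *\<^sub>v v"
    note rc = rho_closed[OF lower_unitriangular_SL[OF x]]
    have w: "w \<in> carrier_vec N" using rc v by (simp add: w_def)
    have key: "s ^ m \<cdot>\<^sub>v (\<rho> (\<gamma> s) *\<^sub>v w) = \<rho> (y s) *\<^sub>v v" if "s \<noteq> 0" for s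
    proof -
      note gc = rho_closed[OF \<gamma>SL(1)[OF that]] and yc' = rho_closed[OF lower_unitriangular_SL[OF yl[of s]]]
      have "\<rho> (\<gamma> s) *\<^sub>v w = (\<rho> (\<gamma> s) * \<rho> x) *\<^sub>v v" unfolding w_def by (rule assoc_mult_mat_vec[OF gc rc v(1), symmetric])
      also have "\<dots> = (\<rho> (y s) * \<rho> (\<gamma> s)) *\<^sub>v v"
        unfolding rho_mult[OF \<gamma>SL(1)[OF that] lower_unitriangular_SL[OF x], symmetric]
          rho_mult[OF lower_unitriangular_SL[OF yl] \<gamma>SL(1)[OF that], symmetric] comm[OF that] ..
      also have "\<dots> = \<rho> (y s) *\<^sub>v (\<rho> (\<gamma> s) *\<^sub>v v)" by (rule assoc_mult_mat_vec[OF yc' gc v(1)])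
      finally have "s ^ m \<cdot>\<^sub>v (\<rho> (\<gamma> s) *\<^sub>v w) = \<rho> (y s) *\<^sub>v (s ^ m \<cdot>\<^sub>v (\<rho> (\<gamma> s) *\<^sub>v v))"
        unfolding mult_mat_vec[OF yc' mult_mat_vec_carrier[OF gc v(1)]] by (rule arg_cong)
      thus ?thesis unfolding \<gamma>v[OF that] .
    qed
    have "(P *\<^sub>v w) $ i = v $ i" if i: "i < N" for i
    proof -
      let ?L = "monom 1 m * (\<Sum>j<N. Polynomial.smult (w $ j) (Q i j))"
      let ?R = "monom 1 D' * (\<Sum>j<N. Polynomial.smult (v $ j) (R i j))"
      have "?L = ?R"
      proof (rule poly_eqI_cofinite[OF alg_closed_infinite])
        fix s :: 'a assume s: "s \<notin> {0}"
        hence s0: "s \<noteq> 0" by simp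
        have "s ^ m * (\<Sum>j<N. \<rho> (\<gamma> s) $$ (i, j) * w $ j) = (\<Sum>j<N. \<rho> (y s) $$ (i, j) * v $ j)"
          using arg_cong[OF key[OF s0], of "\<lambda>x. vec_index x i"] i w v rho_closed[OF \<gamma>SL(1)[OF s0]]
            rho_closed[OF lower_unitriangular_SL[OF yl[of s]]]
          by (simp add: scalar_prod_def atLeast0LessThan)
        hence "s ^ D' * (s ^ m * (\<Sum>j<N. \<rho> (\<gamma> s) $$ (i, j) * w $ j)) = s ^ D' * (\<Sum>j<N. \<rho> (y s) $$ (i, j) * v $ j)" by simp
        also have "s ^ D' * (s ^ m * (\<Sum>j<N. \<rho> (\<gamma> s) $$ (i, j) * w $ j)) =
            s ^ m * (\<Sum>j<N. w $ j * poly (Q i j) s)"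
          using i s0 by (simp add: Q[symmetric] sum_distrib_left D'_def power_mult[symmetric] mult_ac)
        also have "(\<Sum>j<N. \<rho> (y s) $$ (i, j) * v $ j) = (\<Sum>j<N. v $ j * poly (R i j) s)"
          using i by (intro sum.cong) (auto simp: R)
        finally show "poly ?L s = poly ?R s" by (simp add: poly_monom poly_sum)
      qed simp
      hence "coeff ?L D' = coeff ?R D'" by simp
      also have "coeff ?R D' = (\<Sum>j<N. v $ j * poly (R i j) 0)"
        by (simp add: coeff_monom_mult coeff_sum poly_0_coeff_0)
      also have "\<dots> = (\<Sum>j<N. 1\<^sub>m N $$ (i, j) * v $ j)"
        using i by (intro sum.cong) (auto simp: R[symmetric] y0 rho_one)
      also have "\<dots> = (\<Sum>j<N. if j = i then v $ j else 0)" using i by (intro sum.cong) auto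
      also have "\<dots> = v $ i" using i by simp
      also have "coeff ?L D' = (\<Sum>j<N. P $$ (i, j) * w $ j)"
        using i by (simp add: sum_distrib_left coeff_sum P_def mult.commute)
      also have "\<dots> = (P *\<^sub>v w) $ i" using i w by (simp add: P_def scalar_prod_def atLeast0LessThan)
      finally show ?thesis .
    qed
    thus ?thesis using Pc v by (intro eq_vecI) (auto simp: w_def)
  qed
  with Pc show ?thesis by blast
qed

end

lemma lower_triangular_decomposition:
  fixes c :: "'a :: field mat"
  assumes c: "c \<in> carrier_mat n n" "\<And>i j. i < j \<Longrightarrow> j < n \<Longrightarrow> c $$ (i, j) = 0" and det: "det c = 1"
  obtains x t where "lower_unitriangular n x" "t \<in> SL_torus n" "c = x * t" "\<And>i. i < n \<Longrightarrow> t $$ (i, i) = c $$ (i, i)"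
proof -
  have p: "(\<Prod>i<n. c $$ (i, i)) = 1" using lower_triangular_det[OF c] det by simp
  have nz: "c $$ (i, i) \<noteq> 0" if "i < n" for i
  proof
    assume "c $$ (i, i) = 0"
    hence "(\<Prod>i<n. c $$ (i, i)) = 0" using that by (intro prod_zero) auto
    with p show False by simp
  qed
  define t where "t = mat n n (\<lambda>(i, j). if i = j then c $$ (i, i) else 0)"
  define x where "x = mat n n (\<lambda>(i, j). c $$ (i, j) / c $$ (j, j))"
  have "det t = (\<Prod>i<n. t $$ (i, i))" by (rule lower_triangular_det) (auto simp: t_def)
  also have "\<dots> = (\<Prod>i<n. c $$ (i, i))" by (intro prod.cong) (auto simp: t_def)
  finally have "det t = 1" using p by simp
  hence t: "t \<in> SL_torus n" by (auto simp: SL_torus_def SL_carrier diagonal_mat_def t_def)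
  have "c = x * t"
  proof (rule eq_matI)
    fix i j assume "i < dim_row (x * t)" "j < dim_col (x * t)"
    hence ij: "i < n" "j < n" by (auto simp: x_def t_def)
    have "(x * t) $$ (i, j) = (\<Sum>k<n. x $$ (i, k) * (if k = j then c $$ (k, k) else 0))"
      using ij by (auto simp: x_def t_def scalar_prod_def atLeast0LessThan intro!: sum.cong)
    also have "\<dots> = (\<Sum>k<n. if k = j then x $$ (i, k) * c $$ (k, k) else 0)" by (intro sum.cong) auto
    also have "\<dots> = x $$ (i, j) * c $$ (j, j)" using ij by simp
    also have "\<dots> = c $$ (i, j)" using ij nz by (simp add: x_def)
    finally show "c $$ (i, j) = (x * t) $$ (i, j)" by simp
  qed (use c(1) in \<open>auto simp: x_def t_def\<close>)
  moreover have "lower_unitriangular n x"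
    unfolding lower_unitriangular_def using nz c(2) by (auto simp: x_def)
  ultimately show ?thesis using that[of x t] t by (simp add: t_def)
qed

context hw_rep
begin

text \<open>
  On the big cell \<open>g = x t y\<^sup>-\<^sup>1\<close> with \<open>x\<close> lower unitriangular, \<open>t\<close> in the torus and \<open>y\<close> upper
  unitriangular. Here \<open>y\<close> fixes \<open>v\<close>, \<open>t\<close> acts on \<open>v\<close> by the weight, and \<open>P\<close> removes \<open>x\<close>.
\<close>

lemma coefficient_on_big_cell:
  assumes P: "P \<in> carrier_mat N N" "\<And>x. lower_unitriangular n x \<Longrightarrow> P *\<^sub>v (\<rho> x *\<^sub>v v) = v"
    and g: "g \<in> carrier (SL_grp n)" and minors: "\<And>k. k \<le> n \<Longrightarrow> det (leading_block k g) \<noteq> 0"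
  shows "P *\<^sub>v (\<rho> g *\<^sub>v v) = hw_coeff n g \<cdot>\<^sub>v v"
proof -
  have gc: "g \<in> carrier_mat n n" using g by (simp add: SL_carrier)
  obtain y where y: "y \<in> SL_max_unipotent n" "\<And>i k. i < k \<Longrightarrow> k < n \<Longrightarrow> (g * y) $$ (i, k) = 0"
    using leading_minors_factorization[OF gc minors] by blast
  hence ySL: "y \<in> carrier (SL_grp n)" by (simp add: SL_max_unipotent_def)
  have gy: "g * y \<in> carrier (SL_grp n)" by (rule SL_mult_closed[OF g ySL])
  hence gyc: "g * y \<in> carrier_mat n n" "det (g * y) = 1" by (simp_all only: SL_carrier)
  obtain x t where xt: "lower_unitriangular n x" "t \<in> SL_torus n" "g * y = x * t"
    "\<And>i. i < n \<Longrightarrow> t $$ (i, i) = (g * y) $$ (i, i)"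
    using lower_triangular_decomposition[OF gyc(1) y(2) gyc(2)] by blast
  have tSL: "t \<in> carrier (SL_grp n)" using xt(2) by (simp add: SL_torus_def)
  note xSL = lower_unitriangular_SL[OF xt(1)]
  have "\<rho> g *\<^sub>v v = \<rho> g *\<^sub>v (\<rho> y *\<^sub>v v)" unfolding fixed[OF y(1)] ..
  also have "\<dots> = (\<rho> g * \<rho> y) *\<^sub>v v" by (rule assoc_mult_mat_vec[OF rho_closed[OF g] rho_closed[OF ySL] v(1), symmetric])
  also have "\<dots> = (\<rho> x * \<rho> t) *\<^sub>v v"
    unfolding rho_mult[OF g ySL, symmetric] xt(3) rho_mult[OF xSL tSL] ..
  also have "\<dots> = \<rho> x *\<^sub>v (\<rho> t *\<^sub>v v)" by (rule assoc_mult_mat_vec[OF rho_closed[OF xSL] rho_closed[OF tSL] v(1)])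
  also have "\<rho> t *\<^sub>v v = hw_coeff n g \<cdot>\<^sub>v v"
  proof -
    have hw: "hw_coeff n (g * y) = (g * y) $$ (0, 0) * (\<Prod>j<n - 1. (g * y) $$ (j, j))"
      by (rule hw_coeff_lower[OF gyc(1) _ n]) (rule y(2))
    have "t $$ (0, 0) * (\<Prod>j<n - 1. t $$ (j, j)) = hw_coeff n (g * y)"
      unfolding hw using n xt(4)
      by (intro arg_cong2[of _ _ _ _ "(*)"] prod.cong) auto
    also have "\<dots> = hw_coeff n g" by (rule hw_coeff_mult_upper[OF gc y(1) n])
    finally show ?thesis using weight[OF xt(2)] by metis
  qed
  also have "\<rho> x *\<^sub>v (hw_coeff n g \<cdot>\<^sub>v v) = hw_coeff n g \<cdot>\<^sub>v (\<rho> x *\<^sub>v v)"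
    by (rule mult_mat_vec[OF rho_closed[OF xSL] v(1)])
  finally have "P *\<^sub>v (\<rho> g *\<^sub>v v) = P *\<^sub>v (hw_coeff n g \<cdot>\<^sub>v (\<rho> x *\<^sub>v v))" by (rule arg_cong)
  also have "\<dots> = hw_coeff n g \<cdot>\<^sub>v (P *\<^sub>v (\<rho> x *\<^sub>v v))"
    by (rule mult_mat_vec[OF P(1) mult_mat_vec_carrier[OF rho_closed[OF xSL] v(1)]])
  finally show ?thesis unfolding P(2)[OF xt(1)] .
qed

text \<open>
  A coordinate of \<open>P\<close> at which \<open>v\<close> is nonzero has the required values on the big cell, and both sides
  are polynomial functions of \<open>g\<close>, so that \<open>SL_density\<close> applies.
\<close>

lemma highest_coefficient:
  obtains \<phi> where "\<And>x y. x \<in> carrier_vec N \<Longrightarrow> y \<in> carrier_vec N \<Longrightarrow> \<phi> (x + y) = \<phi> x + \<phi> y"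
    "\<And>c x. x \<in> carrier_vec N \<Longrightarrow> \<phi> (c \<cdot>\<^sub>v x) = c * \<phi> x"
    "\<And>g. g \<in> carrier (SL_grp n) \<Longrightarrow> \<phi> (\<rho> g *\<^sub>v v) = hw_coeff n g"
proof -
  obtain P where P: "P \<in> carrier_mat N N" "\<And>x. lower_unitriangular n x \<Longrightarrow> P *\<^sub>v (\<rho> x *\<^sub>v v) = v"
    using highest_coefficient_exists by blast
  obtain i0 where i0: "i0 < N" "vec_index v i0 \<noteq> 0" using v by (metis eq_vecI carrier_vecD index_zero_vec)
  define \<phi> where "\<phi> x = (P *\<^sub>v x) $ i0 / v $ i0" for x
  have "\<exists>F. \<forall>j k. j < N \<longrightarrow> k < N \<longrightarrow> F j k \<in> entry_polynomials n \<and> (\<forall>g \<in> carrier (SL_grp n). \<rho> g $$ (j, k) = F j k g)"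
    using rho_entry by metis
  then obtain F where F: "\<And>j k. j < N \<Longrightarrow> k < N \<Longrightarrow> F j k \<in> entry_polynomials n"
    "\<And>j k g. j < N \<Longrightarrow> k < N \<Longrightarrow> g \<in> carrier (SL_grp n) \<Longrightarrow> \<rho> g $$ (j, k) = F j k g" by blast
  have expand: "(P *\<^sub>v (\<rho> g *\<^sub>v v)) $ i0 = (\<Sum>j<N. P $$ (i0, j) * (\<Sum>k<N. F j k g * v $ k))"
    if g: "g \<in> carrier (SL_grp n)" for g
  proof -
    note rg = rho_closed[OF g]
    have "(P *\<^sub>v (\<rho> g *\<^sub>v v)) $ i0 = (\<Sum>j<N. P $$ (i0, j) * (\<rho> g *\<^sub>v v) $ j)"
      using i0 P(1) rg v(1) by (auto simp: scalar_prod_def atLeast0LessThan intro!: sum.cong)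
    also have "\<dots> = (\<Sum>j<N. P $$ (i0, j) * (\<Sum>k<N. F j k g * v $ k))"
      using rg v(1) F(2)[OF _ _ g] by (intro sum.cong) (auto simp: scalar_prod_def atLeast0LessThan intro!: sum.cong)
    finally show ?thesis .
  qed
  let ?D = "\<lambda>g. (\<Sum>j<N. P $$ (i0, j) * (\<Sum>k<N. F j k g * v $ k)) + (- v $ i0) * (g $$ (0, 0) * det (leading_block (n - 1) g))"
  have poly: "?D \<in> entry_polynomials n"
    using n by (intro entry_polynomials.add entry_polynomials_sum entry_polynomials.mult entry_polynomials.const
        entry_polynomials.entry entry_polynomials_leading_minor F(1)) auto
  have coeff: "\<phi> (\<rho> g *\<^sub>v v) = hw_coeff n g" if g: "g \<in> carrier (SL_grp n)" for g
  proof -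
    have "?D g = 0"
    proof (rule SL_density[OF poly _ _ g])
      fix h :: "'a mat" assume h: "h \<in> carrier (SL_grp n)" "\<And>k. k \<le> n \<Longrightarrow> det (leading_block k h) \<noteq> 0"
      have "P *\<^sub>v (\<rho> h *\<^sub>v v) = hw_coeff n h \<cdot>\<^sub>v v"
        by (rule coefficient_on_big_cell[OF P(1) _ h(1)]) (use P(2) h(2) in auto)
      hence "(P *\<^sub>v (\<rho> h *\<^sub>v v)) $ i0 = hw_coeff n h * v $ i0" using i0 v(1) by simp
      thus "?D h = 0" unfolding expand[OF h(1)] by (simp add: hw_coeff_def)
    qed (use n in simp)
    hence "(P *\<^sub>v (\<rho> g *\<^sub>v v)) $ i0 = hw_coeff n g * v $ i0" unfolding expand[OF g] by (simp add: hw_coeff_def)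
    thus ?thesis using i0 by (simp add: \<phi>_def)
  qed
  show ?thesis
  proof (rule that[of \<phi>])
    fix x y :: "'a vec" assume xy: "x \<in> carrier_vec N" "y \<in> carrier_vec N"
    show "\<phi> (x + y) = \<phi> x + \<phi> y"
      unfolding \<phi>_def mult_add_distrib_mat_vec[OF P(1) xy] using i0 P(1) xy by (simp add: add_divide_distrib)
  next
    fix c and x :: "'a vec" assume x: "x \<in> carrier_vec N"
    show "\<phi> (c \<cdot>\<^sub>v x) = c * \<phi> x"
      unfolding \<phi>_def mult_mat_vec[OF P(1) x] using i0 P(1) by simp
  qed (rule coeff)
qed

end

definition unit_mat :: "nat \<Rightarrow> nat \<Rightarrow> nat \<Rightarrow> 'a :: field mat" where
  "unit_mat n i j = mat n n (\<lambda>(a, b). if a = i \<and> b = j then 1 else 0)"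

lemma unit_mat_closed [simp]: "unit_mat n i j \<in> carrier_mat n n" by (simp add: unit_mat_def)

lemma mult_unit_mat:
  assumes "A \<in> carrier_mat n n" "a < n" "b < n" "i < n"
  shows "(A * unit_mat n i j) $$ (a, b) = (if b = j then A $$ (a, i) else 0)"
proof -
  have "(A * unit_mat n i j) $$ (a, b) = (\<Sum>k<n. A $$ (a, k) * (if k = i \<and> b = j then 1 else 0))"
    using assms by (auto simp: unit_mat_def scalar_prod_def atLeast0LessThan intro!: sum.cong)
  also have "\<dots> = (\<Sum>k<n. if k = i then (if b = j then A $$ (a, k) else 0) else 0)" by (intro sum.cong) auto
  finally show ?thesis using assms by simp
qed

lemma unit_mat_mult:
  assumes "A \<in> carrier_mat n n" "a < n" "b < n" "j < n"
  shows "(unit_mat n i j * A) $$ (a, b) = (if a = i then A $$ (j, b) else 0)"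
proof -
  have "(unit_mat n i j * A) $$ (a, b) = (\<Sum>k<n. (if a = i \<and> k = j then 1 else 0) * A $$ (k, b))"
    using assms by (auto simp: unit_mat_def scalar_prod_def atLeast0LessThan intro!: sum.cong)
  also have "\<dots> = (\<Sum>k<n. if k = j then (if a = i then A $$ (k, b) else 0) else 0)" by (intro sum.cong) auto
  finally show ?thesis using assms by simp
qed

abbreviation highest_root_mat :: "nat \<Rightarrow> 'a :: field mat" where
  "highest_root_mat n \<equiv> unit_mat n 0 (n - 1)"

text \<open>
  The entry is \<open>g\<^sub>1\<^sub>1\<close> times the last diagonal entry of the adjugate, a minor of size \<open>n - 1\<close>. Hence
  the highest root vector of the adjoint representation has the same matrix coefficient as \<open>v\<close>.
\<close>

lemma adjoint_hw_coeff:
  assumes g: "g \<in> carrier (SL_grp n)" and n: "n \<ge> 2"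
  shows "(g * highest_root_mat n * adj_mat g) $$ (0, n - 1) = hw_coeff n (g :: 'a :: field mat)"
proof -
  have gc: "g \<in> carrier_mat n n" using g by (simp add: SL_carrier)
  note ac = adj_mat(1)[OF gc]
  have "(g * highest_root_mat n * adj_mat g) $$ (0, n - 1)
      = (\<Sum>k<n. (g * highest_root_mat n) $$ (0, k) * adj_mat g $$ (k, n - 1))"
    using n carrier_matD[OF gc] carrier_matD[OF ac] carrier_matD[OF unit_mat_closed[of n 0 "n - 1", where ?'a = 'a]]
    by (auto simp: scalar_prod_def atLeast0LessThan simp del: index_mult_mat(1) intro!: sum.cong)
       (subst index_mult_mat(1), auto simp: scalar_prod_def atLeast0LessThan intro!: sum.cong)
  also have "\<dots> = (\<Sum>k<n. if k = n - 1 then g $$ (0, 0) * adj_mat g $$ (k, n - 1) else 0)"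
    using n by (intro sum.cong) (auto simp: mult_unit_mat[OF gc])
  also have "\<dots> = g $$ (0, 0) * adj_mat g $$ (n - 1, n - 1)" using n by simp
  also have "adj_mat g $$ (n - 1, n - 1) = det (leading_block (n - 1) g)"
  proof -
    have "mat_delete g (n - 1) (n - 1) = leading_block (n - 1) g"
      using carrier_matD[OF gc] by (intro eq_matI) (auto simp: mat_delete_def leading_block_def)
    thus ?thesis using n carrier_matD[OF gc] by (simp add: adj_mat_def cofactor_def mult_2[symmetric])
  qed
  finally show ?thesis by (simp add: hw_coeff_def)
qed

section \<open>The adjoint representation\<close>

text \<open>
  The adjugate is used for the inverse: the two agree on \<open>SL\<^sub>n(K)\<close>, and its entries are polynomials.
\<close>

definition conj_mat :: "'a :: field mat \<Rightarrow> 'a mat \<Rightarrow> 'a mat" where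
  "conj_mat g X = g * X * adj_mat g"

definition traceless :: "nat \<Rightarrow> 'a :: field mat set" where
  "traceless n = {X \<in> carrier_mat n n. mat_trace X = 0}"

lemma SL_carrierD: "g \<in> carrier (SL_grp n) \<Longrightarrow> g \<in> carrier_mat n n"
  by (simp add: SL_carrier)

lemma conj_mat_closed:
  assumes "g \<in> carrier (SL_grp n)" "X \<in> carrier_mat n n"
  shows "conj_mat g X \<in> carrier_mat n n"
  unfolding conj_mat_def
  using mult_carrier_mat[OF mult_carrier_mat[OF SL_carrierD[OF assms(1)] assms(2)] SL_carrierD[OF SL_adj_mat(1)[OF assms(1)]]] .

lemma conj_mat_mult_right:
  assumes g: "g \<in> carrier (SL_grp n)" and X: "X \<in> carrier_mat n n"
  shows "conj_mat g X * g = g * X"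
proof -
  note gc = SL_carrierD[OF g] and ac = SL_carrierD[OF SL_adj_mat(1)[OF g]]
  have "conj_mat g X * g = g * X * (adj_mat g * g)"
    unfolding conj_mat_def by (rule assoc_mult_mat[OF mult_carrier_mat[OF gc X] ac gc])
  thus ?thesis unfolding SL_adj_mat(3)[OF g] right_mult_one_mat[OF mult_carrier_mat[OF gc X]] .
qed

lemma conj_mat_eqI:
  assumes g: "g \<in> carrier (SL_grp n)" and X: "X \<in> carrier_mat n n" and Y: "Y \<in> carrier_mat n n"
    and eq: "Y * g = g * X"
  shows "conj_mat g X = Y"
proof -
  note gc = SL_carrierD[OF g] and ac = SL_carrierD[OF SL_adj_mat(1)[OF g]]
  have "conj_mat g X = Y * (g * adj_mat g)"
    unfolding conj_mat_def eq[symmetric] by (rule assoc_mult_mat[OF Y gc ac])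
  thus ?thesis unfolding SL_adj_mat(2)[OF g] right_mult_one_mat[OF Y] .
qed

lemma conj_mat_conj_mat:
  assumes g: "g \<in> carrier (SL_grp n)" and h: "h \<in> carrier (SL_grp n)" and X: "X \<in> carrier_mat n n"
  shows "conj_mat (g * h) X = conj_mat g (conj_mat h X)"
proof (rule conj_mat_eqI[OF SL_mult_closed[OF g h] X conj_mat_closed[OF g conj_mat_closed[OF h X]]])
  note gc = SL_carrierD[OF g] and hc = SL_carrierD[OF h]
  have "conj_mat g (conj_mat h X) * (g * h) = g * (conj_mat h X * h)"
    unfolding assoc_mult_mat[OF conj_mat_closed[OF g conj_mat_closed[OF h X]] gc hc, symmetric]
      conj_mat_mult_right[OF g conj_mat_closed[OF h X]] by (rule assoc_mult_mat[OF gc conj_mat_closed[OF h X] hc])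
  also have "\<dots> = g * h * X"
    unfolding conj_mat_mult_right[OF h X] by (rule assoc_mult_mat[OF gc hc X, symmetric])
  finally show "conj_mat g (conj_mat h X) * (g * h) = g * h * X" .
qed

lemma conj_mat_one: "X \<in> carrier_mat n n \<Longrightarrow> conj_mat (1\<^sub>m n) X = X"
  by (rule conj_mat_eqI[OF SL_one]) auto

lemma conj_mat_add:
  assumes g: "g \<in> carrier (SL_grp n)" and "X \<in> carrier_mat n n" "Y \<in> carrier_mat n n"
  shows "conj_mat g (X + Y) = conj_mat g X + conj_mat g Y"
proof -
  note gc = SL_carrierD[OF g] and ac = SL_carrierD[OF SL_adj_mat(1)[OF g]]
  show ?thesis unfolding conj_mat_def mult_add_distrib_mat[OF gc assms(2,3)]
      add_mult_distrib_mat[OF mult_carrier_mat[OF gc assms(2)] mult_carrier_mat[OF gc assms(3)] ac] ..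
qed

lemma conj_mat_smult:
  assumes g: "g \<in> carrier (SL_grp n)" and "X \<in> carrier_mat n n"
  shows "conj_mat g (c \<cdot>\<^sub>m X) = c \<cdot>\<^sub>m conj_mat g X"
proof -
  note gc = SL_carrierD[OF g] and ac = SL_carrierD[OF SL_adj_mat(1)[OF g]]
  show ?thesis unfolding conj_mat_def mult_smult_distrib[OF gc assms(2)]
      mult_smult_assoc_mat[OF mult_carrier_mat[OF gc assms(2)] ac] ..
qed

lemma conj_mat_trace:
  assumes g: "g \<in> carrier (SL_grp n)" and "X \<in> carrier_mat n n"
  shows "mat_trace (conj_mat g X) = mat_trace X"
  unfolding conj_mat_def
  by (rule mat_trace_similar[OF assms(2) SL_carrierD[OF g] SL_carrierD[OF SL_adj_mat(1)[OF g]] SL_adj_mat(3)[OF g]])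

lemma conj_mat_traceless:
  "g \<in> carrier (SL_grp n) \<Longrightarrow> X \<in> traceless n \<Longrightarrow> conj_mat g X \<in> traceless n"
  by (auto simp: traceless_def conj_mat_closed conj_mat_trace)

lemma conj_mat_scalar:
  assumes g: "g \<in> carrier (SL_grp n)"
  shows "conj_mat g (c \<cdot>\<^sub>m 1\<^sub>m n) = c \<cdot>\<^sub>m 1\<^sub>m n"
proof -
  have "conj_mat g (1\<^sub>m n) = 1\<^sub>m n"
    by (rule conj_mat_eqI[OF g]) (use SL_carrierD[OF g] in auto)
  thus ?thesis using conj_mat_smult[OF g one_carrier_mat, of c] by metis
qed

text \<open>
  A monomial matrix that moves the basis vectors \<open>i\<close> and \<open>j\<close> to the first and the last one; the
  entry \<open>e\<close> is the sign of the permutation, which makes the determinant 1.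
\<close>

lemma signed_permutation_SL:
  fixes n :: nat
  assumes ij: "i < n" "j < n" "i \<noteq> j"
  obtains h :: "'a :: field mat" and e where "h \<in> carrier (SL_grp n)" "e \<noteq> 0"
    "\<forall>b<n. h $$ (0, b) = (if b = i then e else 0)"
    "\<forall>b<n. h $$ (n - 1, b) = (if b = j then 1 else 0)"
    "\<forall>a<n. h $$ (a, i) = (if a = 0 then e else 0)"
    "\<forall>a<n. h $$ (a, j) = (if a = n - 1 then 1 else 0)"
proof -
  have n: "n \<ge> 2" using ij by linarith
  define \<tau> where "\<tau> = Transposition.transpose 0 i"
  define \<sigma> where "\<sigma> a = Transposition.transpose (\<tau> (n - 1)) j (\<tau> a)" for a
  have transpose_inj: "Transposition.transpose k l a = Transposition.transpose k l b \<longleftrightarrow> a = b" for k l a b :: nat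
  proof
    assume "Transposition.transpose k l a = Transposition.transpose k l b"
    from arg_cong[OF this, of "Transposition.transpose k l"] show "a = b" unfolding transpose_involutory .
  qed simp
  have inj: "\<sigma> a = \<sigma> b \<longleftrightarrow> a = b" for a b unfolding \<sigma>_def \<tau>_def transpose_inj ..
  have transpose_less: "Transposition.transpose k l a < n" if "k < n" "l < n" "a < n" for k l a :: nat
    using that unfolding Transposition.transpose_def by presburger
  have lt: "\<sigma> a < n" if "a < n" for a
    unfolding \<sigma>_def \<tau>_def by (intro transpose_less) (use that ij n in simp_all)
  have \<sigma>n: "\<sigma> (n - 1) = j" by (simp add: \<sigma>_def)
  have "\<tau> 0 \<noteq> \<tau> (n - 1)" using n unfolding \<tau>_def transpose_inj by linarith
  moreover have "\<tau> 0 = i" by (simp add: \<tau>_def)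
  ultimately have \<sigma>0: "\<sigma> 0 = i" using ij(3) by (simp add: \<sigma>_def)
  define H where "H = mat n n (\<lambda>(a, b). if b = \<sigma> a then (1 :: 'a) else 0)"
  have Hc: "H \<in> carrier_mat n n" by (simp add: H_def)
  have "H * transpose_mat H = 1\<^sub>m n"
  proof (rule eq_matI)
    fix a b assume "a < dim_row (1\<^sub>m n :: 'a mat)" "b < dim_col (1\<^sub>m n :: 'a mat)"
    hence ab: "a < n" "b < n" by auto
    have "(H * transpose_mat H) $$ (a, b) = (\<Sum>c<n. (if c = \<sigma> a then 1 else 0) * (if c = \<sigma> b then 1 else 0))"
      using ab by (auto simp: H_def scalar_prod_def atLeast0LessThan intro!: sum.cong)
    also have "\<dots> = (\<Sum>c<n. if c = \<sigma> a then (if a = b then 1 else 0) else 0)" by (intro sum.cong) (auto simp: inj)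
    also have "\<dots> = 1\<^sub>m n $$ (a, b)" using ab lt[of a] by simp
    finally show "(H * transpose_mat H) $$ (a, b) = 1\<^sub>m n $$ (a, b)" .
  qed (auto simp: H_def)
  from arg_cong[OF this, of det] have det2: "det H * det H = 1"
    unfolding det_mult[OF Hc transpose_carrier_mat[THEN iffD2, OF Hc]] det_transpose[OF Hc] by simp
  define h where "h = multrow 0 (det H) H"
  have hc: "h \<in> carrier_mat n n" using Hc by (simp add: h_def)
  have hab: "h $$ (a, b) = (if b = \<sigma> a then if a = 0 then det H else 1 else 0)" if "a < n" "b < n" for a b
    using that Hc by (auto simp: h_def H_def)
  have "det h = det H * det H" unfolding h_def by (rule det_multrow[OF _ Hc]) (use n in simp)
  hence SL: "h \<in> carrier (SL_grp n)" using hc det2 by (simp add: SL_carrier)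
  show ?thesis
  proof (rule that[OF SL])
    show "det H \<noteq> 0" using det2 by auto
    have \<sigma>i: "i = \<sigma> a \<longleftrightarrow> 0 = a" for a using inj[of 0 a] unfolding \<sigma>0 .
    have \<sigma>j: "j = \<sigma> a \<longleftrightarrow> n - 1 = a" for a using inj[of "n - 1" a] unfolding \<sigma>n .
    have "h $$ (0, b) = (if b = i then det H else 0)" if "b < n" for b
      using hab[of 0 b] that n by (simp add: \<sigma>0)
    thus "\<forall>b<n. h $$ (0, b) = (if b = i then det H else 0)" by blast
    have "h $$ (n - 1, b) = (if b = j then 1 else 0)" if "b < n" for b
      using hab[of "n - 1" b] that n \<sigma>n by simp
    thus "\<forall>b<n. h $$ (n - 1, b) = (if b = j then 1 else 0)" by blast
    have "h $$ (a, i) = (if a = 0 then det H else 0)" if "a < n" for a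
      using hab[of a i] that ij \<sigma>i[of a] by simp
    thus "\<forall>a<n. h $$ (a, i) = (if a = 0 then det H else 0)" by blast
    have "h $$ (a, j) = (if a = n - 1 then 1 else 0)" if "a < n" for a
      using hab[of a j] that ij \<sigma>j[of a] n by simp
    thus "\<forall>a<n. h $$ (a, j) = (if a = n - 1 then 1 else 0)" by blast
  qed
qed

lemma transvection_SL:
  assumes "i < n" "j < n" "i \<noteq> j"
  shows "1\<^sub>m n + unit_mat n i j \<in> carrier (SL_grp n :: 'a :: field mat monoid)"
proof -
  let ?T = "1\<^sub>m n + unit_mat n i j :: 'a mat"
  have T: "?T \<in> carrier_mat n n" by simp
  have ent: "?T $$ (a, b) = (if a = b then 1 else 0) + (if a = i \<and> b = j then 1 else 0)" if "a < n" "b < n" for a b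
    using that by (simp add: unit_mat_def)
  have "det ?T = 1"
  proof (cases "i < j")
    case True
    show ?thesis by (rule upper_unitriangular_det[OF T]) (use True assms in \<open>auto simp: ent simp del: index_add_mat\<close>)
  next
    case False
    have "det ?T = (\<Prod>a<n. ?T $$ (a, a))"
      by (rule lower_triangular_det[OF T]) (use False assms in \<open>auto simp: ent simp del: index_add_mat\<close>)
    also have "\<dots> = 1" by (rule prod.neutral) (use assms in \<open>auto simp: ent simp del: index_add_mat\<close>)
    finally show ?thesis .
  qed
  thus ?thesis using T by (simp add: SL_carrier)
qed

text \<open>
  Conjugation by monomial matrices moves every off-diagonal entry to the corner, so all of them
  vanish, for \<open>X\<close> as well as for its conjugate by a transvection. The entry \<open>(i, j)\<close> of the latter is
  a difference of two diagonal entries of \<open>X\<close>.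
\<close>

lemma scalar_if_all_conjugates_vanish:
  assumes X: "X \<in> carrier_mat n n" and n: "n \<ge> 2"
    and van: "\<And>h. h \<in> carrier (SL_grp n) \<Longrightarrow> conj_mat h X $$ (0, n - 1) = (0 :: 'a :: field)"
  shows "\<exists>c. X = c \<cdot>\<^sub>m 1\<^sub>m n"
proof -
  have off: "Y $$ (i, j) = 0"
    if Y: "Y \<in> carrier_mat n n" and van: "\<And>h. h \<in> carrier (SL_grp n) \<Longrightarrow> conj_mat h Y $$ (0, n - 1) = (0 :: 'a)"
      and ij: "i < n" "j < n" "i \<noteq> j" for Y i j
  proof -
    obtain h :: "'a mat" and e where h: "h \<in> carrier (SL_grp n)" "e \<noteq> 0"
      "\<forall>b<n. h $$ (0, b) = (if b = i then e else 0)"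
      "\<forall>b<n. h $$ (n - 1, b) = (if b = j then 1 else 0)"
      "\<forall>a<n. h $$ (a, i) = (if a = 0 then e else 0)"
      "\<forall>a<n. h $$ (a, j) = (if a = n - 1 then 1 else 0)"
      by (rule signed_permutation_SL[OF ij])
    note hc = SL_carrierD[OF h(1)] and cc = conj_mat_closed[OF h(1) Y]
    have "(h * Y) $$ (0, j) = (\<Sum>k<n. h $$ (0, k) * Y $$ (k, j))"
      using carrier_matD[OF hc] carrier_matD[OF Y] n ij by (simp add: scalar_prod_def atLeast0LessThan)
    also have "\<dots> = (\<Sum>k<n. if k = i then e * Y $$ (k, j) else 0)" by (rule sum.cong[OF refl]) (simp add: h(3))
    finally have 1: "(h * Y) $$ (0, j) = e * Y $$ (i, j)" using ij by simp
    have "(conj_mat h Y * h) $$ (0, j) = (\<Sum>k<n. conj_mat h Y $$ (0, k) * h $$ (k, j))"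
      using carrier_matD[OF hc] carrier_matD[OF cc] n ij by (simp add: scalar_prod_def atLeast0LessThan)
    also have "\<dots> = (\<Sum>k<n. if k = n - 1 then conj_mat h Y $$ (0, k) else 0)" by (rule sum.cong[OF refl]) (simp add: h(6))
    also have "\<dots> = 0" using van[OF h(1)] n by simp
    finally show ?thesis using 1 h(2) conj_mat_mult_right[OF h(1) Y] by simp
  qed
  have diag: "X $$ (i, i) = X $$ (j, j)" if ij: "i < n" "j < n" "i \<noteq> j" for i j
  proof -
    let ?T = "1\<^sub>m n + unit_mat n i j :: 'a mat"
    note T = transvection_SL[OF ij, where ?'a = 'a]
    define Y where "Y = conj_mat ?T X"
    have Y: "Y \<in> carrier_mat n n" unfolding Y_def by (rule conj_mat_closed[OF T X])
    have vanY: "conj_mat h Y $$ (0, n - 1) = 0" if "h \<in> carrier (SL_grp n)" for h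
      unfolding Y_def conj_mat_conj_mat[OF that T X, symmetric] by (rule van[OF SL_mult_closed[OF that T]])
    have "Y * ?T = ?T * X" unfolding Y_def by (rule conj_mat_mult_right[OF T X])
    hence eq: "Y + Y * unit_mat n i j = X + unit_mat n i j * X"
      unfolding mult_add_distrib_mat[OF Y one_carrier_mat unit_mat_closed]
        add_mult_distrib_mat[OF one_carrier_mat unit_mat_closed X]
        right_mult_one_mat[OF Y] left_mult_one_mat[OF X] .
    have e: "Y $$ (a, b) + (if b = j then Y $$ (a, i) else 0) = X $$ (a, b) + (if a = i then X $$ (j, b) else 0)"
      if "a < n" "b < n" for a b
      using arg_cong[OF eq, of "\<lambda>M. M $$ (a, b)"] that ij X Y mult_unit_mat[OF Y that ij(1), of j]
        unit_mat_mult[OF X that ij(2), of i] by (simp del: index_mult_mat(1) add: carrier_matD unit_mat_def)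
    show ?thesis using e[OF ij(1) ij(1)] e[OF ij(1) ij(2)] off[OF Y vanY ij] off[OF X van ij]
        off[OF X van ij(2,1)] ij(3) by simp
  qed
  have "X = X $$ (0, 0) \<cdot>\<^sub>m 1\<^sub>m n"
  proof (rule eq_matI)
    fix a b assume "a < dim_row (X $$ (0, 0) \<cdot>\<^sub>m 1\<^sub>m n)" "b < dim_col (X $$ (0, 0) \<cdot>\<^sub>m 1\<^sub>m n)"
    thus "X $$ (a, b) = (X $$ (0, 0) \<cdot>\<^sub>m 1\<^sub>m n) $$ (a, b)"
      using off[OF X van, of a b] diag[of a 0] n by (cases "a = b"; cases "a = 0") auto
  qed (use X in auto)
  thus ?thesis by blast
qed

lemma mat_eq_zeroI:
  "X \<in> carrier_mat n n \<Longrightarrow> (\<And>a b. a < n \<Longrightarrow> b < n \<Longrightarrow> X $$ (a, b) = 0) \<Longrightarrow> X = 0\<^sub>m n n"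
  by (rule eq_matI) auto

text \<open>
  Monomial matrices give all off-diagonal matrix units. Conjugating one of them by a transvection
  gives the differences of two diagonal matrix units, and together these span the matrices of trace
  zero.
\<close>

lemma conj_stable_subspace_is_traceless:
  fixes M :: "'a :: field mat set"
  assumes n: "n \<ge> 2" and E: "highest_root_mat n \<in> M"
    and add: "\<And>X Y. X \<in> M \<Longrightarrow> Y \<in> M \<Longrightarrow> X + Y \<in> M"
    and smult: "\<And>c X. X \<in> M \<Longrightarrow> c \<cdot>\<^sub>m X \<in> M"
    and conj: "\<And>g X. g \<in> carrier (SL_grp n) \<Longrightarrow> X \<in> M \<Longrightarrow> conj_mat g X \<in> M"
  shows "traceless n \<subseteq> M"
proof -
  have "0 \<cdot>\<^sub>m highest_root_mat n = (0\<^sub>m n n :: 'a mat)" by (intro eq_matI) (auto simp: unit_mat_def)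
  with smult[OF E, of 0] have z: "0\<^sub>m n n \<in> M" by simp
  have unit: "unit_mat n i j \<in> M" if ij: "i < n" "j < n" "i \<noteq> j" for i j
  proof -
    obtain h :: "'a mat" and e where h: "h \<in> carrier (SL_grp n)" "e \<noteq> 0"
      "\<forall>b<n. h $$ (0, b) = (if b = i then e else 0)"
      "\<forall>b<n. h $$ (n - 1, b) = (if b = j then 1 else 0)"
      "\<forall>a<n. h $$ (a, i) = (if a = 0 then e else 0)"
      "\<forall>a<n. h $$ (a, j) = (if a = n - 1 then 1 else 0)"
      by (rule signed_permutation_SL[OF ij])
    note hc = SL_carrierD[OF h(1)]
    have "conj_mat h (e \<cdot>\<^sub>m unit_mat n i j) = e \<cdot>\<^sub>m (e \<cdot>\<^sub>m highest_root_mat n)"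
    proof (rule conj_mat_eqI[OF h(1)])
      show "e \<cdot>\<^sub>m (e \<cdot>\<^sub>m highest_root_mat n) * h = h * (e \<cdot>\<^sub>m unit_mat n i j)"
      proof (rule eq_matI)
        fix a b assume "a < dim_row (h * (e \<cdot>\<^sub>m unit_mat n i j))" "b < dim_col (h * (e \<cdot>\<^sub>m unit_mat n i j))"
        hence ab: "a < n" "b < n" using hc by (auto simp: unit_mat_def)
        have "(e \<cdot>\<^sub>m (e \<cdot>\<^sub>m highest_root_mat n) * h) $$ (a, b) = e * (e * (highest_root_mat n * h) $$ (a, b))"
          using ab hc by (simp add: mult_smult_assoc_mat[of _ n n _ n] unit_mat_def del: index_mult_mat(1))
        also have "(highest_root_mat n * h) $$ (a, b) = (if a = 0 then h $$ (n - 1, b) else 0)"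
          by (rule unit_mat_mult[OF hc ab]) (use n in simp)
        finally have 1: "(e \<cdot>\<^sub>m (e \<cdot>\<^sub>m highest_root_mat n) * h) $$ (a, b) = e * (e * (if a = 0 then h $$ (n - 1, b) else 0))" .
        have "(h * (e \<cdot>\<^sub>m unit_mat n i j)) $$ (a, b) = e * (h * unit_mat n i j) $$ (a, b)"
          unfolding mult_smult_distrib[OF hc unit_mat_closed]
          using ab carrier_matD[OF hc] by (subst index_smult_mat) (auto simp: unit_mat_def)
        also have "(h * unit_mat n i j) $$ (a, b) = (if b = j then h $$ (a, i) else 0)"
          by (rule mult_unit_mat[OF hc ab ij(1)])
        finally show "(e \<cdot>\<^sub>m (e \<cdot>\<^sub>m highest_root_mat n) * h) $$ (a, b) = (h * (e \<cdot>\<^sub>m unit_mat n i j)) $$ (a, b)"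
          using 1 h(4,5) ab by simp
      qed (use hc in \<open>auto simp: unit_mat_def\<close>)
    qed auto
    hence "e \<cdot>\<^sub>m unit_mat n i j = conj_mat (adj_mat h) (e \<cdot>\<^sub>m (e \<cdot>\<^sub>m highest_root_mat n))"
      using conj_mat_conj_mat[OF SL_adj_mat(1)[OF h(1)] h(1), of "e \<cdot>\<^sub>m unit_mat n i j"]
        conj_mat_one[of "e \<cdot>\<^sub>m unit_mat n i j" n] SL_adj_mat(3)[OF h(1)] by simp
    hence "e \<cdot>\<^sub>m unit_mat n i j \<in> M"
      using conj[OF SL_adj_mat(1)[OF h(1)] smult[OF smult[OF E]]] by simp
    from smult[OF this, of "1 / e"] have "(1 / e) \<cdot>\<^sub>m (e \<cdot>\<^sub>m unit_mat n i j) \<in> M" .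
    also have "(1 / e) \<cdot>\<^sub>m (e \<cdot>\<^sub>m unit_mat n i j) = (unit_mat n i j :: 'a mat)"
      using h(2) by (intro eq_matI) auto
    finally show ?thesis .
  qed
  have diag: "unit_mat n i i + (-1) \<cdot>\<^sub>m unit_mat n j j \<in> M" if ij: "i < n" "j < n" "i \<noteq> j" for i j
  proof -
    let ?T = "1\<^sub>m n + unit_mat n i j :: 'a mat"
    note T = transvection_SL[OF ij, where ?'a = 'a]
    define X where "X = mat n n (\<lambda>(a, b). (if a = j \<and> b = i then 1 else 0) + (if a = i \<and> b = i then 1 else 0)
      - (if a = j \<and> b = j then 1 else 0) - (if a = i \<and> b = j then 1 else 0) :: 'a)"
    have X: "X \<in> carrier_mat n n" by (simp add: X_def)
    have "conj_mat ?T (unit_mat n j i) = X"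
    proof (rule conj_mat_eqI[OF T unit_mat_closed X])
      have "X + X * unit_mat n i j = unit_mat n j i + unit_mat n i j * unit_mat n j i"
      proof (rule eq_matI)
        fix a b assume "a < dim_row (unit_mat n j i + unit_mat n i j * unit_mat n j i :: 'a mat)"
          "b < dim_col (unit_mat n j i + unit_mat n i j * unit_mat n j i :: 'a mat)"
        hence ab: "a < n" "b < n" by (auto simp: unit_mat_def)
        have 1: "(X * unit_mat n i j) $$ (a, b) = (if b = j then X $$ (a, i) else 0)" by (rule mult_unit_mat[OF X ab ij(1)])
        have 2: "(unit_mat n i j * unit_mat n j i :: 'a mat) $$ (a, b) = (if a = i then unit_mat n j i $$ (j, b) else 0)"
          by (rule unit_mat_mult[OF unit_mat_closed ab ij(2)])
        have "(X + X * unit_mat n i j) $$ (a, b) = X $$ (a, b) + (X * unit_mat n i j) $$ (a, b)"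
          using ab by (subst index_add_mat) (auto simp: unit_mat_def X_def)
        moreover have "(unit_mat n j i + unit_mat n i j * unit_mat n j i :: 'a mat) $$ (a, b)
           = unit_mat n j i $$ (a, b) + (unit_mat n i j * unit_mat n j i :: 'a mat) $$ (a, b)"
          using ab by (subst index_add_mat) (auto simp: unit_mat_def)
        ultimately show "(X + X * unit_mat n i j) $$ (a, b) = (unit_mat n j i + unit_mat n i j * unit_mat n j i) $$ (a, b)"
          unfolding 1 2 using ab ij by (auto simp: X_def unit_mat_def)
      qed (use X in \<open>auto simp: unit_mat_def\<close>)
      thus "X * ?T = ?T * unit_mat n j i"
        unfolding mult_add_distrib_mat[OF X one_carrier_mat unit_mat_closed]
          add_mult_distrib_mat[OF one_carrier_mat unit_mat_closed unit_mat_closed]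
          right_mult_one_mat[OF X] left_mult_one_mat[OF unit_mat_closed] .
    qed
    hence "X \<in> M" using conj[OF T unit[OF ij(2,1)]] ij by metis
    from add[OF add[OF this smult[OF unit[OF ij(2,1)], of "-1"]] unit[OF ij]] ij
    have "X + (-1) \<cdot>\<^sub>m unit_mat n j i + unit_mat n i j \<in> M" by simp
    also have "X + (-1) \<cdot>\<^sub>m unit_mat n j i + unit_mat n i j = unit_mat n i i + (-1) \<cdot>\<^sub>m unit_mat n j j"
      by (intro eq_matI) (use ij in \<open>auto simp: X_def unit_mat_def\<close>)
    finally show ?thesis .
  qed
  have offdiag: "X \<in> M" if "finite S" "S \<subseteq> {(i, j). i < n \<and> j < n \<and> i \<noteq> j}" "X \<in> carrier_mat n n"
    "\<And>a b. a < n \<Longrightarrow> b < n \<Longrightarrow> (a, b) \<notin> S \<Longrightarrow> X $$ (a, b) = 0" for S X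
    using that
  proof (induction S arbitrary: X rule: finite_induct)
    case empty
    have "X = 0\<^sub>m n n"
    proof (rule mat_eq_zeroI[OF empty.prems(2)])
      fix a b assume ab: "a < n" "b < n"
      show "X $$ (a, b) = 0" by (rule empty.prems(3)[OF ab]) simp
    qed
    thus ?case using z by (rule ssubst)
  next
    case (insert s S)
    obtain i j where s: "s = (i, j)" by force
    have ij: "i < n" "j < n" "i \<noteq> j" using insert.prems(1) s by auto
    define Y where "Y = X + (- X $$ (i, j)) \<cdot>\<^sub>m unit_mat n i j"
    have Yc: "Y \<in> carrier_mat n n" using insert.prems(2) by (simp add: Y_def)
    have "Y $$ (a, b) = 0" if "a < n" "b < n" "(a, b) \<notin> S" for a b
      using that insert.prems(2) insert.prems(3)[of a b] ij s by (cases "(a, b) = (i, j)") (auto simp: Y_def unit_mat_def)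
    hence "Y \<in> M" using insert.IH[OF _ Yc] insert.prems(1) by blast
    from add[OF this smult[OF unit[OF ij], of "X $$ (i, j)"]]
    have "Y + X $$ (i, j) \<cdot>\<^sub>m unit_mat n i j \<in> M" .
    also have "Y + X $$ (i, j) \<cdot>\<^sub>m unit_mat n i j = X"
      using insert.prems(2) by (intro eq_matI) (auto simp: Y_def unit_mat_def)
    finally show ?case .
  qed
  have diagonal: "X \<in> M" if "finite S" "S \<subseteq> {1..<n}" "X \<in> carrier_mat n n" "mat_trace X = 0"
    "\<And>a b. a < n \<Longrightarrow> b < n \<Longrightarrow> \<not> (a = b \<and> (a = 0 \<or> a \<in> S)) \<Longrightarrow> X $$ (a, b) = 0" for S X
    using that
  proof (induction S arbitrary: X rule: finite_induct)
    case empty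
    have "mat_trace X = (\<Sum>i<n. if i = 0 then X $$ (i, i) else 0)"
      unfolding mat_trace_def using empty.prems(2,4) by (intro sum.cong) auto
    also have "\<dots> = X $$ (0, 0)" using n by simp
    finally have "X $$ (0, 0) = 0" using empty.prems(3) by simp
    hence "X $$ (a, b) = 0" if "a < n" "b < n" for a b
      using empty.prems(4)[of a b] that by (cases "a = b \<and> a = 0") auto
    hence "X = 0\<^sub>m n n" by (rule mat_eq_zeroI[OF empty.prems(2)])
    thus ?case using z by (rule ssubst)
  next
    case (insert i S)
    have i: "i < n" "0 < n" "i \<noteq> 0" using insert.prems(1) by auto
    define F where "F = unit_mat n i i + (-1) \<cdot>\<^sub>m (unit_mat n 0 0 :: 'a mat)"
    have Fc: "F \<in> carrier_mat n n" by (simp add: F_def)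
    have F: "F \<in> M" unfolding F_def by (rule diag[OF i])
    have tr: "mat_trace (unit_mat n k k :: 'a mat) = 1" if "k < n" for k
    proof -
      have "mat_trace (unit_mat n k k :: 'a mat) = (\<Sum>l<n. if l = k then 1 else 0)"
        unfolding mat_trace_def by (intro sum.cong) (auto simp: unit_mat_def)
      thus ?thesis using that by simp
    qed
    have "mat_trace F = 0"
      unfolding F_def using tr[OF i(1)] tr[OF i(2)]
      by (simp add: mat_trace_add[of _ n] mat_trace_smult[of _ n])
    define Y where "Y = X + (- X $$ (i, i)) \<cdot>\<^sub>m F"
    have Yc: "Y \<in> carrier_mat n n" using insert.prems(2) Fc by (simp add: Y_def)
    have "mat_trace Y = 0"
      unfolding Y_def using insert.prems(2,3) Fc \<open>mat_trace F = 0\<close>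
      by (simp add: mat_trace_add[of _ n] mat_trace_smult[of _ n])
    moreover have "Y $$ (a, b) = 0" if "a < n" "b < n" "\<not> (a = b \<and> (a = 0 \<or> a \<in> S))" for a b
      using that insert.prems(2) insert.prems(4)[of a b] i
      by (cases "a = b \<and> a = i") (auto simp: Y_def F_def unit_mat_def)
    ultimately have "Y \<in> M" using insert.IH[OF _ Yc] insert.prems(1) by blast
    from add[OF this smult[OF F, of "X $$ (i, i)"]]
    have "Y + X $$ (i, i) \<cdot>\<^sub>m F \<in> M" .
    also have "Y + X $$ (i, i) \<cdot>\<^sub>m F = X"
      using insert.prems(2) Fc by (intro eq_matI) (auto simp: Y_def)
    finally show ?case .
  qed
  show ?thesis
  proof
    fix X :: "'a mat" assume "X \<in> traceless n"
    hence X: "X \<in> carrier_mat n n" "mat_trace X = 0" by (auto simp: traceless_def)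
    define A where "A = mat n n (\<lambda>(a, b). if a = b then 0 else X $$ (a, b))"
    define B where "B = mat n n (\<lambda>(a, b). if a = b then X $$ (a, b) else 0)"
    have "finite {(i, j). i < n \<and> j < n \<and> i \<noteq> j}"
      by (rule finite_subset[of _ "{..<n} \<times> {..<n}"]) auto
    hence "A \<in> M" by (rule offdiag) (auto simp: A_def)
    moreover have "mat_trace B = mat_trace X"
      unfolding mat_trace_def using X by (intro sum.cong) (auto simp: B_def)
    hence "B \<in> M" by (intro diagonal[of "{1..<n}"]) (use X in \<open>auto simp: B_def\<close>)
    ultimately have "A + B \<in> M" by (rule add)
    also have "A + B = X" using X by (intro eq_matI) (auto simp: A_def B_def)
    finally show "X \<in> M" .
  qed
qed

section \<open>The irreducible module as a quotient of the traceless matrices\<close>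

text \<open>
  The span of the orbit of the pair of highest weight vectors, in the direct sum of the adjoint
  representation and the given module. It is the graph of a homomorphism by \<open>graph_functional\<close>.
\<close>

inductive_set adjoint_graph :: "nat \<Rightarrow> ('a :: field mat \<Rightarrow> 'a mat) \<Rightarrow> 'a vec \<Rightarrow> ('a mat \<times> 'a vec) set"
  for n :: nat and \<rho> :: "'a mat \<Rightarrow> 'a mat" and v :: "'a vec" where
  orbit: "g \<in> carrier (SL_grp n) \<Longrightarrow> (conj_mat g (highest_root_mat n), \<rho> g *\<^sub>v v) \<in> adjoint_graph n \<rho> v"
| add: "(X, x) \<in> adjoint_graph n \<rho> v \<Longrightarrow> (Y, y) \<in> adjoint_graph n \<rho> v \<Longrightarrow> (X + Y, x + y) \<in> adjoint_graph n \<rho> v"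
| smult: "(X, x) \<in> adjoint_graph n \<rho> v \<Longrightarrow> (c \<cdot>\<^sub>m X, c \<cdot>\<^sub>v x) \<in> adjoint_graph n \<rho> v"

lemma traceless_add: "X \<in> traceless n \<Longrightarrow> Y \<in> traceless n \<Longrightarrow> X + Y \<in> traceless n"
  by (simp add: traceless_def mat_trace_add[of _ n])

lemma traceless_smult: "X \<in> traceless n \<Longrightarrow> c \<cdot>\<^sub>m X \<in> traceless n"
  by (simp add: traceless_def mat_trace_smult[of _ n])

lemma highest_root_mat_traceless:
  assumes "n \<ge> 2"
  shows "highest_root_mat n \<in> traceless n"
proof -
  have "mat_trace (highest_root_mat n :: 'a mat) = (\<Sum>i<n. 0)"
    unfolding mat_trace_def using assms by (intro sum.cong) (auto simp: unit_mat_def)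
  thus ?thesis by (simp add: traceless_def)
qed

locale irreducible_hw_rep = hw_rep n N \<rho> v
  for n N :: nat and \<rho> :: "'a :: alg_closed_field mat \<Rightarrow> 'a mat" and v :: "'a vec" +
  assumes irreducible: "irreducible_SL_rep n N \<rho>"
begin

abbreviation "graph \<equiv> adjoint_graph n \<rho> v"

lemma irreducibleD:
  assumes "lin_subspace N W" "\<And>g w. g \<in> carrier (SL_grp n) \<Longrightarrow> w \<in> W \<Longrightarrow> \<rho> g *\<^sub>v w \<in> W"
  shows "W = {0\<^sub>v N} \<or> W = carrier_vec N"
  using irreducible lin_subspace_imp_subspace[OF assms(1)] assms(2)
  unfolding irreducible_SL_rep_def by blast

lemma graph_closed:
  "(X, x) \<in> graph \<Longrightarrow> X \<in> traceless n \<and> x \<in> carrier_vec N"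
proof (induction rule: adjoint_graph.induct)
  case (orbit g)
  show ?case
    using conj_mat_traceless[OF orbit highest_root_mat_traceless[OF n]]
      mult_mat_vec_carrier[OF rho_closed[OF orbit] v(1)] by blast
next
  case (add X x Y y)
  thus ?case using traceless_add by (blast intro: add_carrier_vec)
next
  case (smult X x c)
  thus ?case using traceless_smult by (blast intro: smult_carrier_vec[THEN iffD2])
qed

lemma graph_traceless: "(X, x) \<in> graph \<Longrightarrow> X \<in> traceless n"
  and graph_vec: "(X, x) \<in> graph \<Longrightarrow> x \<in> carrier_vec N"
  and graph_mat: "(X, x) \<in> graph \<Longrightarrow> X \<in> carrier_mat n n"
  using graph_closed unfolding traceless_def by blast+

lemma graph_equivariant:
  assumes h: "h \<in> carrier (SL_grp n)"
  shows "(X, x) \<in> graph \<Longrightarrow> (conj_mat h X, \<rho> h *\<^sub>v x) \<in> graph"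
proof (induction rule: adjoint_graph.induct)
  case (orbit g)
  have "\<rho> (h * g) *\<^sub>v v = \<rho> h *\<^sub>v (\<rho> g *\<^sub>v v)"
    unfolding rho_mult[OF h orbit] by (rule assoc_mult_mat_vec[OF rho_closed[OF h] rho_closed[OF orbit] v(1)])
  with adjoint_graph.orbit[OF SL_mult_closed[OF h orbit], of \<rho> v] show ?case
    unfolding conj_mat_conj_mat[OF h orbit unit_mat_closed] by simp
next
  case (add X x Y y)
  from adjoint_graph.add[OF add.IH] show ?case
    unfolding conj_mat_add[OF h graph_mat[OF add.hyps(1)] graph_mat[OF add.hyps(2)]]
      mult_add_distrib_mat_vec[OF rho_closed[OF h] graph_vec[OF add.hyps(1)] graph_vec[OF add.hyps(2)]] .
next
  case (smult X x c)
  from adjoint_graph.smult[OF smult.IH] show ?case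
    unfolding conj_mat_smult[OF h graph_mat[OF smult.hyps(1)]]
      mult_mat_vec[OF rho_closed[OF h] graph_vec[OF smult.hyps(1)]] .
qed

lemma graph_domain: "X \<in> traceless n \<Longrightarrow> \<exists>x. (X, x) \<in> graph"
proof -
  let ?M = "{X. \<exists>x. (X, x) \<in> graph}"
  have "traceless n \<subseteq> ?M"
  proof (rule conj_stable_subspace_is_traceless[OF n])
    show "highest_root_mat n \<in> ?M"
      using adjoint_graph.orbit[OF SL_one[of n], where \<rho> = \<rho> and v = v] unfolding conj_mat_one[OF unit_mat_closed] by blast
  next
    fix X Y assume "X \<in> ?M" "Y \<in> ?M"
    thus "X + Y \<in> ?M" using adjoint_graph.add by blast
  next
    fix c X assume "X \<in> ?M"
    thus "c \<cdot>\<^sub>m X \<in> ?M" using adjoint_graph.smult by blast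
  next
    fix g X :: "'a mat" assume "g \<in> carrier (SL_grp n)" "X \<in> ?M"
    thus "conj_mat g X \<in> ?M" using graph_equivariant by blast
  qed
  thus "X \<in> traceless n \<Longrightarrow> \<exists>x. (X, x) \<in> graph" by blast
qed

lemma graph_range: "x \<in> carrier_vec N \<Longrightarrow> \<exists>X. (X, x) \<in> graph"
proof -
  let ?W = "{x. \<exists>X. (X, x) \<in> graph}"
  have v_in: "v \<in> ?W"
    using adjoint_graph.orbit[OF SL_one[of n], where \<rho> = \<rho> and v = v] unfolding rho_one one_mult_mat_vec[OF v(1)] by blast
  have "lin_subspace N ?W"
    unfolding lin_subspace_def
  proof (intro conjI ballI allI)
    show "?W \<subseteq> carrier_vec N" using graph_vec by blast
    obtain X where "(X, v) \<in> graph" using v_in by blast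
    from adjoint_graph.smult[OF this, of 0] have "\<exists>X. (X, 0 \<cdot>\<^sub>v v) \<in> graph" by blast
    moreover have "0 \<cdot>\<^sub>v v = 0\<^sub>v N" using v(1) by (intro eq_vecI) auto
    ultimately show "0\<^sub>v N \<in> ?W" by simp
    show "x + y \<in> ?W" if "x \<in> ?W" "y \<in> ?W" for x y using that adjoint_graph.add by blast
    show "c \<cdot>\<^sub>v x \<in> ?W" if "x \<in> ?W" for c x using that adjoint_graph.smult by blast
  qed
  from irreducibleD[OF this] have "?W = {0\<^sub>v N} \<or> ?W = carrier_vec N"
    using graph_equivariant by blast
  with v_in v(2) have "?W = carrier_vec N" by blast
  thus "x \<in> carrier_vec N \<Longrightarrow> \<exists>X. (X, x) \<in> graph" by blast
qed

text \<open>
  For a pair \<open>(X, x)\<close> of the relation, the corner entry of \<open>h X h\<^sup>-\<^sup>1\<close> equals \<open>\<phi>(h x)\<close>, because both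
  sides are linear and agree on the orbit by \<open>adjoint_hw_coeff\<close> and \<open>highest_coefficient\<close>. All these
  entries vanish iff \<open>X\<close> is scalar. All these values of \<open>\<phi>\<close> vanish iff \<open>x = 0\<close>, since the vectors with
  this property form a proper submodule of an irreducible module.
\<close>

lemma graph_kernel:
  assumes "(X, x) \<in> graph"
  shows "x = 0\<^sub>v N \<longleftrightarrow> (\<exists>c. X = c \<cdot>\<^sub>m 1\<^sub>m n)"
proof -
  obtain \<phi> where \<phi>: "\<And>x y. x \<in> carrier_vec N \<Longrightarrow> y \<in> carrier_vec N \<Longrightarrow> \<phi> (x + y) = \<phi> x + \<phi> y"
    "\<And>c x. x \<in> carrier_vec N \<Longrightarrow> \<phi> (c \<cdot>\<^sub>v x) = c * \<phi> x"
    "\<And>g. g \<in> carrier (SL_grp n) \<Longrightarrow> \<phi> (\<rho> g *\<^sub>v v) = hw_coeff n g"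
    using highest_coefficient by blast
  have coeff: "\<phi> x = X $$ (0, n - 1)" if "(X, x) \<in> graph" for X x
    using that
  proof (induction rule: adjoint_graph.induct)
    case (orbit g)
    show ?case unfolding conj_mat_def adjoint_hw_coeff[OF orbit n] by (rule \<phi>(3)[OF orbit])
  next
    case (add X x Y y)
    have "(X + Y) $$ (0, n - 1) = X $$ (0, n - 1) + Y $$ (0, n - 1)"
      using n carrier_matD[OF graph_mat[OF add.hyps(2)]] by (subst index_add_mat) simp_all
    thus ?case using add.IH \<phi>(1)[OF graph_vec[OF add.hyps(1)] graph_vec[OF add.hyps(2)]] by simp
  next
    case (smult X x c)
    have "(c \<cdot>\<^sub>m X) $$ (0, n - 1) = c * X $$ (0, n - 1)"
      using n carrier_matD[OF graph_mat[OF smult.hyps(1)]] by (subst index_smult_mat) simp_all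
    thus ?case using smult.IH \<phi>(2)[OF graph_vec[OF smult.hyps(1)], of c] by simp
  qed
  have coeff_conj: "\<phi> (\<rho> h *\<^sub>v x) = conj_mat h X $$ (0, n - 1)" if "h \<in> carrier (SL_grp n)" for h
    by (rule coeff[OF graph_equivariant[OF that assms]])
  have \<phi>0: "\<phi> (0\<^sub>v N) = 0"
  proof -
    have "0 \<cdot>\<^sub>v 0\<^sub>v N = (0\<^sub>v N :: 'a vec)" by (intro eq_vecI) auto
    thus ?thesis using \<phi>(2)[of "0\<^sub>v N" 0] by simp
  qed
  define Z where "Z = {x \<in> carrier_vec N. \<forall>h \<in> carrier (SL_grp n). \<phi> (\<rho> h *\<^sub>v x) = 0}"
  have "lin_subspace N Z"
    unfolding lin_subspace_def
  proof (intro conjI ballI allI)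
    show "Z \<subseteq> carrier_vec N" by (auto simp: Z_def)
    show "0\<^sub>v N \<in> Z" unfolding Z_def using mult_mat_zero_vec[OF rho_closed] \<phi>0 by simp
    show "x + y \<in> Z" if "x \<in> Z" "y \<in> Z" for x y
    proof -
      have xy: "x \<in> carrier_vec N" "y \<in> carrier_vec N" using that by (auto simp: Z_def)
      have "\<phi> (\<rho> h *\<^sub>v (x + y)) = 0" if h: "h \<in> carrier (SL_grp n)" for h
        unfolding mult_add_distrib_mat_vec[OF rho_closed[OF h] xy]
          \<phi>(1)[OF mult_mat_vec_carrier[OF rho_closed[OF h] xy(1)] mult_mat_vec_carrier[OF rho_closed[OF h] xy(2)]]
        using \<open>x \<in> Z\<close> \<open>y \<in> Z\<close> h by (simp add: Z_def)
      thus ?thesis using xy by (simp add: Z_def)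
    qed
    show "c \<cdot>\<^sub>v x \<in> Z" if "x \<in> Z" for c x
    proof -
      have x: "x \<in> carrier_vec N" using that by (auto simp: Z_def)
      have "\<phi> (\<rho> h *\<^sub>v (c \<cdot>\<^sub>v x)) = 0" if h: "h \<in> carrier (SL_grp n)" for h
        unfolding mult_mat_vec[OF rho_closed[OF h] x] \<phi>(2)[OF mult_mat_vec_carrier[OF rho_closed[OF h] x]]
        using \<open>x \<in> Z\<close> h by (simp add: Z_def)
      thus ?thesis using x by (simp add: Z_def)
    qed
  qed
  moreover have "\<rho> g *\<^sub>v x \<in> Z" if g: "g \<in> carrier (SL_grp n)" and "x \<in> Z" for g x
  proof -
    have x: "x \<in> carrier_vec N" using that(2) by (auto simp: Z_def)
    have "\<phi> (\<rho> h *\<^sub>v (\<rho> g *\<^sub>v x)) = 0" if h: "h \<in> carrier (SL_grp n)" for h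
    proof -
      have "\<rho> h *\<^sub>v (\<rho> g *\<^sub>v x) = \<rho> (h * g) *\<^sub>v x"
        unfolding rho_mult[OF h g] by (rule assoc_mult_mat_vec[OF rho_closed[OF h] rho_closed[OF g] x, symmetric])
      thus ?thesis using \<open>x \<in> Z\<close> SL_mult_closed[OF h g] by (simp add: Z_def)
    qed
    thus ?thesis using mult_mat_vec_carrier[OF rho_closed[OF g] x] by (simp add: Z_def)
  qed
  ultimately have "Z = {0\<^sub>v N} \<or> Z = carrier_vec N" by (rule irreducibleD)
  moreover have "v \<notin> Z"
  proof -
    have "hw_coeff n (1\<^sub>m n :: 'a mat) = 1"
    proof -
      have "leading_block (n - 1) (1\<^sub>m n) = (1\<^sub>m (n - 1) :: 'a mat)"
        by (intro eq_matI) (auto simp: leading_block_def)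
      thus ?thesis using n by (simp add: hw_coeff_def)
    qed
    hence "\<phi> (\<rho> (1\<^sub>m n) *\<^sub>v v) \<noteq> 0" using \<phi>(3)[OF SL_one] by simp
    thus ?thesis using SL_one[of n] unfolding Z_def by blast
  qed
  ultimately have Z: "Z = {0\<^sub>v N}" using v(1) by blast
  show ?thesis
  proof
    assume x0: "x = 0\<^sub>v N"
    show "\<exists>c. X = c \<cdot>\<^sub>m 1\<^sub>m n"
    proof (rule scalar_if_all_conjugates_vanish[OF graph_mat[OF assms] n])
      fix h :: "'a mat" assume h: "h \<in> carrier (SL_grp n)"
      show "conj_mat h X $$ (0, n - 1) = 0"
        unfolding coeff_conj[OF h, symmetric] x0 mult_mat_zero_vec[OF rho_closed[OF h]] by (rule \<phi>0)
    qed
  next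
    assume "\<exists>c. X = c \<cdot>\<^sub>m 1\<^sub>m n"
    then obtain c where X: "X = c \<cdot>\<^sub>m 1\<^sub>m n" by blast
    have "\<phi> (\<rho> h *\<^sub>v x) = 0" if h: "h \<in> carrier (SL_grp n)" for h
      unfolding coeff_conj[OF h] X conj_mat_scalar[OF h] using n by simp
    hence "x \<in> Z" using graph_vec[OF assms] by (simp add: Z_def)
    thus "x = 0\<^sub>v N" unfolding Z by simp
  qed
qed

lemma graph_functional:
  assumes "(X, x) \<in> graph" "(X, y) \<in> graph"
  shows "x = y"
proof -
  note c = graph_vec[OF assms(1)] graph_vec[OF assms(2)] graph_mat[OF assms(1)]
  have "(X + (-1) \<cdot>\<^sub>m X, x + (-1) \<cdot>\<^sub>v y) \<in> graph"
    by (intro adjoint_graph.add adjoint_graph.smult assms)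
  moreover have "X + (-1) \<cdot>\<^sub>m X = 0 \<cdot>\<^sub>m 1\<^sub>m n" using c(3) by (intro eq_matI) auto
  ultimately have "x + (-1) \<cdot>\<^sub>v y = 0\<^sub>v N" using graph_kernel by blast
  from arg_cong[OF this, of "\<lambda>z. z + y"] c(1,2) show "x = y"
  proof -
    have "x $ i = y $ i" if "i < N" for i
      using arg_cong[OF \<open>x + (-1) \<cdot>\<^sub>v y = 0\<^sub>v N\<close>, of "\<lambda>z. vec_index z i"] that c(1,2) by simp
    thus ?thesis using c(1,2) by (intro eq_vecI) auto
  qed
qed

end

theorem adjoint_module_model:
  fixes \<rho> :: "'a :: alg_closed_field mat \<Rightarrow> 'a mat"
  assumes n: "n \<ge> 2"
    and L: "is_L_SL n (weight_add (fundamental_weight 1) (fundamental_weight (n - 1))) N \<rho>"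
  obtains \<Psi> where "\<And>X Y. X \<in> traceless n \<Longrightarrow> Y \<in> traceless n \<Longrightarrow> \<Psi> (X + Y) = \<Psi> X + \<Psi> Y"
    "\<And>c X. X \<in> traceless n \<Longrightarrow> \<Psi> (c \<cdot>\<^sub>m X) = c \<cdot>\<^sub>v \<Psi> X"
    "\<Psi> ` traceless n = carrier_vec N"
    "\<And>X. X \<in> traceless n \<Longrightarrow> \<Psi> X = 0\<^sub>v N \<longleftrightarrow> (\<exists>c. X = c \<cdot>\<^sub>m 1\<^sub>m n)"
    "\<And>g X. g \<in> carrier (SL_grp n) \<Longrightarrow> X \<in> traceless n \<Longrightarrow> \<Psi> (conj_mat g X) = \<rho> g *\<^sub>v \<Psi> X"
    "\<And>g. g \<in> carrier (SL_grp n) \<Longrightarrow> \<rho> g \<in> carrier_mat N N"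
    "\<And>g h. g \<in> carrier (SL_grp n) \<Longrightarrow> h \<in> carrier (SL_grp n) \<Longrightarrow> \<rho> (g * h) = \<rho> g * \<rho> h"
    "\<rho> (1\<^sub>m n) = 1\<^sub>m N"
proof -
  obtain v where v: "v \<in> carrier_vec N" "v \<noteq> 0\<^sub>v N" "\<And>x. x \<in> SL_max_unipotent n \<Longrightarrow> \<rho> x *\<^sub>v v = v"
    "\<And>t. t \<in> SL_torus n \<Longrightarrow> \<rho> t *\<^sub>v v = weight_add (fundamental_weight 1) (fundamental_weight (n - 1)) t \<cdot>\<^sub>v v"
    using L unfolding is_L_SL_def has_highest_weight_def by blast
  interpret irreducible_hw_rep n N \<rho> v
  proof
    show "\<rho> t *\<^sub>v v = (t $$ (0, 0) * (\<Prod>j<n - 1. t $$ (j, j))) \<cdot>\<^sub>v v" if "t \<in> SL_torus n" for t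
      using v(4)[OF that] by (simp add: weight_add_def fundamental_weight_def)
  qed (use n L v in \<open>simp_all add: is_L_SL_def\<close>)
  define \<Psi> where "\<Psi> X = (SOME x. (X, x) \<in> graph)" for X
  have \<Psi>: "(X, \<Psi> X) \<in> graph" if "X \<in> traceless n" for X
    unfolding \<Psi>_def by (rule someI_ex[OF graph_domain[OF that]])
  have \<Psi>_eq: "\<Psi> X = x" if "(X, x) \<in> graph" for X x
    by (rule graph_functional[OF \<Psi>[OF graph_traceless[OF that]] that])
  show ?thesis
  proof (rule that[of \<Psi>])
    show "\<Psi> (X + Y) = \<Psi> X + \<Psi> Y" if "X \<in> traceless n" "Y \<in> traceless n" for X Y
      by (rule \<Psi>_eq[OF adjoint_graph.add[OF \<Psi>[OF that(1)] \<Psi>[OF that(2)]]])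
    show "\<Psi> (c \<cdot>\<^sub>m X) = c \<cdot>\<^sub>v \<Psi> X" if "X \<in> traceless n" for c X
      by (rule \<Psi>_eq[OF adjoint_graph.smult[OF \<Psi>[OF that]]])
    show "\<Psi> ` traceless n = carrier_vec N"
    proof
      show "\<Psi> ` traceless n \<subseteq> carrier_vec N" using graph_vec[OF \<Psi>] by blast
      show "carrier_vec N \<subseteq> \<Psi> ` traceless n"
      proof
        fix x :: "'a vec" assume "x \<in> carrier_vec N"
        then obtain X where X: "(X, x) \<in> graph" using graph_range by blast
        show "x \<in> \<Psi> ` traceless n" using \<Psi>_eq[OF X] graph_traceless[OF X] by blast
      qed
    qed
    show "\<Psi> X = 0\<^sub>v N \<longleftrightarrow> (\<exists>c. X = c \<cdot>\<^sub>m 1\<^sub>m n)" if "X \<in> traceless n" for X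
      by (rule graph_kernel[OF \<Psi>[OF that]])
    show "\<Psi> (conj_mat g X) = \<rho> g *\<^sub>v \<Psi> X" if "g \<in> carrier (SL_grp n)" "X \<in> traceless n" for g X
      by (rule \<Psi>_eq[OF graph_equivariant[OF that(1) \<Psi>[OF that(2)]]])
  qed (fact rho_closed, fact rho_mult, fact rho_one)
qed

section \<open>The action of an element on the matrices\<close>

definition mat_to_vec :: "nat \<Rightarrow> 'a mat \<Rightarrow> 'a vec" where
  "mat_to_vec n X = vec (n * n) (\<lambda>k. X $$ (k div n, k mod n))"

definition vec_to_mat :: "nat \<Rightarrow> 'a vec \<Rightarrow> 'a mat" where
  "vec_to_mat n x = mat n n (\<lambda>(i, j). x $ (i * n + j))"

lemma mat_to_vec_closed [simp]: "mat_to_vec n X \<in> carrier_vec (n * n)"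
  by (simp add: mat_to_vec_def)

lemma vec_to_mat_closed [simp]: "vec_to_mat n x \<in> carrier_mat n n"
  by (simp add: vec_to_mat_def)

lemma pair_index_less: "i < n \<Longrightarrow> j < n \<Longrightarrow> i * n + j < n * (n :: nat)"
proof -
  assume "i < n" "j < n"
  hence "i * n + j < Suc i * n" by simp
  also have "\<dots> \<le> n * n" using \<open>i < n\<close> by (intro mult_le_mono1) simp
  finally show ?thesis .
qed

lemma index_pair_less:
  assumes "k < n * (n :: nat)"
  shows "k div n < n" "k mod n < n"
proof -
  have "n > 0" using assms by (cases n) simp_all
  thus "k div n < n" "k mod n < n" using assms by (simp_all add: div_less_iff_less_mult)
qed

lemma mat_to_vec_index: "i < n \<Longrightarrow> j < n \<Longrightarrow> mat_to_vec n X $ (i * n + j) = X $$ (i, j)"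
  using pair_index_less[of i n j] by (simp add: mat_to_vec_def)

lemma vec_to_mat_inverse: "X \<in> carrier_mat n n \<Longrightarrow> vec_to_mat n (mat_to_vec n X) = X"
  by (intro eq_matI) (auto simp: vec_to_mat_def mat_to_vec_index)

lemma mat_to_vec_inverse: "x \<in> carrier_vec (n * n) \<Longrightarrow> mat_to_vec n (vec_to_mat n x) = x"
proof (rule eq_vecI)
  fix k assume "k < dim_vec x" "x \<in> carrier_vec (n * n)"
  hence k: "k < n * n" by simp
  thus "mat_to_vec n (vec_to_mat n x) $ k = x $ k"
    using index_pair_less[OF k] by (simp add: mat_to_vec_def vec_to_mat_def)
qed simp

lemma mat_to_vec_eq_iff:
  assumes "X \<in> carrier_mat n n" "Y \<in> carrier_mat n n"
  shows "mat_to_vec n X = mat_to_vec n Y \<longleftrightarrow> X = Y"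
proof
  assume "mat_to_vec n X = mat_to_vec n Y"
  from arg_cong[OF this, of "vec_to_mat n"] show "X = Y"
    unfolding vec_to_mat_inverse[OF assms(1)] vec_to_mat_inverse[OF assms(2)] .
qed simp

lemma vec_to_mat_add:
  "x \<in> carrier_vec (n * n) \<Longrightarrow> y \<in> carrier_vec (n * n) \<Longrightarrow> vec_to_mat n (x + y) = vec_to_mat n x + vec_to_mat n y"
  by (intro eq_matI) (auto simp: vec_to_mat_def pair_index_less)

lemma vec_to_mat_smult:
  "x \<in> carrier_vec (n * n) \<Longrightarrow> vec_to_mat n (c \<cdot>\<^sub>v x) = c \<cdot>\<^sub>m vec_to_mat n x"
  by (intro eq_matI) (auto simp: vec_to_mat_def pair_index_less)

lemma mat_to_vec_add:
  "X \<in> carrier_mat n n \<Longrightarrow> Y \<in> carrier_mat n n \<Longrightarrow> mat_to_vec n (X + Y) = mat_to_vec n X + mat_to_vec n Y"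
  by (intro eq_vecI) (auto simp: mat_to_vec_def index_pair_less)

lemma mat_to_vec_minus:
  "X \<in> carrier_mat n n \<Longrightarrow> Y \<in> carrier_mat n n \<Longrightarrow> mat_to_vec n (X - Y) = mat_to_vec n X - mat_to_vec n Y"
  by (intro eq_vecI) (auto simp: mat_to_vec_def index_pair_less)

lemma mat_to_vec_smult:
  "X \<in> carrier_mat n n \<Longrightarrow> mat_to_vec n (c \<cdot>\<^sub>m X) = c \<cdot>\<^sub>v mat_to_vec n X"
  by (intro eq_vecI) (auto simp: mat_to_vec_def index_pair_less)

lemma mat_to_vec_zero: "mat_to_vec n (0\<^sub>m n n) = 0\<^sub>v (n * n)"
  by (intro eq_vecI) (auto simp: mat_to_vec_def index_pair_less)

lemma sum_div_mod:
  fixes f :: "nat \<Rightarrow> nat \<Rightarrow> 'b :: comm_monoid_add"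
  shows "(\<Sum>l<n * n. f (l div n) (l mod n)) = (\<Sum>a<n. \<Sum>b<n. f a b)"
proof -
  have "(\<Sum>a<n. \<Sum>b<n. f a b) = (\<Sum>(a, b)\<in>{..<n} \<times> {..<n}. f a b)" by (rule sum.cartesian_product)
  also have "\<dots> = (\<Sum>l<n * n. f (l div n) (l mod n))"
    by (rule sum.reindex_bij_witness[of _ "\<lambda>l. (l div n, l mod n)" "\<lambda>(a, b). a * n + b"])
       (auto simp: index_pair_less pair_index_less)
  finally show ?thesis by simp
qed

text \<open>
  The rule \<open>vec(A X B) = (A \<otimes> B\<^sup>T) vec(X)\<close> for row-wise vectorization. For \<open>B = u\<^sup>-\<^sup>1\<close> it turns the
  action of \<open>u\<close> on \<open>V \<otimes> V\<^sup>*\<close> into conjugation.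
\<close>

lemma tensor_mat_mat_to_vec:
  fixes A B X :: "'a :: field mat"
  assumes A: "A \<in> carrier_mat n n" and B: "B \<in> carrier_mat n n" and X: "X \<in> carrier_mat n n"
  shows "tensor_mat A (transpose_mat B) *\<^sub>v mat_to_vec n X = mat_to_vec n (A * X * B)"
proof (rule eq_vecI)
  fix k assume "k < dim_vec (mat_to_vec n (A * X * B))"
  hence k: "k < n * n" by (simp add: mat_to_vec_def)
  note ij = index_pair_less[OF k]
  let ?i = "k div n" and ?j = "k mod n"
  note d = carrier_matD[OF A] carrier_matD[OF B] carrier_matD[OF X]
  have "(tensor_mat A (transpose_mat B) *\<^sub>v mat_to_vec n X) $ k =
      (\<Sum>l<n * n. A $$ (?i, l div n) * B $$ (l mod n, ?j) * X $$ (l div n, l mod n))"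
    using k ij d unfolding tensor_mat_def
    by (auto simp: scalar_prod_def atLeast0LessThan mat_to_vec_def index_pair_less intro!: sum.cong)
  also have "\<dots> = (\<Sum>a<n. \<Sum>b<n. A $$ (?i, a) * B $$ (b, ?j) * X $$ (a, b))" by (rule sum_div_mod)
  also have "\<dots> = (\<Sum>b<n. (\<Sum>a<n. A $$ (?i, a) * X $$ (a, b)) * B $$ (b, ?j))"
    by (subst sum.swap) (simp add: sum_distrib_right sum_distrib_left mult_ac)
  also have "\<dots> = (\<Sum>b<n. (A * X) $$ (?i, b) * B $$ (b, ?j))"
    using ij d by (intro sum.cong) (auto simp: scalar_prod_def atLeast0LessThan)
  also have "\<dots> = (A * X * B) $$ (?i, ?j)"
    using ij d by (subst index_mult_mat(1)[of _ "A * X"]) (auto simp: scalar_prod_def atLeast0LessThan intro!: sum.cong)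
  finally show "(tensor_mat A (transpose_mat B) *\<^sub>v mat_to_vec n X) $ k = mat_to_vec n (A * X * B) $ k"
    using k by (simp add: mat_to_vec_def)
qed (use A B in \<open>simp add: tensor_mat_def mat_to_vec_def carrier_matD\<close>)

lemma dual_mat_SL:
  assumes g: "g \<in> carrier (SL_grp n)"
  shows "dual_mat n g = transpose_mat (adj_mat g)"
proof -
  note gc = SL_carrierD[OF g] and ac = SL_carrierD[OF SL_adj_mat(1)[OF g]]
  have "inv\<^bsub>GL_grp n\<^esub> g = adj_mat g"
    unfolding m_inv_def
  proof (rule the_equality)
    show "adj_mat g \<in> carrier (GL_grp n) \<and> g \<otimes>\<^bsub>GL_grp n\<^esub> adj_mat g = \<one>\<^bsub>GL_grp n\<^esub> \<and>
        adj_mat g \<otimes>\<^bsub>GL_grp n\<^esub> g = \<one>\<^bsub>GL_grp n\<^esub>"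
      using gc ac SL_adj_mat(2,3)[OF g] by (auto simp: GL_grp_def units_of_def Units_def ring_mat_simps)
    fix y assume "y \<in> carrier (GL_grp n) \<and> g \<otimes>\<^bsub>GL_grp n\<^esub> y = \<one>\<^bsub>GL_grp n\<^esub> \<and> y \<otimes>\<^bsub>GL_grp n\<^esub> g = \<one>\<^bsub>GL_grp n\<^esub>"
    hence y: "y \<in> carrier_mat n n" "y * g = 1\<^sub>m n" by (auto simp: GL_grp_def units_of_def Units_def ring_mat_simps)
    have "y = y * (g * adj_mat g)" unfolding SL_adj_mat(2)[OF g] right_mult_one_mat[OF y(1)] ..
    also have "\<dots> = adj_mat g"
      unfolding assoc_mult_mat[OF y(1) gc ac, symmetric] y(2) left_mult_one_mat[OF ac] ..
    finally show "y = adj_mat g" .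
  qed
  thus ?thesis by (simp add: dual_mat_def)
qed

lemma conj_mat_mult:
  assumes g: "g \<in> carrier (SL_grp n)" and X: "X \<in> carrier_mat n n" and Y: "Y \<in> carrier_mat n n"
  shows "conj_mat g (X * Y) = conj_mat g X * conj_mat g Y"
proof (rule conj_mat_eqI[OF g mult_carrier_mat[OF X Y] mult_carrier_mat[OF conj_mat_closed[OF g X] conj_mat_closed[OF g Y]]])
  note gc = SL_carrierD[OF g] and cX = conj_mat_closed[OF g X] and cY = conj_mat_closed[OF g Y]
  have "conj_mat g X * conj_mat g Y * g = conj_mat g X * (g * Y)"
    unfolding assoc_mult_mat[OF cX cY gc] conj_mat_mult_right[OF g Y] ..
  also have "\<dots> = g * (X * Y)"
    unfolding assoc_mult_mat[OF cX gc Y, symmetric] conj_mat_mult_right[OF g X] by (rule assoc_mult_mat[OF gc X Y])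
  finally show "conj_mat g X * conj_mat g Y * g = g * (X * Y)" .
qed

lemma SL_pow_closed: "g \<in> carrier (SL_grp n) \<Longrightarrow> g ^\<^sub>m k \<in> carrier (SL_grp n)"
proof (induction k)
  case 0
  thus ?case using SL_one[of n] carrier_matD(1)[OF SL_carrierD[OF 0]] by simp
next
  case (Suc k)
  thus ?case using SL_mult_closed[of "g ^\<^sub>m k" n g] by simp
qed

text \<open>
  The matrix \<open>Ad\<close> is the action of \<open>u\<close> on \<open>V \<otimes> V\<^sup>*\<close>, and \<open>\<delta>\<close> is the operator of \<open>Ad - 1\<close> on matrices.
\<close>

locale SL_element =
  fixes n :: nat and u :: "'a :: field mat"
  assumes u: "u \<in> carrier (SL_grp n)"
begin

definition \<delta> :: "'a mat \<Rightarrow> 'a mat" where "\<delta> X = conj_mat u X - X"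

definition Ad :: "'a mat" where "Ad = tensor_mat u (transpose_mat (adj_mat u))"

abbreviation "D \<equiv> Ad - 1\<^sub>m (n * n)"

lemma uc: "u \<in> carrier_mat n n" by (rule SL_carrierD[OF u])

lemma Ad_closed: "Ad \<in> carrier_mat (n * n) (n * n)"
  using uc SL_carrierD[OF SL_adj_mat(1)[OF u]] by (simp add: Ad_def tensor_mat_def carrier_matD)

lemma D_closed: "D \<in> carrier_mat (n * n) (n * n)"
  by (rule minus_carrier_mat) simp

lemma Ad_mat_to_vec: "X \<in> carrier_mat n n \<Longrightarrow> Ad *\<^sub>v mat_to_vec n X = mat_to_vec n (conj_mat u X)"
  unfolding Ad_def conj_mat_def by (rule tensor_mat_mat_to_vec[OF uc SL_carrierD[OF SL_adj_mat(1)[OF u]]])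

lemma conj_closed: "X \<in> carrier_mat n n \<Longrightarrow> conj_mat u X \<in> carrier_mat n n"
  by (rule conj_mat_closed[OF u])

lemma delta_closed: "X \<in> carrier_mat n n \<Longrightarrow> \<delta> X \<in> carrier_mat n n"
  unfolding \<delta>_def by (rule minus_carrier_mat)

lemma delta_pow_closed: "X \<in> carrier_mat n n \<Longrightarrow> (\<delta> ^^ k) X \<in> carrier_mat n n"
  by (induction k) (simp_all add: delta_closed)

lemma D_mat_to_vec: "X \<in> carrier_mat n n \<Longrightarrow> D *\<^sub>v mat_to_vec n X = mat_to_vec n (\<delta> X)"
  unfolding \<delta>_def mat_to_vec_minus[OF conj_closed]
    minus_mult_distrib_mat_vec[OF Ad_closed one_carrier_mat mat_to_vec_closed]
    Ad_mat_to_vec one_mult_mat_vec[OF mat_to_vec_closed] ..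

lemma D_pow_mat_to_vec: "X \<in> carrier_mat n n \<Longrightarrow> D ^\<^sub>m k *\<^sub>v mat_to_vec n X = mat_to_vec n ((\<delta> ^^ k) X)"
proof (induction k)
  case 0
  thus ?case using carrier_matD(1)[OF Ad_closed] by simp
next
  case (Suc k)
  have "D ^\<^sub>m Suc k *\<^sub>v mat_to_vec n X = D *\<^sub>v (D ^\<^sub>m k *\<^sub>v mat_to_vec n X)"
    unfolding mat_pow_Suc_left[OF D_closed]
    by (rule assoc_mult_mat_vec[OF D_closed pow_carrier_mat[OF D_closed] mat_to_vec_closed])
  thus ?case unfolding Suc.IH[OF Suc.prems] D_mat_to_vec[OF delta_pow_closed[OF Suc.prems]] by simp
qed

lemma Ad_pow_mat_to_vec:
  "X \<in> carrier_mat n n \<Longrightarrow> Ad ^\<^sub>m k *\<^sub>v mat_to_vec n X = mat_to_vec n (conj_mat (u ^\<^sub>m k) X)"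
proof (induction k)
  case 0
  thus ?case using carrier_matD(1)[OF Ad_closed] carrier_matD(1)[OF uc] conj_mat_one[OF 0] by simp
next
  case (Suc k)
  have "Ad ^\<^sub>m Suc k *\<^sub>v mat_to_vec n X = Ad *\<^sub>v (Ad ^\<^sub>m k *\<^sub>v mat_to_vec n X)"
    unfolding mat_pow_Suc_left[OF Ad_closed]
    by (rule assoc_mult_mat_vec[OF Ad_closed pow_carrier_mat[OF Ad_closed] mat_to_vec_closed])
  also have "\<dots> = mat_to_vec n (conj_mat u (conj_mat (u ^\<^sub>m k) X))"
    unfolding Suc.IH[OF Suc.prems] by (rule Ad_mat_to_vec[OF conj_mat_closed[OF SL_pow_closed[OF u] Suc.prems]])
  also have "conj_mat u (conj_mat (u ^\<^sub>m k) X) = conj_mat (u ^\<^sub>m Suc k) X"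
    unfolding mat_pow_Suc_left[OF uc] conj_mat_conj_mat[OF u SL_pow_closed[OF u] Suc.prems] ..
  finally show ?case .
qed

lemma delta_add:
  assumes "X \<in> carrier_mat n n" "Y \<in> carrier_mat n n"
  shows "\<delta> (X + Y) = \<delta> X + \<delta> Y"
  unfolding \<delta>_def conj_mat_add[OF u assms]
  by (rule eq_matI) (use carrier_matD[OF assms(1)] carrier_matD[OF assms(2)]
      carrier_matD[OF conj_closed[OF assms(1)]] carrier_matD[OF conj_closed[OF assms(2)]] in simp_all)

lemma delta_smult:
  assumes "X \<in> carrier_mat n n"
  shows "\<delta> (c \<cdot>\<^sub>m X) = c \<cdot>\<^sub>m \<delta> X"
  unfolding \<delta>_def conj_mat_smult[OF u assms]
  by (rule eq_matI) (use carrier_matD[OF assms] carrier_matD[OF conj_closed[OF assms]] in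
      \<open>simp_all add: right_diff_distrib\<close>)

lemma delta_pow_add:
  assumes "X \<in> carrier_mat n n" "Y \<in> carrier_mat n n"
  shows "(\<delta> ^^ k) (X + Y) = (\<delta> ^^ k) X + (\<delta> ^^ k) Y"
  by (induction k) (simp_all add: delta_add[OF delta_pow_closed[OF assms(1)] delta_pow_closed[OF assms(2)]])

lemma delta_pow_smult:
  assumes "X \<in> carrier_mat n n"
  shows "(\<delta> ^^ k) (c \<cdot>\<^sub>m X) = c \<cdot>\<^sub>m (\<delta> ^^ k) X"
  by (induction k) (simp_all add: delta_smult[OF delta_pow_closed[OF assms]])

lemma delta_pow_zero: "(\<delta> ^^ k) (0\<^sub>m n n) = 0\<^sub>m n n"
proof -
  have "0 \<cdot>\<^sub>m 0\<^sub>m n n = (0\<^sub>m n n :: 'a mat)" by (intro eq_matI) auto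
  moreover have "0 \<cdot>\<^sub>m (\<delta> ^^ k) (0\<^sub>m n n) = 0\<^sub>m n n"
    using carrier_matD[OF delta_pow_closed[OF zero_carrier_mat, of k]] by (intro eq_matI) auto
  ultimately show ?thesis using delta_pow_smult[OF zero_carrier_mat, of k 0] by metis
qed

lemma delta_pow_scalar: "k \<ge> 1 \<Longrightarrow> (\<delta> ^^ k) (c \<cdot>\<^sub>m 1\<^sub>m n) = 0\<^sub>m n n"
proof -
  assume "k \<ge> 1"
  then obtain j where k: "k = Suc j" by (cases k) auto
  have "\<delta> (c \<cdot>\<^sub>m 1\<^sub>m n) = 0\<^sub>m n n"
    unfolding \<delta>_def conj_mat_scalar[OF u] by (intro eq_matI) auto
  thus ?thesis unfolding k funpow_Suc_right comp_def using delta_pow_zero by simp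
qed

lemma delta_trace: "X \<in> carrier_mat n n \<Longrightarrow> mat_trace (\<delta> X) = 0"
  unfolding \<delta>_def by (simp add: mat_trace_minus[OF conj_closed] conj_mat_trace[OF u])

lemma delta_pow_trace: "X \<in> carrier_mat n n \<Longrightarrow> k \<ge> 1 \<Longrightarrow> mat_trace ((\<delta> ^^ k) X) = 0"
proof (cases k)
  case (Suc j)
  assume "X \<in> carrier_mat n n"
  from delta_trace[OF delta_pow_closed[OF this]] show ?thesis unfolding Suc by simp
qed simp

lemma delta_conj: "X \<in> carrier_mat n n \<Longrightarrow> \<delta> (conj_mat u X) = conj_mat u (\<delta> X)"
proof -
  assume X: "X \<in> carrier_mat n n"
  have "conj_mat u (\<delta> X) = conj_mat u (conj_mat u X + (-1) \<cdot>\<^sub>m X)"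
    unfolding \<delta>_def by (rule arg_cong[of _ _ "conj_mat u"], rule eq_matI) (use carrier_matD[OF X] carrier_matD[OF conj_closed[OF X]] in auto)
  also have "\<dots> = conj_mat u (conj_mat u X) + (-1) \<cdot>\<^sub>m conj_mat u X"
    unfolding conj_mat_add[OF u conj_closed[OF X] smult_carrier_mat[OF X]] conj_mat_smult[OF u X] ..
  also have "\<dots> = \<delta> (conj_mat u X)"
    unfolding \<delta>_def by (rule eq_matI)
      (use carrier_matD[OF conj_closed[OF X]] carrier_matD[OF conj_closed[OF conj_closed[OF X]]] in auto)
  finally show ?thesis by simp
qed

lemma delta_pow_conj: "X \<in> carrier_mat n n \<Longrightarrow> (\<delta> ^^ k) (conj_mat u X) = conj_mat u ((\<delta> ^^ k) X)"
  by (induction k) (simp_all add: delta_conj[OF delta_pow_closed])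

lemma conj_inj:
  assumes "X \<in> carrier_mat n n" "conj_mat u X = 0\<^sub>m n n"
  shows "X = 0\<^sub>m n n"
proof -
  have "X = conj_mat (adj_mat u) (conj_mat u X)"
    unfolding conj_mat_conj_mat[OF SL_adj_mat(1)[OF u] u assms(1), symmetric] SL_adj_mat(3)[OF u]
      conj_mat_one[OF assms(1)] ..
  also have "\<dots> = conj_mat (adj_mat u) (0 \<cdot>\<^sub>m 1\<^sub>m n)"
    unfolding assms(2) by (rule arg_cong[of _ _ "conj_mat (adj_mat u)"]) (rule eq_matI, auto)
  also have "\<dots> = 0\<^sub>m n n" unfolding conj_mat_scalar[OF SL_adj_mat(1)[OF u]] by (rule eq_matI) auto
  finally show ?thesis .
qed

text \<open>
  The trace form is invariant, so the adjoint of \<open>u - 1\<close> is \<open>u\<^sup>-\<^sup>1 - 1 = - u\<^sup>-\<^sup>1 (u - 1)\<close>. Its powers have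
  the same kernels as those of \<open>\<delta>\<close>, and the kernel of the adjoint is orthogonal to the image.
\<close>

lemma trace_orthogonal:
  assumes "X \<in> carrier_mat n n" "Y \<in> carrier_mat n n" "(\<delta> ^^ k) X = 0\<^sub>m n n"
  shows "mat_trace (X * (\<delta> ^^ k) Y) = 0"
  using assms(1,3)
proof (induction k arbitrary: X)
  case 0
  hence "X = 0\<^sub>m n n" by simp
  thus ?case using left_mult_zero_mat[OF assms(2), of n] by (simp add: mat_trace_zero)
next
  case (Suc k)
  let ?Y = "(\<delta> ^^ k) Y" and ?v = "adj_mat u"
  note X = Suc.prems(1) and Y = delta_pow_closed[OF assms(2), of k]
  note v = SL_adj_mat(1)[OF u]
  note vX = conj_mat_closed[OF v X]
  define Z where "Z = conj_mat ?v X - X"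
  have Z: "Z \<in> carrier_mat n n" unfolding Z_def by (rule minus_carrier_mat[OF X])
  have conj_back: "conj_mat u (conj_mat ?v X) = X"
    unfolding conj_mat_conj_mat[OF u v X, symmetric] SL_adj_mat(2)[OF u] by (rule conj_mat_one[OF X])
  have "mat_trace (X * conj_mat u ?Y) = mat_trace (conj_mat u (conj_mat ?v X * ?Y))"
    unfolding conj_mat_mult[OF u vX Y] conj_back ..
  also have "\<dots> = mat_trace (conj_mat ?v X * ?Y)" by (rule conj_mat_trace[OF u mult_carrier_mat[OF vX Y]])
  finally have 1: "mat_trace (X * conj_mat u ?Y) = mat_trace (conj_mat ?v X * ?Y)" .
  have "mat_trace (X * \<delta> ?Y) = mat_trace (X * conj_mat u ?Y) - mat_trace (X * ?Y)"
    unfolding \<delta>_def[of ?Y] mult_minus_distrib_mat[OF X conj_closed[OF Y] Y]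
    by (rule mat_trace_minus[OF mult_carrier_mat[OF X conj_closed[OF Y]] mult_carrier_mat[OF X Y]])
  also have "\<dots> = mat_trace (Z * ?Y)"
    unfolding 1 Z_def minus_mult_distrib_mat[OF vX X Y]
    by (rule mat_trace_minus[OF mult_carrier_mat[OF vX Y] mult_carrier_mat[OF X Y], symmetric])
  also have "\<dots> = 0"
  proof (rule Suc.IH[OF Z])
    have "Z = conj_mat ?v X + (-1) \<cdot>\<^sub>m X"
      unfolding Z_def by (rule eq_matI) (use carrier_matD[OF X] carrier_matD[OF vX] in auto)
    hence "conj_mat u Z = X + (-1) \<cdot>\<^sub>m conj_mat u X"
      using conj_mat_add[OF u vX smult_carrier_mat[OF X]] conj_mat_smult[OF u X] conj_back by simp
    also have "\<dots> = (-1) \<cdot>\<^sub>m \<delta> X"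
      unfolding \<delta>_def by (rule eq_matI) (use carrier_matD[OF X] carrier_matD[OF conj_closed[OF X]] in auto)
    finally have "conj_mat u ((\<delta> ^^ k) Z) = (-1) \<cdot>\<^sub>m (\<delta> ^^ k) (\<delta> X)"
      unfolding delta_pow_conj[OF Z, symmetric] using delta_pow_smult[OF delta_closed[OF X]] by simp
    also have "(\<delta> ^^ k) (\<delta> X) = 0\<^sub>m n n" using Suc.prems(2) unfolding funpow_Suc_right comp_def .
    also have "(-1) \<cdot>\<^sub>m 0\<^sub>m n n = (0\<^sub>m n n :: 'a mat)" by (rule eq_matI) auto
    finally show "(\<delta> ^^ k) Z = 0\<^sub>m n n" by (rule conj_inj[OF delta_pow_closed[OF Z]])
  qed
  finally show ?case by simp
qed

lemma mat_to_vec_sum: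
  "(\<And>i. i < k \<Longrightarrow> f i \<in> carrier_mat n n) \<Longrightarrow> (\<And>i. i < k \<Longrightarrow> M i \<in> carrier_mat (n * n) (n * n)) \<Longrightarrow>
   (\<And>i. i < k \<Longrightarrow> M i *\<^sub>v mat_to_vec n X = mat_to_vec n (f i)) \<Longrightarrow>
   mat_sum (n * n) M k *\<^sub>v mat_to_vec n X = mat_to_vec n (mat_sum n f k :: 'a mat)"
proof (induction k)
  case 0
  have "0\<^sub>m (n * n) (n * n) *\<^sub>v mat_to_vec n X = 0\<^sub>v (n * n)"
    by (rule eq_vecI) (simp_all add: scalar_prod_def mat_to_vec_def)
  thus ?case by (simp add: mat_to_vec_zero)
next
  case (Suc k)
  have c: "mat_sum (n * n) M k \<in> carrier_mat (n * n) (n * n)" "mat_sum n f k \<in> carrier_mat n n"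
    using Suc.prems by (auto intro!: mat_sum_closed)
  have IH: "mat_sum (n * n) M k *\<^sub>v mat_to_vec n X = mat_to_vec n (mat_sum n f k)"
    by (rule Suc.IH) (use Suc.prems in simp_all)
  show ?case
    unfolding mat_sum.simps add_mult_distrib_mat_vec[OF c(1) Suc.prems(2)[OF lessI] mat_to_vec_closed]
      mat_to_vec_add[OF c(2) Suc.prems(1)[OF lessI]] IH Suc.prems(3)[OF lessI] ..
qed

text \<open>
  These are the identities \<open>(a - 1)\<^sup>q = a\<^sup>q - 1\<close> and \<open>(a - 1)\<^sup>q\<^sup>-\<^sup>1 = 1 + a + \<dots> + a\<^sup>q\<^sup>-\<^sup>1\<close> for the
  conjugation \<open>a\<close> by \<open>u\<close>.
\<close>

lemma delta_pow_char:
  assumes p: "prime CHAR('a)" "q = CHAR('a) ^ a" and X: "X \<in> carrier_mat n n"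
  shows "(\<delta> ^^ q) X = conj_mat (u ^\<^sub>m q) X - X"
    and "(\<delta> ^^ (q - 1)) X = mat_sum n (\<lambda>i. conj_mat (u ^\<^sub>m i) X) q"
proof -
  note cu = conj_mat_closed[OF SL_pow_closed[OF u] X]
  have "mat_to_vec n ((\<delta> ^^ q) X) = mat_to_vec n (conj_mat (u ^\<^sub>m q) X - X)"
    unfolding D_pow_mat_to_vec[OF X, symmetric] mat_minus_one_pow_char(1)[OF Ad_closed p]
      minus_mult_distrib_mat_vec[OF pow_carrier_mat[OF Ad_closed] one_carrier_mat mat_to_vec_closed]
      Ad_pow_mat_to_vec[OF X] one_mult_mat_vec[OF mat_to_vec_closed] mat_to_vec_minus[OF cu X] ..
  thus "(\<delta> ^^ q) X = conj_mat (u ^\<^sub>m q) X - X"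
    using mat_to_vec_eq_iff[OF delta_pow_closed[OF X] minus_carrier_mat[OF X]] by blast
  have s: "mat_sum n (\<lambda>i. conj_mat (u ^\<^sub>m i) X) q \<in> carrier_mat n n" by (rule mat_sum_closed) (rule cu)
  have "mat_to_vec n ((\<delta> ^^ (q - 1)) X) = mat_to_vec n (mat_sum n (\<lambda>i. conj_mat (u ^\<^sub>m i) X) q)"
    unfolding D_pow_mat_to_vec[OF X, symmetric] mat_minus_one_pow_char(2)[OF Ad_closed p]
    by (rule mat_to_vec_sum) (rule cu, rule pow_carrier_mat[OF Ad_closed], rule Ad_pow_mat_to_vec[OF X])
  thus "(\<delta> ^^ (q - 1)) X = mat_sum n (\<lambda>i. conj_mat (u ^\<^sub>m i) X) q"
    using mat_to_vec_eq_iff[OF delta_pow_closed[OF X] s] by blast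
qed

end

section \<open>Kernels on the quotient of the traceless matrices by the scalars\<close>

lemma mat_to_vec_dim [simp]: "dim_vec (mat_to_vec n X) = n * n"
  by (simp add: mat_to_vec_def)

context SL_element
begin

text \<open>
  Matrices are vectorized here, so that dimensions of subspaces are available.
\<close>

definition preimage_scalars :: "nat \<Rightarrow> 'a vec set" where
  "preimage_scalars k = {x \<in> carrier_vec (n * n). \<exists>c. D ^\<^sub>m k *\<^sub>v x = c \<cdot>\<^sub>v mat_to_vec n (1\<^sub>m n)}"

lemma D_pow_closed: "D ^\<^sub>m k \<in> carrier_mat (n * n) (n * n)"
  by (rule pow_carrier_mat[OF D_closed])

lemma lin_subspace_preimage_scalars: "lin_subspace (n * n) (preimage_scalars k)"
  unfolding lin_subspace_def
proof (intro conjI ballI allI)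
  let ?one = "mat_to_vec n (1\<^sub>m n) :: 'a vec"
  have one: "?one \<in> carrier_vec (n * n)" by simp
  show "preimage_scalars k \<subseteq> carrier_vec (n * n)" by (auto simp: preimage_scalars_def)
  have "D ^\<^sub>m k *\<^sub>v 0\<^sub>v (n * n) = 0 \<cdot>\<^sub>v ?one"
    unfolding mult_mat_zero_vec[OF D_pow_closed] by (rule eq_vecI) simp_all
  thus "0\<^sub>v (n * n) \<in> preimage_scalars k" unfolding preimage_scalars_def using zero_carrier_vec by blast
  show "x + y \<in> preimage_scalars k" if "x \<in> preimage_scalars k" "y \<in> preimage_scalars k" for x y
  proof -
    obtain c d where c: "x \<in> carrier_vec (n * n)" "D ^\<^sub>m k *\<^sub>v x = c \<cdot>\<^sub>v ?one"
      and d: "y \<in> carrier_vec (n * n)" "D ^\<^sub>m k *\<^sub>v y = d \<cdot>\<^sub>v ?one"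
      using \<open>x \<in> _\<close> \<open>y \<in> _\<close> unfolding preimage_scalars_def by blast
    have "D ^\<^sub>m k *\<^sub>v (x + y) = (c + d) \<cdot>\<^sub>v ?one"
      unfolding mult_add_distrib_mat_vec[OF D_pow_closed c(1) d(1)] c(2) d(2)
      by (rule add_smult_distrib_vec[symmetric])
    thus ?thesis unfolding preimage_scalars_def using add_carrier_vec[OF c(1) d(1)] by blast
  qed
  show "a \<cdot>\<^sub>v x \<in> preimage_scalars k" if x: "x \<in> preimage_scalars k" for a x
  proof -
    obtain c where c: "x \<in> carrier_vec (n * n)" "D ^\<^sub>m k *\<^sub>v x = c \<cdot>\<^sub>v ?one"
      using x unfolding preimage_scalars_def by blast
    have "D ^\<^sub>m k *\<^sub>v (a \<cdot>\<^sub>v x) = (a * c) \<cdot>\<^sub>v ?one"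
      unfolding mult_mat_vec[OF D_pow_closed c(1)] c(2) by (rule smult_smult_assoc)
    thus ?thesis unfolding preimage_scalars_def using smult_carrier_vec[of a x] c(1) by blast
  qed
qed

lemma preimage_scalars_iff:
  assumes "X \<in> carrier_mat n n"
  shows "mat_to_vec n X \<in> preimage_scalars k \<longleftrightarrow> (\<exists>c. (\<delta> ^^ k) X = c \<cdot>\<^sub>m 1\<^sub>m n)"
  unfolding preimage_scalars_def D_pow_mat_to_vec[OF assms] mem_Collect_eq
    mat_to_vec_smult[OF one_carrier_mat, symmetric]
    mat_to_vec_eq_iff[OF delta_pow_closed[OF assms] smult_carrier_mat[OF one_carrier_mat]]
  by simp

lemma mat_to_vec_cases:
  assumes "x \<in> carrier_vec (n * n)"
  obtains X where "X \<in> carrier_mat n n" "x = mat_to_vec n X"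
  by (rule that[OF vec_to_mat_closed mat_to_vec_inverse[OF assms, symmetric]])

lemma mat_to_vec_mem_kernel:
  assumes "X \<in> carrier_mat n n"
  shows "mat_to_vec n X \<in> mat_kernel (D ^\<^sub>m k) \<longleftrightarrow> (\<delta> ^^ k) X = 0\<^sub>m n n"
  unfolding mat_kernel[OF D_pow_closed] mem_Collect_eq D_pow_mat_to_vec[OF assms]
    mat_to_vec_zero[symmetric] mat_to_vec_eq_iff[OF delta_pow_closed[OF assms] zero_carrier_mat]
  by simp

lemma sdim_preimage_scalars:
  assumes n: "n > 0"
  shows "sdim (n * n) (preimage_scalars k) = kernel_dim (D ^\<^sub>m k) +
     (if \<exists>X \<in> carrier_mat n n. (\<delta> ^^ k) X = 1\<^sub>m n then 1 else 0)"
proof -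
  let ?one = "mat_to_vec n (1\<^sub>m n) :: 'a vec"
  let ?f = "\<lambda>x. (D ^\<^sub>m k *\<^sub>v x) $ 0"
  have nn: "0 < n * n" using n by simp
  have one0: "?one $ 0 = 1" using mat_to_vec_index[of 0 n 0 "1\<^sub>m n"] n by simp
  have carrier: "x \<in> carrier_vec (n * n)" if "x \<in> preimage_scalars k" for x
    using that by (simp add: preimage_scalars_def)
  have val: "\<exists>X \<in> carrier_mat n n. x = mat_to_vec n X \<and> (\<delta> ^^ k) X = ?f x \<cdot>\<^sub>m 1\<^sub>m n"
    if x: "x \<in> preimage_scalars k" for x :: "'a vec"
  proof -
    obtain X where X: "X \<in> carrier_mat n n" "x = mat_to_vec n X" by (rule mat_to_vec_cases[OF carrier[OF x]])
    obtain c where c: "(\<delta> ^^ k) X = c \<cdot>\<^sub>m 1\<^sub>m n"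
      using x unfolding X(2) preimage_scalars_iff[OF X(1)] by blast
    have "?f x = c * ?one $ 0"
      unfolding X(2) D_pow_mat_to_vec[OF X(1)] c mat_to_vec_smult[OF one_carrier_mat]
      by (rule index_smult_vec(1)) (use nn in simp)
    hence "?f x = c" unfolding one0 mult_1_right .
    thus ?thesis using X c by blast
  qed
  have "sdim (n * n) (preimage_scalars k) = sdim (n * n) {x \<in> preimage_scalars k. ?f x = 0} +
      (if \<exists>x \<in> preimage_scalars k. ?f x \<noteq> 0 then 1 else 0)"
  proof (rule sdim_functional[OF lin_subspace_preimage_scalars])
    show "?f (x + y) = ?f x + ?f y" if "x \<in> preimage_scalars k" "y \<in> preimage_scalars k" for x y
      unfolding mult_add_distrib_mat_vec[OF D_pow_closed carrier[OF that(1)] carrier[OF that(2)]]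
      by (rule index_add_vec(1)) (use nn carrier_matD(1)[OF D_pow_closed[of k]] in \<open>simp del: pow_mat_dim\<close>)
    show "?f (c \<cdot>\<^sub>v x) = c * ?f x" if "x \<in> preimage_scalars k" for c x
      unfolding mult_mat_vec[OF D_pow_closed carrier[OF that]]
      by (rule index_smult_vec(1)) (use nn carrier_matD(1)[OF D_pow_closed[of k]] in \<open>simp del: pow_mat_dim\<close>)
  qed
  also have "{x \<in> preimage_scalars k. ?f x = 0} = mat_kernel (D ^\<^sub>m k)"
  proof (intro equalityI subsetI)
    fix x assume "x \<in> {x \<in> preimage_scalars k. ?f x = 0}"
    hence x: "x \<in> preimage_scalars k" "?f x = 0" by auto
    then obtain X where X: "X \<in> carrier_mat n n" "x = mat_to_vec n X" "(\<delta> ^^ k) X = 0 \<cdot>\<^sub>m 1\<^sub>m n"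
      using val[OF x(1)] unfolding x(2) by blast
    have "0 \<cdot>\<^sub>m 1\<^sub>m n = (0\<^sub>m n n :: 'a mat)" by (rule eq_matI) auto
    thus "x \<in> mat_kernel (D ^\<^sub>m k)" unfolding X(2) mat_to_vec_mem_kernel[OF X(1)] X(3) .
  next
    fix x assume x: "x \<in> mat_kernel (D ^\<^sub>m k)"
    hence x': "x \<in> carrier_vec (n * n)" "D ^\<^sub>m k *\<^sub>v x = 0\<^sub>v (n * n)" using mat_kernelD[OF D_pow_closed x] by auto
    have "0\<^sub>v (n * n) = 0 \<cdot>\<^sub>v ?one" by (rule eq_vecI) simp_all
    hence "D ^\<^sub>m k *\<^sub>v x = 0 \<cdot>\<^sub>v ?one" unfolding x'(2) .
    hence "x \<in> preimage_scalars k" unfolding preimage_scalars_def using x'(1) by blast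
    moreover have "?f x = 0" unfolding x'(2) by (rule index_zero_vec(1)[OF nn])
    ultimately show "x \<in> {x \<in> preimage_scalars k. ?f x = 0}" by blast
  qed
  also have "sdim (n * n) (mat_kernel (D ^\<^sub>m k)) = kernel_dim (D ^\<^sub>m k)"
    using kernel_dim_eq_sdim[OF D_pow_closed] by simp
  also have "(\<exists>x \<in> preimage_scalars k. ?f x \<noteq> 0) \<longleftrightarrow> (\<exists>X \<in> carrier_mat n n. (\<delta> ^^ k) X = 1\<^sub>m n)"
  proof
    assume "\<exists>x \<in> preimage_scalars k. ?f x \<noteq> 0"
    then obtain x where x: "x \<in> preimage_scalars k" "?f x \<noteq> 0" by blast
    from val[OF x(1)] obtain X where X: "X \<in> carrier_mat n n" "(\<delta> ^^ k) X = ?f x \<cdot>\<^sub>m 1\<^sub>m n" by blast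
    have "(\<delta> ^^ k) ((1 / ?f x) \<cdot>\<^sub>m X) = (1 / ?f x) \<cdot>\<^sub>m (?f x \<cdot>\<^sub>m 1\<^sub>m n)"
      unfolding delta_pow_smult[OF X(1)] X(2) ..
    also have "\<dots> = 1\<^sub>m n" using x(2) by (intro eq_matI) auto
    finally show "\<exists>X \<in> carrier_mat n n. (\<delta> ^^ k) X = 1\<^sub>m n" using smult_carrier_mat[OF X(1)] by blast
  next
    assume "\<exists>X \<in> carrier_mat n n. (\<delta> ^^ k) X = 1\<^sub>m n"
    then obtain X where X: "X \<in> carrier_mat n n" "(\<delta> ^^ k) X = 1\<^sub>m n" by blast
    have "1\<^sub>m n = 1 \<cdot>\<^sub>m (1\<^sub>m n :: 'a mat)" by (rule eq_matI) auto
    hence "mat_to_vec n X \<in> preimage_scalars k" unfolding preimage_scalars_iff[OF X(1)] X(2) by blast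
    have "?f (mat_to_vec n X) = 1" unfolding D_pow_mat_to_vec[OF X(1)] X(2) by (rule one0)
    hence "?f (mat_to_vec n X) \<noteq> 0" by simp
    with \<open>mat_to_vec n X \<in> _\<close> show "\<exists>x \<in> preimage_scalars k. ?f x \<noteq> 0" by blast
  qed
  finally show ?thesis .
qed

text \<open>
  Compute the dimension of \<open>A = {X. \<delta>\<^sup>k X scalar}\<close> in two ways. On the one hand, \<open>\<delta>\<^sup>k\<close> maps \<open>A\<close> to the
  scalars with kernel \<open>ker \<delta>\<^sup>k\<close> (\<open>sdim_preimage_scalars\<close>). On the other hand, the
  matrices of trace zero in \<open>A\<close> are all of \<open>A\<close> or of codimension 1. By \<open>\<Psi>\<close> they are mapped onto
  \<open>ker (R - 1)\<^sup>k\<close>, and the kernel of this map consists of the scalar matrices of trace zero, a space of dimension 1 or 0 according to whether \<open>n = 0\<close> in the field.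
\<close>

lemma kernel_dim_quotient:
  fixes \<Psi> :: "'a mat \<Rightarrow> 'a vec"
  assumes n: "n > 0"
    and add: "\<And>X Y. X \<in> traceless n \<Longrightarrow> Y \<in> traceless n \<Longrightarrow> \<Psi> (X + Y) = \<Psi> X + \<Psi> Y"
    and smult: "\<And>c X. X \<in> traceless n \<Longrightarrow> \<Psi> (c \<cdot>\<^sub>m X) = c \<cdot>\<^sub>v \<Psi> X"
    and surj: "\<Psi> ` traceless n = carrier_vec N"
    and ker: "\<And>X. X \<in> traceless n \<Longrightarrow> \<Psi> X = 0\<^sub>v N \<longleftrightarrow> (\<exists>c. X = c \<cdot>\<^sub>m 1\<^sub>m n)"
    and equiv: "\<And>X. X \<in> traceless n \<Longrightarrow> \<Psi> (conj_mat u X) = R *\<^sub>v \<Psi> X"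
    and R: "R \<in> carrier_mat N N"
  shows "kernel_dim (D ^\<^sub>m k) + (if \<exists>X \<in> carrier_mat n n. (\<delta> ^^ k) X = 1\<^sub>m n then 1 else 0) =
    kernel_dim ((R - 1\<^sub>m N) ^\<^sub>m k) + (if of_nat n = (0 :: 'a) then 1 else 0) +
    (if \<exists>X \<in> carrier_mat n n. \<exists>c. (\<delta> ^^ k) X = c \<cdot>\<^sub>m 1\<^sub>m n \<and> mat_trace X \<noteq> 0 then 1 else 0)"
proof -
  let ?A = "preimage_scalars k" and ?M = "vec_to_mat n" and ?Rk = "(R - 1\<^sub>m N) ^\<^sub>m k"
  have nn: "0 < n * n" using n by simp
  have RD: "R - 1\<^sub>m N \<in> carrier_mat N N" by (rule minus_carrier_mat) simp
  have Rk: "(R - 1\<^sub>m N) ^\<^sub>m j \<in> carrier_mat N N" for j by (rule pow_carrier_mat[OF RD])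
  have tl: "X \<in> carrier_mat n n" if "X \<in> traceless n" for X using that by (simp add: traceless_def)
  have carrier: "x \<in> carrier_vec (n * n)" if "x \<in> ?A" for x using that by (simp add: preimage_scalars_def)
  have \<Psi>c: "\<Psi> X \<in> carrier_vec N" if "X \<in> traceless n" for X using surj that by blast
  have delta_tl: "(\<delta> ^^ j) X \<in> traceless n" if "X \<in> traceless n" for j X
  proof (cases "j = 0")
    case False
    thus ?thesis using delta_pow_closed[OF tl[OF that], of j] delta_pow_trace[OF tl[OF that], of j]
      by (simp add: traceless_def)
  qed (use that in simp)
  have equivk: "\<Psi> ((\<delta> ^^ j) X) = (R - 1\<^sub>m N) ^\<^sub>m j *\<^sub>v \<Psi> X" if X: "X \<in> traceless n" for j X
  proof (induction j)
    case 0
    show ?case using R \<Psi>c[OF X] by simp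
  next
    case (Suc j)
    note Y = delta_tl[OF X, of j]
    let ?Y = "(\<delta> ^^ j) X"
    have "\<delta> ?Y = conj_mat u ?Y + (-1) \<cdot>\<^sub>m ?Y"
      unfolding \<delta>_def[of ?Y] by (rule eq_matI) (use carrier_matD[OF tl[OF Y]] carrier_matD[OF conj_closed[OF tl[OF Y]]] in auto)
    hence "\<Psi> (\<delta> ?Y) = \<Psi> (conj_mat u ?Y + (-1) \<cdot>\<^sub>m ?Y)" by (rule arg_cong)
    also have "\<dots> = R *\<^sub>v \<Psi> ?Y + (-1) \<cdot>\<^sub>v \<Psi> ?Y"
      unfolding add[OF conj_mat_traceless[OF u Y] traceless_smult[OF Y]] smult[OF Y] equiv[OF Y] ..
    also have "\<dots> = (R - 1\<^sub>m N) *\<^sub>v \<Psi> ?Y"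
      unfolding minus_mult_distrib_mat_vec[OF R one_carrier_mat \<Psi>c[OF Y]] one_mult_mat_vec[OF \<Psi>c[OF Y]]
      by (rule eq_vecI) (use carrier_vecD[OF \<Psi>c[OF Y]] carrier_matD[OF R] in auto)
    also have "\<dots> = (R - 1\<^sub>m N) ^\<^sub>m Suc j *\<^sub>v \<Psi> X"
      unfolding Suc.IH mat_pow_Suc_left[OF RD] by (rule assoc_mult_mat_vec[OF RD Rk \<Psi>c[OF X], symmetric])
    finally show ?case by simp
  qed
  let ?t = "\<lambda>x. mat_trace (?M x)"
  define A0 where "A0 = {x \<in> ?A. ?t x = 0}"
  have 1: "sdim (n * n) ?A = sdim (n * n) A0 + (if \<exists>x \<in> ?A. ?t x \<noteq> 0 then 1 else 0)"
    unfolding A0_def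
  proof (rule sdim_functional[OF lin_subspace_preimage_scalars])
    show "?t (x + y) = ?t x + ?t y" if "x \<in> ?A" "y \<in> ?A" for x y
      unfolding vec_to_mat_add[OF carrier[OF that(1)] carrier[OF that(2)]]
      by (rule mat_trace_add[OF vec_to_mat_closed vec_to_mat_closed])
    show "?t (c \<cdot>\<^sub>v x) = c * ?t x" if "x \<in> ?A" for c x
      unfolding vec_to_mat_smult[OF carrier[OF that]] by (rule mat_trace_smult[OF vec_to_mat_closed])
  qed
  have ex: "(\<exists>x \<in> ?A. ?t x \<noteq> 0) \<longleftrightarrow> (\<exists>X \<in> carrier_mat n n. \<exists>c. (\<delta> ^^ k) X = c \<cdot>\<^sub>m 1\<^sub>m n \<and> mat_trace X \<noteq> 0)"
  proof
    assume "\<exists>x \<in> ?A. ?t x \<noteq> 0"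
    then obtain x where x: "x \<in> ?A" "?t x \<noteq> 0" by blast
    hence "mat_to_vec n (?M x) \<in> ?A" using mat_to_vec_inverse[OF carrier[OF x(1)]] by simp
    thus "\<exists>X \<in> carrier_mat n n. \<exists>c. (\<delta> ^^ k) X = c \<cdot>\<^sub>m 1\<^sub>m n \<and> mat_trace X \<noteq> 0"
      using preimage_scalars_iff[OF vec_to_mat_closed, of x k] x(2) vec_to_mat_closed by blast
  next
    assume "\<exists>X \<in> carrier_mat n n. \<exists>c. (\<delta> ^^ k) X = c \<cdot>\<^sub>m 1\<^sub>m n \<and> mat_trace X \<noteq> 0"
    then obtain X c where X: "X \<in> carrier_mat n n" "(\<delta> ^^ k) X = c \<cdot>\<^sub>m 1\<^sub>m n" "mat_trace X \<noteq> 0" by blast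
    have "mat_to_vec n X \<in> ?A" using preimage_scalars_iff[OF X(1)] X(2) by blast
    moreover have "?t (mat_to_vec n X) \<noteq> 0" unfolding vec_to_mat_inverse[OF X(1)] by (rule X(3))
    ultimately show "\<exists>x \<in> ?A. ?t x \<noteq> 0" by (rule bexI[rotated])
  qed
  have A0_tl: "?M x \<in> traceless n" if "x \<in> A0" for x using that by (simp add: A0_def traceless_def)
  have A0_carrier: "x \<in> carrier_vec (n * n)" if "x \<in> A0" for x using that carrier by (simp add: A0_def)
  have A0_I: "mat_to_vec n X \<in> A0" if "X \<in> traceless n" "(\<delta> ^^ k) X = c \<cdot>\<^sub>m 1\<^sub>m n" for X c
    using preimage_scalars_iff[OF tl[OF that(1)], of k] that vec_to_mat_inverse[OF tl[OF that(1)]]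
    by (auto simp: A0_def traceless_def)
  have A0: "lin_subspace (n * n) A0"
    using lin_subspace_preimage_scalars[of k] unfolding lin_subspace_def
  proof (intro conjI ballI allI; elim conjE)
    assume h: "0\<^sub>v (n * n) \<in> ?A" "\<forall>x\<in>?A. \<forall>y\<in>?A. x + y \<in> ?A" "\<forall>c. \<forall>x\<in>?A. c \<cdot>\<^sub>v x \<in> ?A"
    show "A0 \<subseteq> carrier_vec (n * n)" using A0_carrier by blast
    show "x + y \<in> A0" if "x \<in> A0" "y \<in> A0" for x y
    proof -
      have "?t (x + y) = ?t x + ?t y"
        unfolding vec_to_mat_add[OF A0_carrier[OF that(1)] A0_carrier[OF that(2)]]
        by (rule mat_trace_add[OF vec_to_mat_closed vec_to_mat_closed])
      thus ?thesis using that h(2) by (simp add: A0_def)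
    qed
    show sm: "c \<cdot>\<^sub>v x \<in> A0" if "x \<in> A0" for c x
    proof -
      have "?t (c \<cdot>\<^sub>v x) = c * ?t x"
        unfolding vec_to_mat_smult[OF A0_carrier[OF that]] by (rule mat_trace_smult[OF vec_to_mat_closed])
      thus ?thesis using that h(3) by (simp add: A0_def)
    qed
    have M0: "?M (0\<^sub>v (n * n)) = 0\<^sub>m n n" by (rule eq_matI) (auto simp: vec_to_mat_def pair_index_less)
    have "?t (0\<^sub>v (n * n)) = 0" unfolding M0 by (rule mat_trace_zero)
    thus "0\<^sub>v (n * n) \<in> A0" unfolding A0_def using h(1) by blast
  qed
  have 2: "sdim (n * n) A0 = sdim N (mat_kernel ?Rk) + sdim (n * n) {x \<in> A0. \<Psi> (?M x) = 0\<^sub>v N}"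
  proof (rule rank_nullity_subspace[OF A0 lin_subspace_mat_kernel[OF Rk]])
    show "\<Psi> (?M (x + y)) = \<Psi> (?M x) + \<Psi> (?M y)" if "x \<in> A0" "y \<in> A0" for x y
      unfolding vec_to_mat_add[OF A0_carrier[OF that(1)] A0_carrier[OF that(2)]]
      by (rule add[OF A0_tl[OF that(1)] A0_tl[OF that(2)]])
    show "\<Psi> (?M (c \<cdot>\<^sub>v x)) = c \<cdot>\<^sub>v \<Psi> (?M x)" if "x \<in> A0" for c x
      unfolding vec_to_mat_smult[OF A0_carrier[OF that]] by (rule smult[OF A0_tl[OF that]])
    show "(\<lambda>x. \<Psi> (?M x)) ` A0 = mat_kernel ?Rk"
    proof (intro equalityI subsetI)
      fix y assume "y \<in> (\<lambda>x. \<Psi> (?M x)) ` A0"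
      then obtain x where x: "x \<in> A0" "y = \<Psi> (?M x)" by blast
      have "mat_to_vec n (?M x) \<in> ?A" using x(1) mat_to_vec_inverse[OF A0_carrier[OF x(1)]] by (simp add: A0_def)
      then obtain c where "(\<delta> ^^ k) (?M x) = c \<cdot>\<^sub>m 1\<^sub>m n" using preimage_scalars_iff[OF vec_to_mat_closed] by blast
      hence "\<Psi> ((\<delta> ^^ k) (?M x)) = 0\<^sub>v N" using ker[OF delta_tl[OF A0_tl[OF x(1)]]] by blast
      hence "?Rk *\<^sub>v y = 0\<^sub>v N" unfolding equivk[OF A0_tl[OF x(1)]] x(2) .
      thus "y \<in> mat_kernel ?Rk" using mat_kernelI[OF Rk \<Psi>c[OF A0_tl[OF x(1)]]] x(2) by blast
    next
      fix y assume "y \<in> mat_kernel ?Rk"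
      note y = mat_kernelD[OF Rk this]
      have "y \<in> \<Psi> ` traceless n" unfolding surj by (rule y(1))
      then obtain X where X: "X \<in> traceless n" "y = \<Psi> X" by blast
      have "\<Psi> ((\<delta> ^^ k) X) = 0\<^sub>v N" unfolding equivk[OF X(1)] X(2)[symmetric] by (rule y(2))
      then obtain c where "(\<delta> ^^ k) X = c \<cdot>\<^sub>m 1\<^sub>m n" using ker[OF delta_tl[OF X(1)]] by blast
      from A0_I[OF X(1) this] show "y \<in> (\<lambda>x. \<Psi> (?M x)) ` A0"
        by (rule image_eqI[rotated]) (simp only: vec_to_mat_inverse[OF tl[OF X(1)]] X(2))
    qed
  qed
  \<comment> \<open>The kernel of \<open>\<Psi>\<close> in \<open>A0\<close>. It is read off from the entry with index 0.\<close>
  define Z where "Z = {x \<in> A0. \<Psi> (?M x) = 0\<^sub>v N}"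
  let ?one = "mat_to_vec n (1\<^sub>m n) :: 'a vec"
  have one0: "?one $ 0 = 1" using mat_to_vec_index[of 0 n 0 "1\<^sub>m n"] n by simp
  have Z_iff: "mat_to_vec n X \<in> Z \<longleftrightarrow> (\<exists>c. X = c \<cdot>\<^sub>m 1\<^sub>m n \<and> c * of_nat n = 0)" if X: "X \<in> carrier_mat n n" for X
  proof
    assume "mat_to_vec n X \<in> Z"
    hence z: "X \<in> traceless n" "\<Psi> X = 0\<^sub>v N"
      using A0_tl[of "mat_to_vec n X"] vec_to_mat_inverse[OF X] by (auto simp: Z_def)
    then obtain c where c: "X = c \<cdot>\<^sub>m 1\<^sub>m n" using ker by blast
    have "mat_trace X = c * of_nat n" unfolding c mat_trace_smult[OF one_carrier_mat] mat_trace_one ..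
    with z(1) c show "\<exists>c. X = c \<cdot>\<^sub>m 1\<^sub>m n \<and> c * of_nat n = 0" by (auto simp: traceless_def)
  next
    assume "\<exists>c. X = c \<cdot>\<^sub>m 1\<^sub>m n \<and> c * of_nat n = 0"
    then obtain c where c: "X = c \<cdot>\<^sub>m 1\<^sub>m n" "c * of_nat n = 0" by blast
    have "mat_trace X = 0" unfolding c(1) mat_trace_smult[OF one_carrier_mat] mat_trace_one by (rule c(2))
    hence X': "X \<in> traceless n" using X by (simp add: traceless_def)
    have "\<exists>d. (\<delta> ^^ k) X = d \<cdot>\<^sub>m 1\<^sub>m n"
    proof (cases "k = 0")
      case False
      have "(\<delta> ^^ k) X = 0\<^sub>m n n" unfolding c(1) by (rule delta_pow_scalar) (use False in simp)
      also have "\<dots> = 0 \<cdot>\<^sub>m 1\<^sub>m n" by (rule eq_matI) auto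
      finally show ?thesis by blast
    qed (use c in auto)
    then obtain d where "(\<delta> ^^ k) X = d \<cdot>\<^sub>m 1\<^sub>m n" by blast
    from A0_I[OF X' this] show "mat_to_vec n X \<in> Z"
      unfolding Z_def mem_Collect_eq vec_to_mat_inverse[OF X] using ker[OF X'] c(1) by blast
  qed
  have Z_carrier: "x \<in> carrier_vec (n * n)" if "x \<in> Z" for x using that A0_carrier by (simp add: Z_def)
  have Z: "sdim (n * n) Z = (if of_nat n = (0 :: 'a) then 1 else 0)"
  proof -
    have "lin_subspace (n * n) Z"
      unfolding lin_subspace_def
    proof (intro conjI ballI allI)
      show "Z \<subseteq> carrier_vec (n * n)" using Z_carrier by blast
      have "0\<^sub>m n n = 0 \<cdot>\<^sub>m (1\<^sub>m n :: 'a mat)" by (rule eq_matI) auto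
      hence "mat_to_vec n (0\<^sub>m n n) \<in> Z" unfolding Z_iff[OF zero_carrier_mat] by (intro exI[of _ 0]) simp
      thus "0\<^sub>v (n * n) \<in> Z" unfolding mat_to_vec_zero .
      show "x + y \<in> Z" if xy: "x \<in> Z" "y \<in> Z" for x y
      proof -
        obtain X where X: "X \<in> carrier_mat n n" "x = mat_to_vec n X" by (rule mat_to_vec_cases[OF Z_carrier[OF xy(1)]])
        obtain Y where Y: "Y \<in> carrier_mat n n" "y = mat_to_vec n Y" by (rule mat_to_vec_cases[OF Z_carrier[OF xy(2)]])
        obtain c where c: "X = c \<cdot>\<^sub>m 1\<^sub>m n" "c * of_nat n = 0" using xy(1) unfolding X(2) Z_iff[OF X(1)] by blast
        obtain d where d: "Y = d \<cdot>\<^sub>m 1\<^sub>m n" "d * of_nat n = 0" using xy(2) unfolding Y(2) Z_iff[OF Y(1)] by blast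
        have "X + Y = (c + d) \<cdot>\<^sub>m 1\<^sub>m n" unfolding c(1) d(1) by (rule eq_matI) (auto simp: algebra_simps)
        moreover have "(c + d) * of_nat n = 0" using c(2) d(2) by (simp only: distrib_right add_0_left)
        ultimately show ?thesis
          unfolding X(2) Y(2) mat_to_vec_add[OF X(1) Y(1), symmetric] Z_iff[OF add_carrier_mat[OF Y(1)]] by blast
      qed
      show "a \<cdot>\<^sub>v x \<in> Z" if x: "x \<in> Z" for a x
      proof -
        obtain X where X: "X \<in> carrier_mat n n" "x = mat_to_vec n X" by (rule mat_to_vec_cases[OF Z_carrier[OF x]])
        obtain c where c: "X = c \<cdot>\<^sub>m 1\<^sub>m n" "c * of_nat n = 0" using x unfolding X(2) Z_iff[OF X(1)] by blast
        have "a \<cdot>\<^sub>m X = (a * c) \<cdot>\<^sub>m 1\<^sub>m n" unfolding c(1) by (rule eq_matI) auto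
        moreover have "(a * c) * of_nat n = 0" using c(2) by (simp only: mult.assoc mult_zero_right)
        ultimately show ?thesis
          unfolding X(2) mat_to_vec_smult[OF X(1), symmetric] Z_iff[OF smult_carrier_mat[OF X(1)]] by blast
      qed
    qed
    note Zsub = this
    have "sdim (n * n) Z = sdim (n * n) {x \<in> Z. x $ 0 = 0} + (if \<exists>x \<in> Z. x $ 0 \<noteq> 0 then 1 else 0)"
    proof (rule sdim_functional[OF Zsub])
      show "(x + y) $ 0 = x $ 0 + y $ 0" if "x \<in> Z" "y \<in> Z" for x y :: "'a vec"
        by (rule index_add_vec(1)) (use nn carrier_vecD[OF Z_carrier[OF that(2)]] in simp)
      show "(c \<cdot>\<^sub>v x) $ 0 = c * x $ 0" if "x \<in> Z" for c and x :: "'a vec"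
        by (rule index_smult_vec(1)) (use nn carrier_vecD[OF Z_carrier[OF that]] in simp)
    qed
    also have "{x \<in> Z. x $ 0 = 0} = {0\<^sub>v (n * n)}"
    proof (intro equalityI subsetI)
      fix x assume "x \<in> {x \<in> Z. x $ 0 = 0}"
      hence x: "x \<in> Z" "x $ 0 = 0" by auto
      obtain X where X: "X \<in> carrier_mat n n" "x = mat_to_vec n X" by (rule mat_to_vec_cases[OF Z_carrier[OF x(1)]])
      obtain c where c: "X = c \<cdot>\<^sub>m 1\<^sub>m n" using x(1) unfolding X(2) Z_iff[OF X(1)] by blast
      have "x = c \<cdot>\<^sub>v ?one" unfolding X(2) c by (rule mat_to_vec_smult) simp
      have "x $ 0 = c * ?one $ 0" unfolding \<open>x = c \<cdot>\<^sub>v ?one\<close> by (rule index_smult_vec(1)) (use nn in simp)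
      hence "c = 0" unfolding x(2) one0 by simp
      have "x = 0 \<cdot>\<^sub>v ?one" using \<open>x = c \<cdot>\<^sub>v ?one\<close> unfolding \<open>c = 0\<close> .
      also have "\<dots> = 0\<^sub>v (n * n)" by (rule eq_vecI) simp_all
      finally show "x \<in> {0\<^sub>v (n * n)}" by simp
    next
      fix x assume "x \<in> {0\<^sub>v (n * n) :: 'a vec}"
      thus "x \<in> {x \<in> Z. x $ 0 = 0}" using Zsub nn by (simp add: lin_subspace_def)
    qed
    also have "(\<exists>x \<in> Z. x $ 0 \<noteq> 0) \<longleftrightarrow> of_nat n = (0 :: 'a)"
    proof
      assume "\<exists>x \<in> Z. x $ 0 \<noteq> 0"
      then obtain x :: "'a vec" where x: "x \<in> Z" "x $ 0 \<noteq> 0" by blast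
      obtain X where X: "X \<in> carrier_mat n n" "x = mat_to_vec n X" by (rule mat_to_vec_cases[OF Z_carrier[OF x(1)]])
      obtain c where c: "X = c \<cdot>\<^sub>m 1\<^sub>m n" "c * of_nat n = 0" using x(1) unfolding X(2) Z_iff[OF X(1)] by blast
      have "x = c \<cdot>\<^sub>v ?one" unfolding X(2) c(1) by (rule mat_to_vec_smult) simp
      have "x $ 0 = c * ?one $ 0" unfolding \<open>x = c \<cdot>\<^sub>v ?one\<close> by (rule index_smult_vec(1)) (use nn in simp)
      hence "c \<noteq> 0" using x(2) by auto
      with c(2) show "of_nat n = (0 :: 'a)" by simp
    next
      assume "of_nat n = (0 :: 'a)"
      hence "1 * of_nat n = (0 :: 'a)" by simp
      moreover have "1\<^sub>m n = 1 \<cdot>\<^sub>m (1\<^sub>m n :: 'a mat)" by (rule eq_matI) auto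
      ultimately have "?one \<in> Z" unfolding Z_iff[OF one_carrier_mat] by blast
      moreover have "?one $ 0 \<noteq> 0" unfolding one0 by (rule one_neq_zero)
      ultimately show "\<exists>x \<in> Z. x $ 0 \<noteq> 0" by (rule bexI[rotated])
    qed
    finally show ?thesis by (simp add: sdim_zero)
  qed
  show ?thesis
    using sdim_preimage_scalars[OF n, of k] 1 2 Z unfolding ex Z_def[symmetric] kernel_dim_eq_sdim[OF Rk] by simp
qed

end

section \<open>Scalars and traces under powers of the operator\<close>

lemma mat_eq_one_if_fixes_all:
  fixes M :: "'a :: field mat"
  assumes M: "M \<in> carrier_mat m m" and fixes_all: "\<And>x. x \<in> carrier_vec m \<Longrightarrow> M *\<^sub>v x = x"
  shows "M = 1\<^sub>m m"
proof (rule eq_matI)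
  fix i j assume "i < dim_row (1\<^sub>m m :: 'a mat)" "j < dim_col (1\<^sub>m m :: 'a mat)"
  hence ij: "i < m" "j < m" by simp_all
  have "M $$ (i, j) = row M i \<bullet> unit_vec m j"
    using M ij scalar_prod_right_unit[of j m "row M i"] by simp
  also have "\<dots> = (M *\<^sub>v unit_vec m j) $ i" using M ij by simp
  also have "\<dots> = 1\<^sub>m m $$ (i, j)" unfolding fixes_all[OF unit_vec_carrier] using ij by simp
  finally show "M $$ (i, j) = 1\<^sub>m m $$ (i, j)" .
qed (use M in auto)

lemma kernel_dim_one: "kernel_dim (1\<^sub>m m :: 'a :: field mat) = 0"
proof -
  have "mat_kernel (1\<^sub>m m :: 'a mat) = {0\<^sub>v m}"
    unfolding mat_kernel[OF one_carrier_mat] by auto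
  thus ?thesis using kernel_dim_eq_sdim[OF one_carrier_mat, of m] sdim_zero by metis
qed

context SL_element
begin

lemma Ad_pow_eq_one:
  assumes "u ^\<^sub>m k = 1\<^sub>m n"
  shows "Ad ^\<^sub>m k = 1\<^sub>m (n * n)"
proof (rule mat_eq_one_if_fixes_all[OF pow_carrier_mat[OF Ad_closed]])
  fix x :: "'a vec" assume "x \<in> carrier_vec (n * n)"
  then obtain X where X: "X \<in> carrier_mat n n" "x = mat_to_vec n X" by (rule mat_to_vec_cases)
  show "Ad ^\<^sub>m k *\<^sub>v x = x"
    unfolding X(2) Ad_pow_mat_to_vec[OF X(1)] assms conj_mat_one[OF X(1)] ..
qed

lemma delta_pow_average:
  assumes p: "prime CHAR('a)" "q = CHAR('a) ^ a" and w: "w \<in> carrier_mat n n"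
    and avg: "mat_sum n (\<lambda>i. u ^\<^sub>m i * w * adj_mat u ^\<^sub>m i) q = 1\<^sub>m n"
  shows "(\<delta> ^^ (q - 1)) w = 1\<^sub>m n"
proof -
  let ?v = "adj_mat u"
  have vc: "?v \<in> carrier_mat n n" by (rule SL_carrierD[OF SL_adj_mat(1)[OF u]])
  have "conj_mat (u ^\<^sub>m i) w = u ^\<^sub>m i * w * ?v ^\<^sub>m i" for i
  proof (rule conj_mat_eqI[OF SL_pow_closed[OF u] w])
    note ui = pow_carrier_mat[OF uc, of i] and vi = pow_carrier_mat[OF vc, of i]
    show "u ^\<^sub>m i * w * ?v ^\<^sub>m i \<in> carrier_mat n n"
      by (rule mult_carrier_mat[OF mult_carrier_mat[OF ui w] vi])
    show "u ^\<^sub>m i * w * ?v ^\<^sub>m i * u ^\<^sub>m i = u ^\<^sub>m i * w"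
      unfolding assoc_mult_mat[OF mult_carrier_mat[OF ui w] vi ui]
        mat_pow_mult_inverse[OF vc uc SL_adj_mat(3)[OF u]]
      by (rule right_mult_one_mat[OF mult_carrier_mat[OF ui w]])
  qed
  thus ?thesis unfolding delta_pow_char(2)[OF p w] using avg by simp
qed

lemma delta_pow_commuting:
  assumes p: "prime CHAR('a)" "q = CHAR('a) ^ a" and w: "w \<in> carrier_mat n n"
    and comm: "w * u ^\<^sub>m q = u ^\<^sub>m q * w"
  shows "(\<delta> ^^ q) w = 0\<^sub>m n n"
  unfolding delta_pow_char(1)[OF p w] conj_mat_eqI[OF SL_pow_closed[OF u] w w comm]
  using w by (intro eq_matI) auto

lemma delta_pow_mult_fixed:
  assumes X: "X \<in> carrier_mat n n" and fixed: "\<delta> X = 0\<^sub>m n n" and w: "w \<in> carrier_mat n n"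
  shows "(\<delta> ^^ k) (w * X) = (\<delta> ^^ k) w * X"
proof (induction k)
  case (Suc k)
  let ?Y = "(\<delta> ^^ k) w"
  note Y = delta_pow_closed[OF w, of k]
  have cX: "conj_mat u X = X"
    by (rule mat_minus_eq_zero[OF fixed[unfolded \<delta>_def] conj_closed[OF X] X])
  have "\<delta> (?Y * X) = \<delta> ?Y * X"
    unfolding \<delta>_def[of "?Y * X"] \<delta>_def[of ?Y] conj_mat_mult[OF u Y X] cX
    by (rule minus_mult_distrib_mat[OF conj_closed[OF Y] Y X, symmetric])
  thus ?case using Suc.IH by simp
qed simp

lemma delta_pow_plus: "(\<delta> ^^ (i + j)) X = (\<delta> ^^ i) ((\<delta> ^^ j) X)"
  by (simp add: funpow_add)

context
  fixes w :: "'a mat" and q :: nat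
  assumes q: "q > 0" and w: "w \<in> carrier_mat n n" and w_top: "(\<delta> ^^ (q - 1)) w = 1\<^sub>m n"
begin

text \<open>
  A fixed matrix \<open>X\<close> commutes with \<open>u\<close>, so multiplication by \<open>X\<close> commutes with \<open>\<delta>\<close> and
  \<open>\<delta>\<^sup>q\<^sup>-\<^sup>1 (w X) = (\<delta>\<^sup>q\<^sup>-\<^sup>1 w) X = X\<close>.
\<close>

lemma fixed_in_delta_range:
  assumes X: "X \<in> carrier_mat n n" "\<delta> X = 0\<^sub>m n n" and k: "k < q"
  obtains Y where "Y \<in> carrier_mat n n" "(\<delta> ^^ k) Y = X"
proof
  have wX: "w * X \<in> carrier_mat n n" by (rule mult_carrier_mat[OF w X(1)])
  show "(\<delta> ^^ (q - 1 - k)) (w * X) \<in> carrier_mat n n" by (rule delta_pow_closed[OF wX])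
  have "k + (q - 1 - k) = q - 1" using k by simp
  thus "(\<delta> ^^ k) ((\<delta> ^^ (q - 1 - k)) (w * X)) = X"
    unfolding delta_pow_plus[symmetric] using delta_pow_mult_fixed[OF X w, of "q - 1"] w_top X(1) by simp
qed

text \<open>
  \<open>\<delta>\<^sup>k\<close> maps the kernel of \<open>\<delta>\<^sup>k\<^sup>+\<^sup>1\<close> to the kernel of \<open>\<delta>\<close>, and onto it by \<open>fixed_in_delta_range\<close>.
\<close>

lemma kernel_dim_step:
  assumes k: "k < q"
  shows "kernel_dim (D ^\<^sub>m Suc k) = kernel_dim D + kernel_dim (D ^\<^sub>m k)"
proof -
  let ?S = "mat_kernel (D ^\<^sub>m Suc k)"
  have SD: "D ^\<^sub>m Suc k *\<^sub>v x = D *\<^sub>v (D ^\<^sub>m k *\<^sub>v x)" if "x \<in> carrier_vec (n * n)" for x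
    unfolding mat_pow_Suc_left[OF D_closed] by (rule assoc_mult_mat_vec[OF D_closed D_pow_closed that])
  have Sc: "x \<in> carrier_vec (n * n)" if "x \<in> ?S" for x by (rule mat_kernelD(1)[OF D_pow_closed that])
  have "sdim (n * n) ?S = sdim (n * n) (mat_kernel D) + sdim (n * n) {x \<in> ?S. D ^\<^sub>m k *\<^sub>v x = 0\<^sub>v (n * n)}"
  proof (rule rank_nullity_subspace[OF lin_subspace_mat_kernel[OF D_pow_closed] lin_subspace_mat_kernel[OF D_closed]])
    show "D ^\<^sub>m k *\<^sub>v (x + y) = D ^\<^sub>m k *\<^sub>v x + D ^\<^sub>m k *\<^sub>v y" if "x \<in> ?S" "y \<in> ?S" for x y
      by (rule mult_add_distrib_mat_vec[OF D_pow_closed Sc[OF that(1)] Sc[OF that(2)]])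
    show "D ^\<^sub>m k *\<^sub>v (c \<cdot>\<^sub>v x) = c \<cdot>\<^sub>v (D ^\<^sub>m k *\<^sub>v x)" if "x \<in> ?S" for c x
      by (rule mult_mat_vec[OF D_pow_closed Sc[OF that]])
    show "(\<lambda>x. D ^\<^sub>m k *\<^sub>v x) ` ?S = mat_kernel D"
    proof (intro equalityI subsetI)
      fix y assume "y \<in> (\<lambda>x. D ^\<^sub>m k *\<^sub>v x) ` ?S"
      then obtain x where x: "x \<in> ?S" "y = D ^\<^sub>m k *\<^sub>v x" by blast
      have "D *\<^sub>v y = 0\<^sub>v (n * n)"
        unfolding x(2) SD[OF Sc[OF x(1)], symmetric] by (rule mat_kernelD(2)[OF D_pow_closed x(1)])
      moreover have "y \<in> carrier_vec (n * n)"
        unfolding x(2) by (rule mult_mat_vec_carrier[OF D_pow_closed Sc[OF x(1)]])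
      ultimately show "y \<in> mat_kernel D" using mat_kernelI[OF D_closed] by blast
    next
      fix y assume y: "y \<in> mat_kernel D"
      obtain X where X: "X \<in> carrier_mat n n" "y = mat_to_vec n X"
        by (rule mat_to_vec_cases[OF mat_kernelD(1)[OF D_closed y]])
      have "mat_to_vec n (\<delta> X) = mat_to_vec n (0\<^sub>m n n)"
        unfolding mat_to_vec_zero D_mat_to_vec[OF X(1), symmetric] X(2)[symmetric]
        by (rule mat_kernelD(2)[OF D_closed y])
      hence X0: "\<delta> X = 0\<^sub>m n n"
        unfolding mat_to_vec_eq_iff[OF delta_closed[OF X(1)] zero_carrier_mat] .
      obtain Y where Y: "Y \<in> carrier_mat n n" "(\<delta> ^^ k) Y = X" by (rule fixed_in_delta_range[OF X(1) X0 k])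
      have "(\<delta> ^^ Suc k) Y = 0\<^sub>m n n" using Y(2) X0 by simp
      hence "mat_to_vec n Y \<in> ?S" unfolding mat_to_vec_mem_kernel[OF Y(1)] .
      moreover have "y = D ^\<^sub>m k *\<^sub>v mat_to_vec n Y" unfolding D_pow_mat_to_vec[OF Y(1)] Y(2) X(2) ..
      ultimately show "y \<in> (\<lambda>x. D ^\<^sub>m k *\<^sub>v x) ` ?S" by (rule image_eqI[rotated])
    qed
  qed
  also have "{x \<in> ?S. D ^\<^sub>m k *\<^sub>v x = 0\<^sub>v (n * n)} = mat_kernel (D ^\<^sub>m k)"
  proof (intro equalityI subsetI)
    fix x assume "x \<in> {x \<in> ?S. D ^\<^sub>m k *\<^sub>v x = 0\<^sub>v (n * n)}"
    thus "x \<in> mat_kernel (D ^\<^sub>m k)" using mat_kernelI[OF D_pow_closed Sc] by blast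
  next
    fix x assume x: "x \<in> mat_kernel (D ^\<^sub>m k)"
    note x' = mat_kernelD[OF D_pow_closed x]
    have "D ^\<^sub>m Suc k *\<^sub>v x = 0\<^sub>v (n * n)"
      unfolding SD[OF x'(1)] x'(2) by (rule mult_mat_zero_vec[OF D_closed])
    thus "x \<in> {x \<in> ?S. D ^\<^sub>m k *\<^sub>v x = 0\<^sub>v (n * n)}"
      using mat_kernelI[OF D_pow_closed x'(1)] x'(2) by blast
  qed
  finally show ?thesis
    unfolding kernel_dim_eq_sdim[OF D_pow_closed] kernel_dim_eq_sdim[OF D_closed] .
qed

lemma kernel_dim_linear: "k \<le> q \<Longrightarrow> kernel_dim (D ^\<^sub>m k) = k * kernel_dim D"
proof (induction k)
  case 0
  have "D ^\<^sub>m 0 = 1\<^sub>m (n * n)" using carrier_matD(1)[OF D_closed] by simp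
  thus ?case using kernel_dim_one by simp
next
  case (Suc k)
  thus ?case using kernel_dim_step[of k] by simp
qed

lemma trace_eq_zero_if_delta_pow_eq_zero:
  assumes X: "X \<in> carrier_mat n n" "(\<delta> ^^ (q - 1)) X = 0\<^sub>m n n"
  shows "mat_trace X = 0"
  using trace_orthogonal[OF X(1) w X(2)] unfolding w_top right_mult_one_mat[OF X(1)] .

context
  fixes w' :: "'a mat"
  assumes w': "w' \<in> carrier_mat n n" "(\<delta> ^^ q) w' = 0\<^sub>m n n" "mat_trace w' \<noteq> 0"
begin

text \<open>
  If \<open>1 = \<delta>\<^sup>q Y\<close>, then \<open>1\<close> would be orthogonal to \<open>w'\<close>, whose trace is nonzero.
\<close>

lemma one_in_delta_range_iff: "(\<exists>X \<in> carrier_mat n n. (\<delta> ^^ k) X = 1\<^sub>m n) \<longleftrightarrow> k < q"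
proof
  assume "\<exists>X \<in> carrier_mat n n. (\<delta> ^^ k) X = 1\<^sub>m n"
  then obtain X where X: "X \<in> carrier_mat n n" "(\<delta> ^^ k) X = 1\<^sub>m n" by blast
  show "k < q"
  proof (rule ccontr)
    assume "\<not> k < q"
    hence "q + (k - q) = k" by simp
    hence "(\<delta> ^^ q) ((\<delta> ^^ (k - q)) X) = 1\<^sub>m n" unfolding delta_pow_plus[symmetric] using X(2) by simp
    from trace_orthogonal[OF w'(1) delta_pow_closed[OF X(1)] w'(2), of "k - q", unfolded this right_mult_one_mat[OF w'(1)]]
    show False using w'(3) by simp
  qed
next
  assume "k < q"
  hence "k + (q - 1 - k) = q - 1" by simp
  hence "(\<delta> ^^ k) ((\<delta> ^^ (q - 1 - k)) w) = 1\<^sub>m n" unfolding delta_pow_plus[symmetric] using w_top by simp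
  thus "\<exists>X \<in> carrier_mat n n. (\<delta> ^^ k) X = 1\<^sub>m n" using delta_pow_closed[OF w] by blast
qed

text \<open>
  For \<open>k \<ge> q\<close> take \<open>w'\<close>, which is in the kernel of \<open>\<delta>\<^sup>k\<close>. For \<open>k = q - 1\<close> the preimage of the
  scalars is \<open>ker \<delta>\<^sup>q\<^sup>-\<^sup>1\<close> together with the multiples of \<open>w\<close>, and for \<open>k < q - 1\<close> it is contained in
  \<open>ker \<delta>\<^sup>q\<^sup>-\<^sup>1\<close>; the trace vanishes on this kernel.
\<close>

lemma trace_on_preimage_scalars_iff:
  "(\<exists>X \<in> carrier_mat n n. \<exists>c. (\<delta> ^^ k) X = c \<cdot>\<^sub>m 1\<^sub>m n \<and> mat_trace X \<noteq> 0) \<longleftrightarrow>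
   k \<ge> q \<or> k = q - 1 \<and> mat_trace w \<noteq> 0"
proof
  assume "\<exists>X \<in> carrier_mat n n. \<exists>c. (\<delta> ^^ k) X = c \<cdot>\<^sub>m 1\<^sub>m n \<and> mat_trace X \<noteq> 0"
  then obtain X c where X: "X \<in> carrier_mat n n" "(\<delta> ^^ k) X = c \<cdot>\<^sub>m 1\<^sub>m n" "mat_trace X \<noteq> 0" by blast
  show "k \<ge> q \<or> k = q - 1 \<and> mat_trace w \<noteq> 0"
  proof (rule ccontr)
    assume neg: "\<not> (k \<ge> q \<or> k = q - 1 \<and> mat_trace w \<noteq> 0)"
    define Z where "Z = X + (- c) \<cdot>\<^sub>m w"
    have cw: "(- c) \<cdot>\<^sub>m w \<in> carrier_mat n n" by (rule smult_carrier_mat[OF w])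
    have Z: "Z \<in> carrier_mat n n" unfolding Z_def by (rule add_carrier_mat[OF cw])
    show False
    proof (cases "k = q - 1")
      case True
      have "(\<delta> ^^ (q - 1)) Z = c \<cdot>\<^sub>m 1\<^sub>m n + (- c) \<cdot>\<^sub>m 1\<^sub>m n"
        unfolding Z_def delta_pow_add[OF X(1) cw] delta_pow_smult[OF w] w_top X(2)[unfolded True] ..
      also have "\<dots> = 0\<^sub>m n n" by (rule eq_matI) auto
      finally have "mat_trace Z = 0" by (rule trace_eq_zero_if_delta_pow_eq_zero[OF Z])
      thus False
        unfolding Z_def mat_trace_add[OF X(1) cw] mat_trace_smult[OF w] using neg True X(3) by simp
    next
      case False
      with neg have k: "q - 1 - k \<ge> 1" "(q - 1 - k) + k = q - 1" by linarith+
      have "(\<delta> ^^ ((q - 1 - k) + k)) X = 0\<^sub>m n n"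
        unfolding delta_pow_plus X(2) by (rule delta_pow_scalar[OF k(1)])
      hence "mat_trace X = 0" unfolding k(2) by (rule trace_eq_zero_if_delta_pow_eq_zero[OF X(1)])
      with X(3) show False ..
    qed
  qed
next
  assume "k \<ge> q \<or> k = q - 1 \<and> mat_trace w \<noteq> 0"
  thus "\<exists>X \<in> carrier_mat n n. \<exists>c. (\<delta> ^^ k) X = c \<cdot>\<^sub>m 1\<^sub>m n \<and> mat_trace X \<noteq> 0"
  proof (elim disjE conjE)
    assume "k \<ge> q"
    hence "(k - q) + q = k" by simp
    hence "(\<delta> ^^ k) w' = (\<delta> ^^ (k - q)) ((\<delta> ^^ q) w')" unfolding delta_pow_plus[symmetric] by simp
    also have "\<dots> = 0\<^sub>m n n" unfolding w'(2) by (rule delta_pow_zero)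
    also have "\<dots> = 0 \<cdot>\<^sub>m 1\<^sub>m n" by (rule eq_matI) auto
    finally show ?thesis using w'(1,3) by blast
  next
    assume h: "k = q - 1" "mat_trace w \<noteq> 0"
    have "(\<delta> ^^ k) w = 1 \<cdot>\<^sub>m 1\<^sub>m n" unfolding h(1) w_top by (rule eq_matI) auto
    thus ?thesis using w h(2) by blast
  qed
qed

end

end

end

section \<open>Jordan blocks on the irreducible module\<close>

lemma power_multiplicity_Gcd:
  fixes ds :: "nat list"
  assumes p: "prime p" and pos: "0 \<notin> set ds" "ds \<noteq> []" and a: "a = multiplicity p (Gcd (set ds))"
  shows "\<And>d. d \<in> set ds \<Longrightarrow> p ^ a dvd d" and "\<exists>d \<in> set ds. \<not> p dvd d div p ^ a"
proof -
  show dvd: "p ^ a dvd d" if "d \<in> set ds" for d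
    unfolding a by (rule dvd_trans[OF multiplicity_dvd Gcd_dvd[OF that]])
  show "\<exists>d \<in> set ds. \<not> p dvd d div p ^ a"
  proof (rule ccontr)
    assume "\<not> ?thesis"
    hence h: "p dvd d div p ^ a" if "d \<in> set ds" for d using that by blast
    have "p ^ Suc a dvd Gcd (set ds)"
    proof (rule Gcd_greatest)
      fix d assume d: "d \<in> set ds"
      have "p ^ a * p dvd p ^ a * (d div p ^ a)" by (rule mult_dvd_mono[OF dvd_refl h[OF d]])
      thus "p ^ Suc a dvd d" unfolding dvd_mult_div_cancel[OF dvd[OF d]] by (simp add: mult.commute)
    qed
    moreover have "Gcd (set ds) \<noteq> 0" using pos by (auto simp: Gcd_0_iff neq_Nil_conv)
    ultimately have "Suc a \<le> a"
      unfolding a using p by (intro multiplicity_geI) (auto simp: not_prime_unit)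
    thus False by simp
  qed
qed

theorem theorem6p1:
  fixes u :: "'a :: alg_closed_field mat"
    and \<rho> :: "'a mat \<Rightarrow> 'a mat"
    and p n N \<alpha> :: nat
    and ds :: "nat list"
    and u0 u0'' :: "'a mat"
  assumes char: "CHAR('a) = p" "p > 0"
    and n: "n \<ge> 2"
    and u: "u \<in> carrier (SL_grp n)" "unipotent_mat u"
    and ds: "jordan_nf u (map (\<lambda>d. (d, 1)) ds)"
    and \<alpha>: "\<alpha> = multiplicity p (Gcd (set ds))"
    and u0: "u0 = tensor_mat u (dual_mat n u)"
    and L: "is_L_SL n (weight_add (fundamental_weight 1) (fundamental_weight (n - 1))) N \<rho>"
    and u0'': "u0'' = \<rho> u"
  defines "r \<equiv> \<lambda>m A. int (jordan_block_count m (A :: 'a mat))"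
  shows
    "(\<not> p dvd n \<longrightarrow>
        r 1 u0'' = r 1 u0 - 1 \<and> (\<forall>m\<ge>1. m \<noteq> 1 \<longrightarrow> r m u0'' = r m u0)) \<and>
     (p dvd n \<and> \<alpha> = 0 \<longrightarrow>
        r 1 u0'' = r 1 u0 - 2 \<and> (\<forall>m\<ge>1. m \<noteq> 1 \<longrightarrow> r m u0'' = r m u0)) \<and>
     (p dvd n \<and> \<alpha> > 0 \<longrightarrow>
        (p dvd n div p ^ \<alpha> \<longrightarrow>
           r (p ^ \<alpha>) u0'' = r (p ^ \<alpha>) u0 - 2 \<and> r (p ^ \<alpha> - 1) u0'' = 2 \<and>
           (\<forall>m\<ge>1. m \<noteq> p ^ \<alpha> \<and> m \<noteq> p ^ \<alpha> - 1 \<longrightarrow> r m u0'' = r m u0)) \<and>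
        (\<not> p dvd n div p ^ \<alpha> \<and> p ^ \<alpha> > 2 \<longrightarrow>
           r (p ^ \<alpha>) u0'' = r (p ^ \<alpha>) u0 - 1 \<and> r (p ^ \<alpha> - 2) u0'' = 1 \<and>
           (\<forall>m\<ge>1. m \<noteq> p ^ \<alpha> \<and> m \<noteq> p ^ \<alpha> - 2 \<longrightarrow> r m u0'' = r m u0)) \<and>
        (\<not> p dvd n div p ^ \<alpha> \<and> p ^ \<alpha> = 2 \<longrightarrow>
           r 2 u0'' = r 2 u0 - 1 \<and> (\<forall>m\<ge>1. m \<noteq> 2 \<longrightarrow> r m u0'' = r m u0)))"
proof -
  note u_SL = u(1) and u_unipotent = u(2)
  have prime_CHAR: "prime CHAR('a)" using prime_CHAR_semidom[where 'a = 'a] char by simp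
  have p: "prime p" using prime_CHAR unfolding char(1) .
  define q where "q = p ^ \<alpha>"
  have q_CHAR: "q = CHAR('a) ^ \<alpha>" unfolding q_def char(1) ..
  have q_pos: "q > 0" unfolding q_def using prime_gt_0_nat[OF p] by simp
  have n_pos: "n > 0" using n by simp
  have of_nat_0: "of_nat k = (0 :: 'a) \<longleftrightarrow> p dvd k" for k
    unfolding of_nat_eq_0_iff_char_dvd char(1) ..
  interpret SL_element n u by unfold_locales (rule u_SL)
  obtain \<Psi> where \<Psi>: "\<And>X Y. X \<in> traceless n \<Longrightarrow> Y \<in> traceless n \<Longrightarrow> \<Psi> (X + Y) = \<Psi> X + \<Psi> Y"
    "\<And>c X. X \<in> traceless n \<Longrightarrow> \<Psi> (c \<cdot>\<^sub>m X) = c \<cdot>\<^sub>v \<Psi> X"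
    "\<Psi> ` traceless n = carrier_vec N"
    "\<And>X. X \<in> traceless n \<Longrightarrow> \<Psi> X = 0\<^sub>v N \<longleftrightarrow> (\<exists>c. X = c \<cdot>\<^sub>m 1\<^sub>m n)"
    "\<And>g X. g \<in> carrier (SL_grp n) \<Longrightarrow> X \<in> traceless n \<Longrightarrow> \<Psi> (conj_mat g X) = \<rho> g *\<^sub>v \<Psi> X"
    and \<rho>c: "\<And>g. g \<in> carrier (SL_grp n) \<Longrightarrow> \<rho> g \<in> carrier_mat N N"
    and \<rho>_mult: "\<And>g h. g \<in> carrier (SL_grp n) \<Longrightarrow> h \<in> carrier (SL_grp n) \<Longrightarrow> \<rho> (g * h) = \<rho> g * \<rho> h"
    and \<rho>_one: "\<rho> (1\<^sub>m n) = 1\<^sub>m N"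
  proof (rule adjoint_module_model[OF n L], goal_cases)
    case (1 \<Psi>)
    show ?case by (rule 1(1)[of \<Psi>]) (fact 1)+
  qed
  have R: "\<rho> u \<in> carrier_mat N N" by (rule \<rho>c[OF u_SL])
  have u0_Ad: "u0 = Ad" unfolding u0 dual_mat_SL[OF u_SL] Ad_def ..

  \<comment> \<open>\<open>u\<close> has order a power of the characteristic, so it acts unipotently on both modules, and
    numbers of blocks are second differences of the dimensions \<open>d k\<close> and \<open>e k\<close> of the kernels.\<close>
  obtain k0 where k0: "(u - 1\<^sub>m n) ^\<^sub>m k0 = 0\<^sub>m n n"
  proof -
    from u_unipotent obtain n' k where nk: "u \<in> carrier_mat n' n'" "(u - 1\<^sub>m n') ^\<^sub>m k = 0\<^sub>m n' n'"
      unfolding unipotent_mat_def by blast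
    have "n' = n" using carrier_matD(1)[OF nk(1)] carrier_matD(1)[OF uc] by simp
    from that[OF nk(2)[unfolded this]] show thesis .
  qed
  obtain a where a: "u ^\<^sub>m (CHAR('a) ^ a) = 1\<^sub>m n" by (rule unipotent_pow_char_eq_one[OF uc prime_CHAR k0])
  have \<rho>_pow: "\<rho> u ^\<^sub>m k = \<rho> (u ^\<^sub>m k)" for k
  proof (induction k)
    case 0
    show ?case using carrier_matD(1)[OF R] carrier_matD(1)[OF uc] \<rho>_one by simp
  next
    case (Suc k)
    show ?case
      unfolding mat_pow_Suc_left[OF R] mat_pow_Suc_left[OF uc] Suc.IH \<rho>_mult[OF u_SL SL_pow_closed[OF u_SL]] ..
  qed
  have \<rho>_pow_one: "\<rho> u ^\<^sub>m (CHAR('a) ^ a) = 1\<^sub>m N" unfolding \<rho>_pow a by (rule \<rho>_one)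
  define d where "d k = int (kernel_dim (D ^\<^sub>m k))" for k
  define e where "e k = int (kernel_dim ((\<rho> u - 1\<^sub>m N) ^\<^sub>m k))" for k
  have r_u0: "r m u0 = 2 * d m - d (m - 1) - d (Suc m)" if "m \<ge> 1" for m
    unfolding r_def d_def u0_Ad
    by (rule jordan_block_count_unipotent[OF Ad_closed _ that])
       (rule eigenvalue_eq_one[OF Ad_closed prime_CHAR Ad_pow_eq_one[OF a]])
  have r_u0'': "r m u0'' = 2 * e m - e (m - 1) - e (Suc m)" if "m \<ge> 1" for m
    unfolding r_def e_def u0''
    by (rule jordan_block_count_unipotent[OF R _ that])
       (rule eigenvalue_eq_one[OF R prime_CHAR \<rho>_pow_one])
  note quot = kernel_dim_quotient[OF n_pos \<Psi>(1,2,3,4) \<Psi>(5)[OF u_SL] R]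

  \<comment> \<open>If \<open>p\<close> does not divide \<open>n\<close>, the matrices split into scalars and matrices of trace zero.\<close>
  have e1: "e k = d k + (if k = 0 then 1 else 0) - 1" if "\<not> p dvd n" for k
  proof -
    have n0: "of_nat n \<noteq> (0 :: 'a)" unfolding of_nat_0 using that .
    have I1: "(\<exists>X \<in> carrier_mat n n. (\<delta> ^^ k) X = 1\<^sub>m n) \<longleftrightarrow> k = 0"
    proof
      assume "\<exists>X \<in> carrier_mat n n. (\<delta> ^^ k) X = 1\<^sub>m n"
      then obtain X where X: "X \<in> carrier_mat n n" "(\<delta> ^^ k) X = 1\<^sub>m n" by blast
      show "k = 0"
      proof (rule ccontr)
        assume "k \<noteq> 0"
        hence "mat_trace ((\<delta> ^^ k) X) = 0" by (intro delta_pow_trace[OF X(1)]) simp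
        thus False unfolding X(2) mat_trace_one using n0 by simp
      qed
    next
      assume "k = 0"
      hence "(\<delta> ^^ k) (1\<^sub>m n) = 1\<^sub>m n" by simp
      thus "\<exists>X \<in> carrier_mat n n. (\<delta> ^^ k) X = 1\<^sub>m n" using one_carrier_mat by blast
    qed
    have ex_c: "\<exists>c. (\<delta> ^^ k) (1\<^sub>m n) = c \<cdot>\<^sub>m 1\<^sub>m n"
    proof (cases "k = 0")
      case True
      have "1\<^sub>m n = 1 \<cdot>\<^sub>m (1\<^sub>m n :: 'a mat)" by (rule eq_matI) auto
      thus ?thesis unfolding True funpow_0 by blast
    next
      case False
      have one: "1\<^sub>m n = 1 \<cdot>\<^sub>m (1\<^sub>m n :: 'a mat)" by (rule eq_matI) auto
      have "(\<delta> ^^ k) (1 \<cdot>\<^sub>m 1\<^sub>m n) = 0\<^sub>m n n" by (rule delta_pow_scalar) (use False in simp)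
      also have "\<dots> = 0 \<cdot>\<^sub>m 1\<^sub>m n" by (rule eq_matI) auto
      finally show ?thesis unfolding one[symmetric] by blast
    qed
    have trace_one: "mat_trace (1\<^sub>m n :: 'a mat) \<noteq> 0" unfolding mat_trace_one by (rule n0)
    obtain c where c: "(\<delta> ^^ k) (1\<^sub>m n) = c \<cdot>\<^sub>m 1\<^sub>m n" using ex_c by (rule exE)
    have I2: "\<exists>X \<in> carrier_mat n n. \<exists>c. (\<delta> ^^ k) X = c \<cdot>\<^sub>m 1\<^sub>m n \<and> mat_trace X \<noteq> 0"
      by (rule bexI[of _ "1\<^sub>m n"], rule exI[of _ c], rule conjI[OF c trace_one], rule one_carrier_mat)
    have "kernel_dim (D ^\<^sub>m k) + (if k = 0 then 1 else 0) = kernel_dim ((\<rho> u - 1\<^sub>m N) ^\<^sub>m k) + 1"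
      using quot[of k] unfolding I1 eqTrueI[OF I2] if_True if_not_P[OF n0] by linarith
    thus ?thesis unfolding d_def e_def by (simp del: pow_mat.simps split: if_splits)
  qed

  note dim = jordan_nf_unipotent_dim[OF uc ds]
  have ds_ne: "ds \<noteq> []" using dim(1) n by auto
  note gcd = power_multiplicity_Gcd[OF p dim(2) ds_ne \<alpha>, folded q_def]
  have vc: "adj_mat u \<in> carrier_mat n n" by (rule SL_carrierD[OF SL_adj_mat(1)[OF u_SL]])
  obtain w where w: "w \<in> carrier_mat n n" "mat_sum n (\<lambda>i. u ^\<^sub>m i * w * adj_mat u ^\<^sub>m i) q = 1\<^sub>m n"
    and w_trace: "mat_trace w = of_nat (n div q)"
    by (rule unipotent_average[OF prime_CHAR q_CHAR gcd(1) uc ds vc SL_adj_mat(2)[OF u_SL]])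
  note w_top = delta_pow_average[OF prime_CHAR q_CHAR w]
  obtain b where b: "b \<in> set ds" "\<not> p dvd b div q" using gcd(2) by blast
  obtain w' where w': "w' \<in> carrier_mat n n" "w' * u ^\<^sub>m q = u ^\<^sub>m q * w'" "mat_trace w' = of_nat (b div q)"
    by (rule unipotent_centralizer_trace[OF prime_CHAR q_CHAR b(1) gcd(1)[OF b(1)] uc ds])
  have w'_trace: "mat_trace w' \<noteq> 0" unfolding w'(3) of_nat_0 by (rule b(2))
  note w'_ker = delta_pow_commuting[OF prime_CHAR q_CHAR w'(1,2)]
  have d_linear: "d k = int k * d 1" if "k \<le> q" for k
  proof -
    have "kernel_dim (D ^\<^sub>m 1) = 1 * kernel_dim D"
      by (rule kernel_dim_linear[OF q_pos w(1) w_top]) (use q_pos in simp)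
    hence "kernel_dim (D ^\<^sub>m 1) = kernel_dim D" unfolding nat_mult_1 .
    thus ?thesis unfolding d_def kernel_dim_linear[OF q_pos w(1) w_top that] by (simp only: of_nat_mult)
  qed
  have e2: "e k = d k - (if k \<ge> q then 2 else 0) - (if k = q - 1 \<and> \<not> p dvd n div q then 1 else 0)"
    if "p dvd n" for k
  proof -
    have dims: "kernel_dim (D ^\<^sub>m k) + (if k < q then 1 else 0) = kernel_dim ((\<rho> u - 1\<^sub>m N) ^\<^sub>m k) + 1 +
        (if k \<ge> q \<or> k = q - 1 \<and> \<not> p dvd n div q then 1 else 0)"
      using quot[of k]
      unfolding one_in_delta_range_iff[OF q_pos w(1) w_top w'(1) w'_ker w'_trace]
        trace_on_preimage_scalars_iff[OF q_pos w(1) w_top w'(1) w'_ker w'_trace] w_trace of_nat_0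
        if_P[OF that] .
    have "int y = int x - (if q \<le> k then 2 else 0) - (if P then 1 else 0)"
      if "x + (if k < q then 1 else 0) = y + 1 + (if q \<le> k \<or> P then 1 else 0)" "P \<Longrightarrow> k < q" for x y P
      using that by (auto split: if_splits)
    note arith = this
    show ?thesis unfolding d_def e_def by (rule arith[OF dims]) (use q_pos in simp)
  qed

  have case1: "r 1 u0'' = r 1 u0 - 1 \<and> (\<forall>m\<ge>1. m \<noteq> 1 \<longrightarrow> r m u0'' = r m u0)" if "\<not> p dvd n"
  proof (intro conjI allI impI)
    show "r 1 u0'' = r 1 u0 - 1" unfolding r_u0[OF le_refl] r_u0''[OF le_refl] e1[OF that] by simp
    show "r m u0'' = r m u0" if "m \<ge> 1" "m \<noteq> 1" for m
      unfolding r_u0[OF that(1)] r_u0''[OF that(1)] e1[OF \<open>\<not> p dvd n\<close>] using that by simp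
  qed
  have r_small: "r m u0 = 0" if "m \<ge> 1" "m < q" for m
  proof -
    have "d (m - 1) = (int m - 1) * d 1" using d_linear[of "m - 1"] that by (simp add: of_nat_diff)
    thus ?thesis using r_u0[OF that(1)] d_linear[of m] d_linear[of "Suc m"] that by (simp add: algebra_simps)
  qed
  have case2: "r 1 u0'' = r 1 u0 - 2 \<and> (\<forall>m\<ge>1. m \<noteq> 1 \<longrightarrow> r m u0'' = r m u0)" if h: "p dvd n" "\<alpha> = 0"
  proof -
    have "q = 1" unfolding q_def h(2) by simp
    hence e: "e k = d k - (if k \<ge> 1 then 2 else 0)" for k using e2[OF h(1), of k] h(1) by simp
    show ?thesis
    proof (intro conjI allI impI)
      show "r 1 u0'' = r 1 u0 - 2" unfolding r_u0[OF le_refl] r_u0''[OF le_refl] e by simp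
      show "r m u0'' = r m u0" if "m \<ge> 1" "m \<noteq> 1" for m
        unfolding r_u0[OF that(1)] r_u0''[OF that(1)] e using that by simp
    qed
  qed
  \<comment> \<open>Positions of \<open>m\<close> relative to \<open>q\<close> at which the second difference can change.\<close>
  have indices: "\<exists>i j. m = Suc i \<and> q = Suc (Suc j) \<and> (Suc i < j \<or> j = Suc i \<or> i = j \<or> i = Suc j \<or> Suc j < i)"
    if "m \<ge> 1" "q \<ge> 2" for m
    by (rule exI[of _ "m - 1"], rule exI[of _ "q - 2"]) (use that in linarith)
  have q2: "q \<ge> 2" if "\<alpha> > 0"
  proof -
    have "p ^ 1 \<le> p ^ \<alpha>" by (rule power_increasing) (use that prime_gt_0_nat[OF p] in auto)
    thus ?thesis using prime_ge_2_nat[OF p] unfolding q_def by simp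
  qed
  have case3a: "r q u0'' = r q u0 - 2 \<and> r (q - 1) u0'' = 2 \<and>
      (\<forall>m\<ge>1. m \<noteq> q \<and> m \<noteq> q - 1 \<longrightarrow> r m u0'' = r m u0)" if h: "p dvd n" "\<alpha> > 0" "p dvd n div q"
  proof -
    have e: "e k = d k - (if k \<ge> q then 2 else 0)" for k using e2[OF h(1), of k] h(3) by simp
    note q2 = q2[OF h(2)]
    have diff: "r m u0'' = r m u0 - (if m = q then 2 else 0) + (if m = q - 1 then 2 else 0)" if m: "m \<ge> 1" for m
    proof -
      obtain i j where ij: "m = Suc i" "q = Suc (Suc j)"
        and "Suc i < j \<or> j = Suc i \<or> i = j \<or> i = Suc j \<or> Suc j < i"
        using indices[OF m q2] by (elim exE conjE)
      thus ?thesis unfolding r_u0[OF m] r_u0''[OF m] e unfolding ij by (elim disjE) simp_all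
    qed
    show ?thesis
    proof (intro conjI allI impI)
      show "r q u0'' = r q u0 - 2" using diff[of q] q2 by simp
      show "r (q - 1) u0'' = 2" using diff[of "q - 1"] r_small[of "q - 1"] q2 by simp
      show "r m u0'' = r m u0" if "m \<ge> 1" "m \<noteq> q \<and> m \<noteq> q - 1" for m
        using diff[OF that(1)] that(2) by simp
    qed
  qed
  have diff: "r m u0'' = r m u0 - (if m = q then 1 else 0) + (if m = q - 2 then 1 else 0)"
    if h: "p dvd n" "\<alpha> > 0" "\<not> p dvd n div q" and m: "m \<ge> 1" for m
  proof -
    have e: "e k = d k - (if k \<ge> q then 2 else 0) - (if k = q - 1 then 1 else 0)" for k
      using e2[OF h(1), of k] h(3) by simp
    obtain i j where ij: "m = Suc i" "q = Suc (Suc j)"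
      and "Suc i < j \<or> j = Suc i \<or> i = j \<or> i = Suc j \<or> Suc j < i"
      using indices[OF m q2[OF h(2)]] by (elim exE conjE)
    thus ?thesis unfolding r_u0[OF m] r_u0''[OF m] e unfolding ij by (elim disjE) simp_all
  qed
  have case3b: "r q u0'' = r q u0 - 1 \<and> r (q - 2) u0'' = 1 \<and>
      (\<forall>m\<ge>1. m \<noteq> q \<and> m \<noteq> q - 2 \<longrightarrow> r m u0'' = r m u0)"
    if h: "p dvd n" "\<alpha> > 0" "\<not> p dvd n div q" "q > 2"
  proof (intro conjI allI impI)
    show "r q u0'' = r q u0 - 1" using diff[OF h(1-3), of q] h(4) by simp
    show "r (q - 2) u0'' = 1" using diff[OF h(1-3), of "q - 2"] r_small[of "q - 2"] h(4) by simp
    show "r m u0'' = r m u0" if "m \<ge> 1" "m \<noteq> q \<and> m \<noteq> q - 2" for m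
      using diff[OF h(1-3) that(1)] that(2) by simp
  qed
  have case3c: "r 2 u0'' = r 2 u0 - 1 \<and> (\<forall>m\<ge>1. m \<noteq> 2 \<longrightarrow> r m u0'' = r m u0)"
    if h: "p dvd n" "\<alpha> > 0" "\<not> p dvd n div q" "q = 2"
  proof (intro conjI allI impI)
    show "r 2 u0'' = r 2 u0 - 1" using diff[OF h(1-3), of 2] unfolding h(4) by simp
    show "r m u0'' = r m u0" if "m \<ge> 1" "m \<noteq> 2" for m
      using diff[OF h(1-3) that(1)] that unfolding h(4) by simp
  qed
  show ?thesis
    unfolding q_def[symmetric]
    by (rule conjI[OF impI[OF case1] conjI[OF impI[OF case2] impI[OF conjI[OF impI[OF case3a]
      conjI[OF impI[OF case3b] impI[OF case3c]]]]]]) ((elim conjE)?, assumption)+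
qed

end
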